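(* Let $n\ge2$ and $\gamma\in(0,\tfrac n2)$. The positive function $$v_\infty(t)=C(\cosh t)^{-\frac{n-2\gamma}{2}},\qquad\text{with}\quad C=\left(c_{n,\gamma}\,\frac{\Gamma(\frac n2-\gamma)}{\Gamma(\frac n2+\gamma)}\right)^{-\frac{n-2\gamma}{4\gamma}},$$ is a smooth solution of the fractional Yamabe problem $$P_\gamma^{g_0}(v)=c_{n,\gamma}\,v^{\frac{n+2\gamma}{n-2\gamma}}\quad\text{on }\mathbb R\times\mathbb S^{n-1},$$ and the constant satisfies $C>1$.
   Context: The constant is $$c_{n,\gamma}=2^{2\gamma}\left(\frac{\Gamma(\frac12(\frac n2+\gamma))}{\Gamma(\frac12(\frac n2-\gamma))}\right)^2.$$ The fractional Laplacian $(-\Delta)^\gamma$ on $\mathbb R^n$ is the Fourier multiplier with symbol $|\xi|^{2\gamma}$. With $r=e^{-t}$ and $g_0=dt^2+g_{\mathbb S^{n-1}}$, so that $|dx|^2=e^{-2t}g_0$ on $\mathbb R^n\setminus\{0\}\cong\mathbb R\times\mathbb S^{n-1}$, the conformal fractional Laplacian $P_\gamma^{g_0}$ on $\mathbb R\times\mathbb S^{n-1}$ is given, for $\phi\in C_0^\infty(\mathbb R\times\mathbb S^{n-1})$, by $$(P_\gamma^{g_0}\phi)(t,\theta)=r^{\frac{n+2\gamma}{2}}\,\big((-\Delta)^\gamma w\big)(r\theta),\qquad w(r\theta)=r^{-\frac{n-2\gamma}{2}}\phi(-\ln r,\theta),\qquad r=e^{-t}.$$ For bounded smooth $v$ on $\mathbb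 R\times\mathbb S^{n-1}$, $P_\gamma^{g_0}v$ is understood by duality (the operator being symmetric): $\int (P_\gamma^{g_0}v)\,\phi\,dvol_{g_0}=\int v\,(P_\gamma^{g_0}\phi)\,dvol_{g_0}$ for all $\phi\in C_0^\infty(\mathbb R\times\mathbb S^{n-1})$. A function $v(t)$ is regarded as a function on $\mathbb R\times\mathbb S^{n-1}$ independent of $\theta$. *)

theory Defs
  imports "HOL-Analysis.Analysis"
begin

text \<open>
  On an open set of a finite-dimensional space this is k-fold continuous differentiability:
  all iterated directional derivatives up to order \<open>k\<close> exist and are continuous.
\<close>

primrec Ck_on :: "nat \<Rightarrow> 'a::real_normed_vector set \<Rightarrow> ('a \<Rightarrow> 'b::real_normed_vector) \<Rightarrow> bool"
  where
    "Ck_on 0 U f \<longleftrightarrow> continuous_on U f"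
  | "Ck_on (Suc k) U f \<longleftrightarrow>
       (\<forall>x\<in>U. f differentiable (at x)) \<and>
       (\<forall>h. Ck_on k U (\<lambda>x. frechet_derivative f (at x) h))"

text \<open>
  Smoothness on an embedded submanifold \<open>X\<close> of the ambient space: \<open>f\<close> is locally the restriction of
  a smooth function on an open set.  Values of \<open>f\<close> off \<open>X\<close> are irrelevant.
\<close>

definition smooth_on :: "'a::real_normed_vector set \<Rightarrow> ('a \<Rightarrow> 'b::real_normed_vector) \<Rightarrow> bool"
  where "smooth_on X f \<longleftrightarrow>
    (\<forall>x\<in>X. \<exists>U g. open U \<and> x \<in> U \<and> (\<forall>k. Ck_on k U g) \<and> (\<forall>y\<in>U \<inter> X. g y = f y))"

definition cylinder :: "(real \<times> (real ^ 'n::finite)) set"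
  where "cylinder = UNIV \<times> sphere 0 1"

text \<open>
  Surface measure of the round unit sphere, as the cone measure:
  \<open>\<sigma>(A) = n \<cdot> Lebesgue {r \<theta> | 0 < r < 1, \<theta> \<in> A}\<close>, i.e. the measure for which
  \<open>dx = r^(n-1) dr d\<sigma>(\<theta>)\<close>.
\<close>

definition sphere_measure :: "(real ^ 'n::finite) measure"
  where "sphere_measure =
    scale_measure (of_nat CARD('n))
      (distr (restrict_space lborel (ball 0 1 - {0})) (restrict_space borel (sphere 0 1))
        (\<lambda>x. x /\<^sub>R norm x))"

text \<open>The Riemannian volume of \<open>g\<^sub>0 = dt\<^sup>2 + g_S\<close>, with underlying space \<^term>\<open>cylinder\<close>.\<close>

definition cylinder_measure :: "(real \<times> (real ^ 'n::finite)) measure"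
  where "cylinder_measure = lborel \<Otimes>\<^sub>M sphere_measure"

text \<open>Test functions are complex-valued, so real ones are included.\<close>

definition test_functions :: "(real \<times> (real ^ 'n::finite) \<Rightarrow> complex) set"
  where "test_functions =
    {\<phi>. smooth_on cylinder \<phi> \<and>
        (\<exists>K. compact K \<and> K \<subseteq> cylinder \<and> (\<forall>z\<in>cylinder - K. \<phi> z = 0))}"

definition fourier_transform :: "(real ^ 'n::finite \<Rightarrow> complex) \<Rightarrow> real ^ 'n \<Rightarrow> complex"
  where "fourier_transform w \<xi> = (LINT x|lborel. exp (- \<i> * complex_of_real (\<xi> \<bullet> x)) * w x)"

definition inverse_fourier_transform :: "(real ^ 'n::finite \<Rightarrow> complex) \<Rightarrow> real ^ 'n \<Rightarrow> complex"
  where "inverse_fourier_transform w x =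
    (LINT \<xi>|lborel. exp (\<i> * complex_of_real (\<xi> \<bullet> x)) * w \<xi>) / complex_of_real ((2 * pi) ^ CARD('n))"

definition frac_laplacian :: "real \<Rightarrow> (real ^ 'n::finite \<Rightarrow> complex) \<Rightarrow> real ^ 'n \<Rightarrow> complex"
  where "frac_laplacian \<gamma> w =
    inverse_fourier_transform
      (\<lambda>\<xi>. complex_of_real (norm \<xi> powr (2 * \<gamma>)) * fourier_transform w \<xi>)"

text \<open>
  The function \<open>w\<close> on \<open>\<real>\<^sup>n\<close> associated with \<open>\<phi>\<close>.  Its value at the origin is \<open>0\<close>, because
  \<open>0 powr a = 0\<close>; for a test function \<open>\<phi>\<close> this is the smooth extension.
\<close>

definition euclidean_lift ::
    "real \<Rightarrow> (real \<times> (real ^ 'n::finite) \<Rightarrow> complex) \<Rightarrow> real ^ 'n \<Rightarrow> complex"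
  where "euclidean_lift \<gamma> \<phi> x =
    complex_of_real (norm x powr (- ((real CARD('n) - 2 * \<gamma>) / 2)))
      * \<phi> (- ln (norm x), x /\<^sub>R norm x)"

definition conf_frac_laplacian ::
    "real \<Rightarrow> (real \<times> (real ^ 'n::finite) \<Rightarrow> complex) \<Rightarrow> real \<times> (real ^ 'n) \<Rightarrow> complex"
  where "conf_frac_laplacian \<gamma> \<phi> = (\<lambda>(t, \<theta>).
    let r = exp (- t) in
    complex_of_real (r powr ((real CARD('n) + 2 * \<gamma>) / 2))
      * frac_laplacian \<gamma> (euclidean_lift \<gamma> \<phi>) (r *\<^sub>R \<theta>))"

text \<open>
  \<open>P\<^sub>\<gamma> v = u\<close> by duality, for bounded smooth \<open>v\<close>.  Both pairings are required to converge
  absolutely, so that no integral takes its default value \<open>0\<close>.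
\<close>

definition has_conf_frac_laplacian ::
    "real \<Rightarrow> (real \<times> (real ^ 'n::finite) \<Rightarrow> real) \<Rightarrow> (real \<times> (real ^ 'n) \<Rightarrow> real) \<Rightarrow> bool"
  where "has_conf_frac_laplacian \<gamma> v u \<longleftrightarrow>
    smooth_on cylinder v \<and> bounded (v ` cylinder) \<and>
    (\<forall>\<phi>\<in>test_functions.
      integrable cylinder_measure (\<lambda>z. complex_of_real (u z) * \<phi> z) \<and>
      integrable cylinder_measure (\<lambda>z. complex_of_real (v z) * conf_frac_laplacian \<gamma> \<phi> z) \<and>
      (LINT z|cylinder_measure. complex_of_real (u z) * \<phi> z) =
      (LINT z|cylinder_measure. complex_of_real (v z) * conf_frac_laplacian \<gamma> \<phi> z))"

definition yamabe_const :: "nat \<Rightarrow> real \<Rightarrow> real"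
  where "yamabe_const n \<gamma> =
    2 powr (2 * \<gamma>) * (Gamma ((real n / 2 + \<gamma>) / 2) / Gamma ((real n / 2 - \<gamma>) / 2))\<^sup>2"

end

theory Submission
  imports Defs "HOL-Probability.Characteristic_Functions"
begin

text \<open>
  Put \<open>a = n/2 - \<gamma>\<close> and \<open>b = n/2 + \<gamma>\<close>.  With \<open>r = exp (- t)\<close> one has \<open>2 r cosh t = 1 + r\<^sup>2\<close>, so
  \<open>r\<^sup>-\<^sup>a v(t) = C 2\<^sup>a u\<^sub>a(r)\<close> for the bubble \<open>u\<^sub>a(x) = (1 + |x|\<^sup>2) powr (- a)\<close>.  In the coordinates
  \<open>x = exp (- t) \<theta>\<close> the volume of the cylinder is \<open>|x| powr (- n) dx\<close>
  (\<open>nn_integral_cylinder_measure\<close>), and the pairings on the cylinder become pairings on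
  \<open>\<real>\<^sup>n\<close> with the smooth lift \<open>w\<close> of the test function.  The equation thus says that
  \<open>\<integral> u\<^sub>a (-\<Delta>)\<^sup>\<gamma> w = 4\<^sup>\<gamma> \<Gamma>(b) / \<Gamma>(a) \<integral> u\<^sub>b w\<close> for every smooth \<open>w\<close> of compact support
  (\<open>bubble_duality\<close>); the constant \<open>C\<close> only adjusts the factor in front.

  This identity holds because the bubble is a superposition of Gaussians:
  \<open>\<Gamma>(a) u\<^sub>a(x) = \<integral> s\<^sup>a\<^sup>-\<^sup>1 exp (- s) exp (- s |x|\<^sup>2) ds\<close>.  On the frequency side this becomes, up
  to a constant, \<open>\<integral> s\<^sup>-\<^sup>\<gamma>\<^sup>-\<^sup>1 exp (- s - q/s) ds\<close> with \<open>q = |\<xi>|\<^sup>2/4\<close>.  The reflection \<open>s \<mapsto> q/s\<close>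
  turns it into \<open>q\<^sup>-\<^sup>\<gamma> \<integral> s\<^sup>\<gamma>\<^sup>-\<^sup>1 exp (- s - q/s) ds\<close> (\<open>gamma_density_reflection\<close>), and the factor
  \<open>q\<^sup>-\<^sup>\<gamma>\<close> cancels the symbol \<open>|\<xi>|\<^sup>2\<^sup>\<gamma>\<close>.  Undoing the first two steps gives \<open>u\<^sub>b\<close>.  All steps are
  exchanges of integrals.

  The exchanges need two decay estimates.  The Fourier transform of \<open>w\<close> decays faster than any
  power, by partial integration (\<open>fourier_transform_rapid_decay\<close>).  Since \<open>u\<^sub>a\<close> is not
  integrable, the integrability of \<open>u\<^sub>a (-\<Delta>)\<^sup>\<gamma> w\<close> rests on the other factor: it is bounded by a multiple
  of \<open>u\<^sub>b\<close> (\<open>frac_laplacian_bound\<close>).  To see this, \<open>|\<xi>|\<^sup>2\<^sup>\<gamma>\<close> is written as an integral over \<open>\<tau>\<close> of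
  \<open>\<tau>\<^sup>-\<^sup>\<gamma>\<^sup>-\<^sup>1 e (1 - e)\<^sup>m\<close> with \<open>e = exp (- \<tau> |\<xi>|\<^sup>2)\<close> and \<open>m > \<gamma>\<close>, a combination of heat semigroups at the
  times \<open>\<tau>, \<dots>, (m + 1) \<tau>\<close>; away from the support of \<open>w\<close> their kernels are Gaussian tails.

  Finally \<open>C > 1\<close>, since by the duplication formula the base of the power in \<open>C\<close> is the quotient of
  the values of \<open>\<Gamma>(t + 1/2) / \<Gamma>(t)\<close> at \<open>t = a/2\<close> and at \<open>t = b/2\<close>, and this function increases strictly
  because the digamma function does.
\<close>

section \<open>Calculus of continuously differentiable functions\<close>

text \<open>
  The derivatives in \<^const>\<open>Ck_on\<close> are taken in the ambient space; on an open set they see only the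
  values there.
\<close>

lemma Ck_on_cong:
  assumes "open U" "\<And>x. x \<in> U \<Longrightarrow> f x = g x" "Ck_on k U f"
  shows "Ck_on k U g"
  using assms(2,3)
proof (induction k arbitrary: f g)
  case 0
  then show ?case using continuous_on_cong[of U U f g] by simp
next
  case (Suc k)
  have tr: "(g has_derivative f') (at x)" if "x \<in> U" "(f has_derivative f') (at x)" for x f'
    using has_derivative_transform_within_open[OF that(2) \<open>open U\<close> that(1)] Suc.prems(1) by metis
  have d: "f differentiable (at x)" if "x \<in> U" for x
    using Suc.prems(2) that by simp
  have fd: "frechet_derivative f (at x) = frechet_derivative g (at x)" if "x \<in> U" for x
    using frechet_derivative_at[OF tr[OF that]] d[OF that] frechet_derivative_works by blast
  have "g differentiable (at x)" if "x \<in> U" for x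
    using tr[OF that] d[OF that] unfolding differentiable_def by blast
  moreover have "Ck_on k U (\<lambda>x. frechet_derivative g (at x) h)" for h
    using Suc.IH[of "\<lambda>x. frechet_derivative f (at x) h"] fd Suc.prems(2) by simp
  ultimately show ?case by simp
qed

text \<open>
  The recursion of \<^const>\<open>Ck_on\<close> refers to \<^const>\<open>frechet_derivative\<close>; this rule accepts any
  explicitly known derivative.
\<close>

lemma Ck_on_SucI:
  assumes "open U" "\<And>x. x \<in> U \<Longrightarrow> (f has_derivative f' x) (at x)"
    and "\<And>h. Ck_on k U (\<lambda>x. f' x h)"
  shows "Ck_on (Suc k) U f"
proof -
  have "frechet_derivative f (at x) = f' x" if "x \<in> U" for x
    using frechet_derivative_at[OF assms(2)[OF that]] by simp
  then show ?thesis
    using assms(2) Ck_on_cong[OF \<open>open U\<close> _ assms(3)]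
    by (auto simp: differentiable_def)
qed

lemma Ck_on_SucD:
  assumes "Ck_on (Suc k) U f"
  shows "\<And>x. x \<in> U \<Longrightarrow> (f has_derivative frechet_derivative f (at x)) (at x)"
    and "\<And>h. Ck_on k U (\<lambda>x. frechet_derivative f (at x) h)"
  using assms frechet_derivative_works by auto

lemma Ck_on_lower: "Ck_on (Suc k) U f \<Longrightarrow> Ck_on k U f"
proof (induction k arbitrary: f)
  case 0
  then show ?case
    by (auto intro!: continuous_at_imp_continuous_on differentiable_imp_continuous_within)
next
  case (Suc k)
  from Suc.prems have "\<forall>x\<in>U. f differentiable at x"
    "\<And>h. Ck_on (Suc k) U (\<lambda>x. frechet_derivative f (at x) h)" by simp_all
  with Suc.IH show ?case by simp
qed

lemma Ck_on_imp_continuous: "Ck_on k U f \<Longrightarrow> continuous_on U f"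
  by (induction k) (use Ck_on_lower in \<open>auto simp del: Ck_on.simps(2)\<close>)

lemma Ck_on_subset: "Ck_on k U f \<Longrightarrow> W \<subseteq> U \<Longrightarrow> Ck_on k W f"
  by (induction k arbitrary: f) (auto intro: continuous_on_subset)

text \<open>
  Needed where a function has different smooth formulas near different points.
\<close>

lemma Ck_on_local:
  assumes "\<And>x. x \<in> U \<Longrightarrow> \<exists>W. open W \<and> x \<in> W \<and> Ck_on k W f"
  shows "Ck_on k U f"
  using assms
proof (induction k arbitrary: f)
  case 0
  have "isCont f x" if x: "x \<in> U" for x
  proof -
    from 0[OF x] obtain W where "open W" "x \<in> W" "continuous_on W f" by auto
    then show ?thesis by (simp add: continuous_on_eq_continuous_at)
  qed
  then show ?case by (simp add: continuous_at_imp_continuous_on)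
next
  case (Suc k)
  have "f differentiable (at x)" if "x \<in> U" for x
    using Suc.prems[OF that] by auto
  moreover have "Ck_on k U (\<lambda>x. frechet_derivative f (at x) h)" for h
    using Suc.prems by (intro Suc.IH) fastforce
  ultimately show ?case by simp
qed

lemma Ck_on_const: "Ck_on k U (\<lambda>x. c)"
  by (induction k arbitrary: c) auto

lemma Ck_on_bounded_linear:
  assumes "bounded_linear f"
  shows "Ck_on k U f"
proof -
  have "Ck_on k UNIV f"
  proof (cases k)
    case 0
    then show ?thesis using assms by (simp add: linear_continuous_on)
  next
    case (Suc m)
    have "Ck_on (Suc m) UNIV f"
      by (rule Ck_on_SucI[where f' = "\<lambda>_. f"])
        (use assms in \<open>auto intro: bounded_linear_imp_has_derivative Ck_on_const\<close>)
    then show ?thesis by (simp only: Suc)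
  qed
  then show ?thesis by (rule Ck_on_subset) simp
qed

lemma Ck_on_add:
  assumes "open U" "Ck_on k U f" "Ck_on k U g"
  shows "Ck_on k U (\<lambda>x. f x + g x)"
  using assms(2,3)
proof (induction k arbitrary: f g)
  case 0
  then show ?case by (simp add: continuous_on_add)
next
  case (Suc k)
  note f = Ck_on_SucD[OF Suc.prems(1)] and g = Ck_on_SucD[OF Suc.prems(2)]
  show ?case
    by (rule Ck_on_SucI[OF \<open>open U\<close> has_derivative_add[OF f(1) g(1)] Suc.IH[OF f(2) g(2)]])
qed

lemma Ck_on_sum:
  assumes "open U" "\<And>i. i \<in> I \<Longrightarrow> Ck_on k U (f i)"
  shows "Ck_on k U (\<lambda>x. \<Sum>i\<in>I. f i x)"
  using assms(2)
  by (induction I rule: infinite_finite_induct) (auto intro: Ck_on_const Ck_on_add[OF \<open>open U\<close>])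

lemma Ck_on_scaleR:
  assumes "open U" "Ck_on k U f" "Ck_on k U g"
  shows "Ck_on k U (\<lambda>x. f x *\<^sub>R g x)"
  using assms(2,3)
proof (induction k arbitrary: f g)
  case (Suc k)
  note f = Ck_on_SucD[OF Suc.prems(1)] and g = Ck_on_SucD[OF Suc.prems(2)]
  show ?case
    by (rule Ck_on_SucI[OF \<open>open U\<close> has_derivative_scaleR[OF f(1) g(1)]],
        assumption, assumption,
        rule Ck_on_add[OF \<open>open U\<close> Suc.IH[OF Ck_on_lower[OF Suc.prems(1)] g(2)]
          Suc.IH[OF f(2) Ck_on_lower[OF Suc.prems(2)]]])
qed (simp add: continuous_on_scaleR)

lemma Ck_on_linear_comp:
  assumes "open U" "bounded_linear l" "Ck_on k U f"
  shows "Ck_on k U (\<lambda>x. l (f x))"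
  using assms(3)
proof (induction k arbitrary: f)
  case 0
  then show ?case using bounded_linear.continuous_on[OF assms(2)] by simp
next
  case (Suc k)
  note f = Ck_on_SucD[OF Suc.prems(1)]
  show ?case
    by (rule Ck_on_SucI[OF \<open>open U\<close> bounded_linear.has_derivative[OF assms(2) f(1)] Suc.IH[OF f(2)]])
qed

text \<open>By the chain rule, \<open>D(f \<circ> g)(x) h\<close> is the sum over the basis vectors \<open>b\<close> of
  \<open>(Dg(x) h \<bullet> b) (D\<^sub>b f)(g x)\<close>, a combination of products of functions of one class lower.\<close>

lemma Ck_on_compose:
  fixes f :: "'b::euclidean_space \<Rightarrow> 'c::real_normed_vector"
  assumes "open U" "Ck_on k U g" "Ck_on k W f" "\<And>x. x \<in> U \<Longrightarrow> g x \<in> W"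
  shows "Ck_on k U (\<lambda>x. f (g x))"
  using assms(2,3)
proof (induction k arbitrary: f)
  case 0
  then show ?case using assms(4) continuous_on_compose2[of W f U g] by auto
next
  case (Suc k)
  note f = Ck_on_SucD[OF Suc.prems(2)] and g = Ck_on_SucD[OF Suc.prems(1)]
  let ?f' = "\<lambda>x h. \<Sum>b\<in>Basis. (frechet_derivative g (at x) h \<bullet> b) *\<^sub>R
      frechet_derivative f (at (g x)) b"
  show ?case
  proof (rule Ck_on_SucI[OF \<open>open U\<close>, where f' = ?f'])
    fix x assume x: "x \<in> U"
    have "((\<lambda>x. f (g x)) has_derivative
       (\<lambda>h. frechet_derivative f (at (g x)) (frechet_derivative g (at x) h))) (at x)"
      by (rule has_derivative_compose[OF g(1)[OF x] f(1)[OF assms(4)[OF x]]])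
    moreover have "frechet_derivative f (at (g x)) (frechet_derivative g (at x) h) = ?f' x h" for h
    proof -
      interpret l: bounded_linear "frechet_derivative f (at (g x))"
        by (rule has_derivative_bounded_linear[OF f(1)[OF assms(4)[OF x]]])
      have "frechet_derivative f (at (g x)) (frechet_derivative g (at x) h) =
        frechet_derivative f (at (g x))
          (\<Sum>b\<in>Basis. (frechet_derivative g (at x) h \<bullet> b) *\<^sub>R b)"
        by (simp add: euclidean_representation)
      then show ?thesis by (simp add: l.sum l.scaleR)
    qed
    ultimately show "((\<lambda>x. f (g x)) has_derivative ?f' x) (at x)" by simp
  next
    fix h
    have "Ck_on k U (\<lambda>x. frechet_derivative f (at (g x)) b)" for b
      by (rule Suc.IH[OF Ck_on_lower[OF Suc.prems(1)] f(2)])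
    moreover have "Ck_on k U (\<lambda>x. frechet_derivative g (at x) h \<bullet> b)" for b
      by (rule Ck_on_linear_comp[OF \<open>open U\<close> bounded_linear_inner_left g(2)])
    ultimately show "Ck_on k U (\<lambda>x. ?f' x h)"
      by (intro Ck_on_sum[OF \<open>open U\<close>] Ck_on_scaleR[OF \<open>open U\<close>])
  qed
qed

lemma Ck_on_Pair:
  assumes "open U" "Ck_on k U f" "Ck_on k U g"
  shows "Ck_on k U (\<lambda>x. (f x, g x))"
proof -
  have "Ck_on k U (\<lambda>x. (f x, 0 :: 'c))"
    by (rule Ck_on_linear_comp[OF \<open>open U\<close> _ assms(2), where l = "\<lambda>y. (y, 0)"])
      (simp add: bounded_linear_Pair bounded_linear_ident bounded_linear_zero)
  moreover have "Ck_on k U (\<lambda>x. (0 :: 'b, g x))"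
    by (rule Ck_on_linear_comp[OF \<open>open U\<close> _ assms(3), where l = "\<lambda>y. (0, y)"])
      (simp add: bounded_linear_Pair bounded_linear_ident bounded_linear_zero)
  ultimately have "Ck_on k U (\<lambda>x. (f x, 0) + (0, g x))"
    by (rule Ck_on_add[OF \<open>open U\<close>])
  then show ?thesis by simp
qed

lemma Ck_on_real_SucI:
  fixes f :: "real \<Rightarrow> real"
  assumes "open U" "\<And>x. x \<in> U \<Longrightarrow> (f has_real_derivative f' x) (at x)" "Ck_on k U f'"
  shows "Ck_on (Suc k) U f"
proof (rule Ck_on_SucI[OF \<open>open U\<close>, where f' = "\<lambda>x h. h * f' x"])
  show "(f has_derivative (\<lambda>h. h * f' x)) (at x)" if "x \<in> U" for x
    using assms(2)[OF that] by (simp add: has_field_derivative_def mult_commute_abs)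
  show "Ck_on k U (\<lambda>x. h * f' x)" for h
    using Ck_on_scaleR[OF \<open>open U\<close> Ck_on_const assms(3)] by simp
qed

lemma Ck_on_powr: "Ck_on k {0::real<..} (\<lambda>x. x powr a)"
proof (induction k arbitrary: a)
  case (Suc k)
  have "Ck_on k {0::real<..} (\<lambda>x. a *\<^sub>R x powr (a - 1))"
    by (intro Ck_on_scaleR Ck_on_const Suc.IH) auto
  then show ?case
    by (intro Ck_on_real_SucI[where f' = "\<lambda>x. a * x powr (a - 1)"])
      (auto intro!: derivative_eq_intros)
qed (auto intro!: continuous_intros)

lemma Ck_on_ln: "Ck_on k {0::real<..} ln"
proof (cases k)
  case 0
  then show ?thesis by (auto intro!: continuous_intros)
next
  case (Suc m)
  have "Ck_on m {0::real<..} (\<lambda>x. 1 / x)"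
    by (rule Ck_on_cong[OF _ _ Ck_on_powr[where a = "-1"]]) (auto simp: powr_minus_divide)
  then have "Ck_on (Suc m) {0::real<..} ln"
    by (intro Ck_on_real_SucI[where f' = "\<lambda>x. 1 / x"]) (auto intro!: derivative_eq_intros)
  then show ?thesis by (simp only: Suc)
qed

lemma Ck_on_exp: "Ck_on k UNIV (exp :: real \<Rightarrow> real)"
proof (induction k)
  case (Suc k)
  then show ?case by (intro Ck_on_real_SucI[where f' = exp]) (auto intro!: derivative_eq_intros)
qed (auto intro!: continuous_intros)

lemma Ck_on_cosh: "Ck_on k UNIV (cosh :: real \<Rightarrow> real)"
proof -
  have "Ck_on k UNIV (\<lambda>x::real. - x)"
    by (rule Ck_on_bounded_linear) (simp add: bounded_linear_minus bounded_linear_ident)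
  then have "Ck_on k UNIV (\<lambda>x::real. exp (- x))"
    by (rule Ck_on_compose[OF open_UNIV _ Ck_on_exp]) simp
  then have "Ck_on k UNIV (\<lambda>x::real. exp x + exp (- x))"
    by (rule Ck_on_add[OF open_UNIV Ck_on_exp])
  then have "Ck_on k UNIV (\<lambda>x::real. (1/2) *\<^sub>R (exp x + exp (- x)))"
    by (rule Ck_on_scaleR[OF open_UNIV Ck_on_const])
  moreover have "(\<lambda>x::real. (1/2) *\<^sub>R (exp x + exp (- x))) = cosh"
    by (auto simp: cosh_def)
  ultimately show ?thesis by simp
qed

lemma Ck_on_inner_self: "Ck_on k UNIV (\<lambda>x::'a::euclidean_space. x \<bullet> x)"
proof -
  have "Ck_on k UNIV (\<lambda>x::'a. x \<bullet> b)" for b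
    by (rule Ck_on_bounded_linear) (rule bounded_linear_inner_left)
  then have "Ck_on k UNIV (\<lambda>x::'a. \<Sum>b\<in>Basis. (x \<bullet> b) *\<^sub>R (x \<bullet> b))"
    by (intro Ck_on_sum[OF open_UNIV] Ck_on_scaleR[OF open_UNIV])
  then show ?thesis
    by (subst euclidean_inner) simp
qed

lemma Ck_on_norm: "Ck_on k (- {0::'a::euclidean_space}) norm"
proof -
  have "Ck_on k (- {0::'a}) (\<lambda>x. (x \<bullet> x) powr (1/2))"
    by (rule Ck_on_compose[OF _ Ck_on_subset[OF Ck_on_inner_self] Ck_on_powr]) auto
  then show ?thesis
    by (rule Ck_on_cong[rotated 2]) (auto simp: norm_eq_sqrt_inner powr_half_sqrt)
qed

lemma Ck_on_log_polar:
  "Ck_on k (- {0::'a::euclidean_space}) (\<lambda>x. (- ln (norm x), x /\<^sub>R norm x))"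
proof -
  have o: "open (- {0::'a})" by auto
  have "Ck_on k (- {0::'a}) (\<lambda>x. norm x powr (-1))"
    by (rule Ck_on_compose[OF o Ck_on_norm Ck_on_powr]) auto
  then have "Ck_on k (- {0::'a}) (\<lambda>x. inverse (norm x))"
    by (rule Ck_on_cong[OF o, rotated]) (auto simp: powr_minus)
  moreover have "Ck_on k (- {0::'a}) (\<lambda>x. x)"
    by (rule Ck_on_bounded_linear) (rule bounded_linear_ident)
  ultimately have s: "Ck_on k (- {0::'a}) (\<lambda>x. inverse (norm x) *\<^sub>R x)"
    by (rule Ck_on_scaleR[OF o])
  have "Ck_on k (- {0::'a}) (\<lambda>x. ln (norm x))"
    by (rule Ck_on_compose[OF o Ck_on_norm Ck_on_ln]) auto
  then have "Ck_on k (- {0::'a}) (\<lambda>x. - ln (norm x))"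
    by (rule Ck_on_linear_comp[OF o, rotated])
      (simp add: bounded_linear_minus bounded_linear_ident)
  then show ?thesis
    using s by (rule Ck_on_Pair[OF o])
qed

section \<open>Logarithmic polar coordinates\<close>

text \<open>
  The inverse of \<open>(t, \<theta>) \<mapsto> exp (- t) \<theta>\<close>.  The origin is sent to \<open>(0, 0)\<close>, which lies off the cylinder.
\<close>

definition log_polar :: "real ^ 'n::finite \<Rightarrow> real \<times> (real ^ 'n)"
  where "log_polar x = (- ln (norm x), x /\<^sub>R norm x)"

lemma log_polar_measurable [measurable]: "log_polar \<in> borel_measurable borel"
  unfolding log_polar_def by (intro borel_measurable_Pair) measurable

lemma normalize_measurable_sphere:
  "(\<lambda>x::real^'n. x /\<^sub>R norm x) \<in> restrict_space lborel (ball 0 1 - {0}) \<rightarrow>\<^sub>M restrict_space borel (sphere 0 1)"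
  by (intro measurable_restrict_space2 measurable_restrict_space1)
    (auto simp: space_restrict_space)

lemma space_sphere_measure: "space (sphere_measure :: (real^'n) measure) = sphere 0 1"
  by (simp add: sphere_measure_def space_scale_measure space_restrict_space)

lemma sets_sphere_measure [measurable_cong]:
  "sets (sphere_measure :: (real^'n) measure) = sets (restrict_space borel (sphere 0 1))"
  by (simp add: sphere_measure_def)

lemma nn_integral_sphere_measure:
  fixes f :: "real^'n \<Rightarrow> ennreal"
  assumes [measurable]: "f \<in> borel_measurable borel"
  shows "(\<integral>\<^sup>+\<theta>. f \<theta> \<partial>sphere_measure) =
    of_nat CARD('n) * (\<integral>\<^sup>+x. f (x /\<^sub>R norm x) * indicator (ball 0 1 - {0}) x \<partial>lborel)"
proof -
  have f: "f \<in> borel_measurable (restrict_space borel (sphere 0 1))"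
    by (intro measurable_restrict_space1) measurable
  show ?thesis
    unfolding sphere_measure_def
    by (subst nn_integral_scale_measure)
      (use f in \<open>simp_all add: nn_integral_distr normalize_measurable_sphere nn_integral_restrict_space\<close>)
qed

lemma sigma_finite_sphere_measure: "sigma_finite_measure (sphere_measure :: (real^'n) measure)"
proof -
  have "emeasure (sphere_measure :: (real^'n) measure) (space sphere_measure)
      = (\<integral>\<^sup>+\<theta>. 1 \<partial>(sphere_measure :: (real^'n) measure))"
    by simp
  also have "\<dots> = of_nat CARD('n) * emeasure lborel (ball 0 1 - {0::real^'n})"
    by (subst nn_integral_sphere_measure) (auto simp: nn_integral_indicator)
  also have "\<dots> < \<infinity>"
  proof -
    have "emeasure lborel (ball 0 1 - {0::real^'n}) \<le> emeasure lborel (ball 0 (1::real) :: (real^'n) set)"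
      by (intro emeasure_mono) auto
    also have "\<dots> < \<infinity>" using emeasure_bounded_finite[of "ball 0 (1::real) :: (real^'n) set"] by auto
    finally show ?thesis
      by (auto simp: ennreal_mult_less_top ennreal_of_nat_eq_real_of_nat)
  qed
  finally have "finite_measure (sphere_measure :: (real^'n) measure)"
    by (intro finite_measureI) auto
  then show ?thesis by (simp add: finite_measure_def)
qed

lemma nn_integral_lborel_scaleR:
  fixes f :: "'a::euclidean_space \<Rightarrow> ennreal"
  assumes [measurable]: "f \<in> borel_measurable borel" and c: "c \<noteq> 0"
  shows "(\<integral>\<^sup>+x. f x \<partial>lborel) = ennreal (\<bar>c\<bar> ^ DIM('a)) * (\<integral>\<^sup>+x. f (c *\<^sub>R x) \<partial>lborel)"
  by (subst lborel_affine[OF c, of 0])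
     (simp add: nn_integral_density nn_integral_distr nn_integral_cmult)

text \<open>
  The integral over \<open>t\<close> that remains after the substitutions below, with \<open>L = - ln |y|\<close>: it
  produces the density \<open>|y| powr (- n)\<close>.
\<close>

lemma nn_integral_exp_below:
  assumes "n > 0"
  shows "(\<integral>\<^sup>+t. ennreal (n * exp (n * t)) * indicator {..<L} t \<partial>lborel) = ennreal (exp (n * L))"
proof -
  have "(\<integral>\<^sup>+t. ennreal (n * exp (n * t)) * indicator {..<L} t \<partial>lborel)
      = (\<integral>\<^sup>+s. ennreal (n * exp (n * (L - s))) * indicator {..<L} (L - s) \<partial>lborel)"
    by (subst nn_integral_real_affine[where c = "-1" and t = L]) auto
  also have "\<dots> = (\<integral>\<^sup>+s. ennreal (n * exp (n * (L - s))) * indicator {0..} s \<partial>lborel)"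
  proof (rule nn_integral_cong_AE)
    show "AE s in lborel. ennreal (n * exp (n * (L - s))) * indicator {..<L} (L - s) =
      ennreal (n * exp (n * (L - s))) * indicator {0..} s"
      using AE_lborel_singleton[of 0] by eventually_elim (auto split: split_indicator)
  qed
  also have "\<dots> = ennreal (0 - (- exp (n * (L - 0))))"
  proof (rule nn_integral_FTC_atLeast)
    have "filterlim (\<lambda>s. (- n) * s) at_bot at_top"
      using assms
      by (intro filterlim_tendsto_neg_mult_at_bot[OF tendsto_const]) (auto simp: filterlim_ident)
    then have "((\<lambda>s. - (exp (n * L) * exp ((- n) * s))) \<longlongrightarrow> - (exp (n * L) * 0)) at_top"
      by (intro tendsto_intros filterlim_compose[OF exp_at_bot])
    then show "((\<lambda>s. - exp (n * (L - s))) \<longlongrightarrow> 0) at_top"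
      by (simp add: exp_add[symmetric] algebra_simps)
  qed (use assms in \<open>auto intro!: derivative_eq_intros\<close>)
  finally show ?thesis by simp
qed

text \<open>
  The sphere carries the cone measure, so an integral over the cylinder is an integral over \<open>t\<close> and
  over \<open>x\<close> in the punctured unit ball.  For fixed \<open>x\<close> the shift \<open>t \<mapsto> t - ln |x|\<close>, then for fixed \<open>t\<close>
  the scaling \<open>y = exp (- t) x\<close>, make \<open>G\<close> depend on \<open>y\<close> alone.  The ball becomes the condition
  \<open>t < - ln |y|\<close>, and the scaling contributes the factor \<open>exp (n t)\<close>.
\<close>

lemma nn_integral_cylinder_measure:
  fixes G :: "real \<times> (real^'n) \<Rightarrow> ennreal"
  assumes [measurable]: "G \<in> borel_measurable borel"
  shows "(\<integral>\<^sup>+z. G z \<partial>cylinder_measure) =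
    (\<integral>\<^sup>+y. ennreal (norm y powr (- real CARD('n))) * G (log_polar y) \<partial>lborel)"
proof -
  let ?n = "real CARD('n)" and ?B = "ball 0 1 - {0} :: (real^'n) set"
  note Gm = assms[folded borel_prod]
  interpret S: sigma_finite_measure "sphere_measure :: (real^'n) measure"
    by (rule sigma_finite_sphere_measure)
  have idm: "(\<lambda>z. z) \<in> lborel \<Otimes>\<^sub>M (sphere_measure :: (real^'n) measure) \<rightarrow>\<^sub>M borel \<Otimes>\<^sub>M borel"
  proof -
    have "snd \<in> lborel \<Otimes>\<^sub>M (sphere_measure :: (real^'n) measure) \<rightarrow>\<^sub>M restrict_space borel (sphere 0 1)"
      using measurable_snd[of lborel "sphere_measure :: (real^'n) measure"]
      by (simp add: measurable_cong_sets[OF refl sets_sphere_measure])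
    from measurable_compose[OF this measurable_restrict_space1[OF measurable_ident]]
    have "snd \<in> lborel \<Otimes>\<^sub>M (sphere_measure :: (real^'n) measure) \<rightarrow>\<^sub>M borel"
      by simp
    then have "(\<lambda>z. (fst z, snd z)) \<in> lborel \<Otimes>\<^sub>M (sphere_measure :: (real^'n) measure) \<rightarrow>\<^sub>M borel \<Otimes>\<^sub>M borel"
      by (intro measurable_Pair) auto
    then show ?thesis by simp
  qed
  have [measurable]: "G \<in> borel_measurable (lborel \<Otimes>\<^sub>M sphere_measure)"
    using measurable_compose[OF idm Gm] by simp
  have [measurable]: "(\<lambda>p. G (f p, g p)) \<in> borel_measurable M"
    if [measurable]: "f \<in> borel_measurable M" "g \<in> borel_measurable M" for f g and M :: "'x measure"
    by measurable
  have [measurable]: "ball 0 1 \<in> sets (borel :: (real^'n) measure)"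
      "{0} \<in> sets (borel :: (real^'n) measure)"
    by auto
  have "(\<integral>\<^sup>+z. G z \<partial>cylinder_measure) = (\<integral>\<^sup>+t. \<integral>\<^sup>+\<theta>. G (t, \<theta>) \<partial>sphere_measure \<partial>lborel)"
    unfolding cylinder_measure_def by (subst S.nn_integral_fst) auto
  also have "\<dots> = (\<integral>\<^sup>+t. \<integral>\<^sup>+x. ennreal ?n * G (t, x /\<^sub>R norm x) * indicator ?B x \<partial>lborel \<partial>lborel)"
  proof (rule nn_integral_cong)
    fix t :: real
    have "(\<integral>\<^sup>+\<theta>. G (t, \<theta>) \<partial>sphere_measure) =
      ennreal ?n * (\<integral>\<^sup>+x. G (t, x /\<^sub>R norm x) * indicator ?B x \<partial>lborel)"
      by (subst nn_integral_sphere_measure) (simp_all add: ennreal_of_nat_eq_real_of_nat)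
    also have "\<dots> = (\<integral>\<^sup>+x. ennreal ?n * (G (t, x /\<^sub>R norm x) * indicator ?B x) \<partial>lborel)"
      by (rule nn_integral_cmult[symmetric]) measurable
    finally show "(\<integral>\<^sup>+\<theta>. G (t, \<theta>) \<partial>sphere_measure) =
      (\<integral>\<^sup>+x. ennreal ?n * G (t, x /\<^sub>R norm x) * indicator ?B x \<partial>lborel)"
      by (simp only: mult.assoc)
  qed
  also have "\<dots> = (\<integral>\<^sup>+x. \<integral>\<^sup>+t. ennreal ?n * G (t, x /\<^sub>R norm x) * indicator ?B x \<partial>lborel \<partial>lborel)"
    by (rule lborel_pair.Fubini') measurable
  also have "\<dots> = (\<integral>\<^sup>+x. \<integral>\<^sup>+t. ennreal ?n * G (t - ln (norm x), x /\<^sub>R norm x) * indicator ?B x \<partial>lborel \<partial>lborel)"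
  proof (rule nn_integral_cong)
    fix x :: "real^'n"
    show "(\<integral>\<^sup>+t. ennreal ?n * G (t, x /\<^sub>R norm x) * indicator ?B x \<partial>lborel) =
      (\<integral>\<^sup>+t. ennreal ?n * G (t - ln (norm x), x /\<^sub>R norm x) * indicator ?B x \<partial>lborel)"
      by (subst nn_integral_real_affine[where c = 1 and t = "- ln (norm x)"]) auto
  qed
  also have "\<dots> = (\<integral>\<^sup>+t. \<integral>\<^sup>+x. ennreal ?n * G (t - ln (norm x), x /\<^sub>R norm x) * indicator ?B x \<partial>lborel \<partial>lborel)"
    by (rule lborel_pair.Fubini') measurable
  also have "\<dots> = (\<integral>\<^sup>+t. \<integral>\<^sup>+y. G (log_polar y) * indicator (- {0}) y *
      (ennreal (?n * exp (?n * t)) * indicator {..<- ln (norm y)} t) \<partial>lborel \<partial>lborel)"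
  proof (rule nn_integral_cong)
    fix t :: real
    have "(\<integral>\<^sup>+x. ennreal ?n * G (t - ln (norm x), x /\<^sub>R norm x) * indicator ?B x \<partial>lborel)
      = ennreal (exp t ^ CARD('n)) * (\<integral>\<^sup>+y. ennreal ?n *
          G (t - ln (norm (exp t *\<^sub>R y)), (exp t *\<^sub>R y) /\<^sub>R norm (exp t *\<^sub>R y)) *
          indicator ?B (exp t *\<^sub>R y) \<partial>lborel)"
      by (subst nn_integral_lborel_scaleR[where c = "exp t"]) auto
    also have "\<dots> = (\<integral>\<^sup>+y. ennreal (exp t ^ CARD('n)) * (ennreal ?n *
          G (t - ln (norm (exp t *\<^sub>R y)), (exp t *\<^sub>R y) /\<^sub>R norm (exp t *\<^sub>R y)) *
          indicator ?B (exp t *\<^sub>R y)) \<partial>lborel)"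
      by (rule nn_integral_cmult[symmetric]) measurable
    also have "\<dots> = (\<integral>\<^sup>+y. G (log_polar y) * indicator (- {0}) y *
      (ennreal (?n * exp (?n * t)) * indicator {..<- ln (norm y)} t) \<partial>lborel)"
    proof (rule nn_integral_cong)
      fix y :: "real^'n"
      show "ennreal (exp t ^ CARD('n)) * (ennreal ?n *
          G (t - ln (norm (exp t *\<^sub>R y)), (exp t *\<^sub>R y) /\<^sub>R norm (exp t *\<^sub>R y)) *
          indicator ?B (exp t *\<^sub>R y)) = G (log_polar y) * indicator (- {0}) y *
      (ennreal (?n * exp (?n * t)) * indicator {..<- ln (norm y)} t)"
      proof (cases "y = 0")
        case False
        have "exp t * norm y < 1 \<longleftrightarrow> ln (exp t * norm y) < 0"
          using False by (subst ln_less_zero_iff) auto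
        also have "\<dots> \<longleftrightarrow> t < - ln (norm y)"
          using False by (subst ln_mult) auto
        finally have 1: "indicator ?B (exp t *\<^sub>R y) = (indicator {..<- ln (norm y)} t :: ennreal)"
          using False by (auto split: split_indicator)
        have 2: "(t - ln (norm (exp t *\<^sub>R y)), (exp t *\<^sub>R y) /\<^sub>R norm (exp t *\<^sub>R y)) = log_polar y"
          using False by (auto simp: log_polar_def ln_mult)
        have 3: "ennreal (exp t ^ CARD('n)) * ennreal ?n = ennreal (?n * exp (?n * t))"
          by (subst ennreal_mult[symmetric]) (auto simp: exp_of_nat_mult exp_of_nat2_mult mult.commute[of ?n])
        show ?thesis unfolding 1 2 3[symmetric] using False by (simp add: mult_ac)
      qed auto
    qed
    finally show "(\<integral>\<^sup>+x. ennreal ?n * G (t - ln (norm x), x /\<^sub>R norm x) * indicator ?B x \<partial>lborel) = \<dots>" .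
  qed
  also have "\<dots> = (\<integral>\<^sup>+y. \<integral>\<^sup>+t. G (log_polar y) * indicator (- {0}) y *
      (ennreal (?n * exp (?n * t)) * indicator {..<- ln (norm y)} t) \<partial>lborel \<partial>lborel)"
    by (rule lborel_pair.Fubini') (unfold lessThan_def, measurable)
  also have "\<dots> = (\<integral>\<^sup>+y. G (log_polar y) * indicator (- {0}) y *
      ennreal (exp (?n * (- ln (norm y)))) \<partial>lborel)"
    by (subst nn_integral_cmult) (simp_all add: nn_integral_exp_below)
  also have "\<dots> = (\<integral>\<^sup>+y. ennreal (norm y powr (- ?n)) * G (log_polar y) \<partial>lborel)"
    by (intro nn_integral_cong) (auto simp: powr_def mult.commute split: split_indicator)
  finally show ?thesis .
qed

text \<open>
  Continuity on the cylinder gives measurability for the trace of the Borel sets, whereas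
  \<^const>\<open>cylinder_measure\<close> is built on a product sigma-algebra.
\<close>

lemma sets_cylinder_measure:
  "sets (cylinder_measure :: (real \<times> (real^'n)) measure) = sets (restrict_space borel cylinder)"
proof -
  have "sets (cylinder_measure :: (real \<times> (real^'n)) measure) =
      sets ((borel :: real measure) \<Otimes>\<^sub>M restrict_space borel (sphere 0 1 :: (real^'n) set))"
    unfolding cylinder_measure_def
    by (intro sets_pair_measure_cong) (auto simp: sets_sphere_measure)
  also have "\<dots> = sets (restrict_space borel cylinder)"
  proof (rule antisym)
    have "(\<lambda>z. (fst z, snd z)) \<in> restrict_space borel (cylinder :: (real \<times> (real^'n)) set)
        \<rightarrow>\<^sub>M (borel :: real measure) \<Otimes>\<^sub>M restrict_space borel (sphere 0 1)"
      by (intro measurable_Pair measurable_restrict_space2 measurable_restrict_space1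
          borel_measurable_continuous_onI continuous_intros)
        (auto simp: space_restrict_space cylinder_def)
    from measurable_sets[OF this]
    show "sets ((borel :: real measure) \<Otimes>\<^sub>M restrict_space borel (sphere 0 1 :: (real^'n) set)) \<subseteq>
        sets (restrict_space borel (cylinder :: (real \<times> (real^'n)) set))"
    proof (intro subsetI)
      fix A assume A: "A \<in> sets ((borel :: real measure) \<Otimes>\<^sub>M restrict_space borel (sphere 0 1 :: (real^'n) set))"
      from sets.sets_into_space[OF A] have "A \<subseteq> cylinder"
        by (auto simp: space_pair_measure space_restrict_space cylinder_def)
      then have "(\<lambda>z. (fst z, snd z)) -` A \<inter> space (restrict_space borel cylinder) = A"
        by (auto simp: space_restrict_space)
      with measurable_sets[OF \<open>(\<lambda>z. (fst z, snd z)) \<in> _ \<rightarrow>\<^sub>M _\<close> A]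
      show "A \<in> sets (restrict_space borel cylinder)" by simp
    qed
    have "(\<lambda>z. (fst z, snd z)) \<in> (borel :: real measure) \<Otimes>\<^sub>M restrict_space borel (sphere 0 1 :: (real^'n) set)
        \<rightarrow>\<^sub>M borel \<Otimes>\<^sub>M borel"
      by (intro measurable_Pair measurable_compose[OF measurable_snd]
          measurable_restrict_space1 measurable_ident) auto
    then have m: "(\<lambda>z. z) \<in> (borel :: real measure) \<Otimes>\<^sub>M restrict_space borel (sphere 0 1 :: (real^'n) set) \<rightarrow>\<^sub>M borel"
      by (simp add: borel_prod)
    show "sets (restrict_space borel (cylinder :: (real \<times> (real^'n)) set)) \<subseteq>
        sets ((borel :: real measure) \<Otimes>\<^sub>M restrict_space borel (sphere 0 1 :: (real^'n) set))"
    proof (intro subsetI)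
      fix A assume "A \<in> sets (restrict_space borel (cylinder :: (real \<times> (real^'n)) set))"
      then obtain B where "B \<in> sets borel" "A = B \<inter> cylinder"
        by (auto simp: sets_restrict_space)
      with measurable_sets[OF m \<open>B \<in> sets borel\<close>]
      show "A \<in> sets ((borel :: real measure) \<Otimes>\<^sub>M restrict_space borel (sphere 0 1 :: (real^'n) set))"
        by (simp add: space_pair_measure space_restrict_space cylinder_def)
    qed
  qed
  finally show ?thesis .
qed

lemma closed_cylinder: "closed (cylinder :: (real \<times> (real^'n)) set)"
  unfolding cylinder_def by (intro closed_Times) auto

lemma cylinder_in_borel: "cylinder \<in> sets (borel :: (real \<times> (real^'n)) measure)"
  using closed_cylinder by (rule borel_closed)

lemma log_polar_measurable_cylinder:
  "log_polar \<in> restrict_space lborel (- {0}) \<rightarrow>\<^sub>M (cylinder_measure :: (real \<times> (real^'n)) measure)"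
proof -
  have "log_polar \<in> restrict_space lborel (- {0::real^'n}) \<rightarrow>\<^sub>M restrict_space borel cylinder"
  proof (rule measurable_restrict_space2)
    show "log_polar \<in> restrict_space lborel (- {0::real^'n}) \<rightarrow>\<^sub>M borel"
      by (intro measurable_restrict_space1) simp
  qed (auto simp: space_restrict_space cylinder_def log_polar_def)
  then show ?thesis
    by (simp add: measurable_cong_sets[OF refl sets_cylinder_measure])
qed

text \<open>
  As an identity of measures, the change of variables applies to integrals of complex functions as
  well.  The origin is removed because \<^const>\<open>log_polar\<close> does not send it into the cylinder.
\<close>

lemma cylinder_measure_eq_distr:
  "(cylinder_measure :: (real \<times> (real^'n)) measure) =
    distr (density (restrict_space lborel (- {0})) (\<lambda>y. ennreal (norm y powr (- real CARD('n)))))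
      cylinder_measure log_polar"
    (is "_ = distr (density ?R ?w) _ _")
proof (rule measure_eqI)
  fix A assume A: "A \<in> sets (cylinder_measure :: (real \<times> (real^'n)) measure)"
  then have "A \<in> sets borel"
    using cylinder_in_borel by (auto simp: sets_cylinder_measure sets_restrict_space)
  then have A': "A \<in> sets borel" and [measurable]: "log_polar -` A \<in> sets borel"
    using measurable_sets[OF log_polar_measurable, of A] by auto
  have w: "?w \<in> borel_measurable ?R"
    by (intro measurable_restrict_space1) simp
  have "emeasure cylinder_measure A = (\<integral>\<^sup>+z. indicator A z \<partial>cylinder_measure)"
    using A by simp
  also have "\<dots> = (\<integral>\<^sup>+y. ?w y * indicator A (log_polar y) \<partial>lborel)"
    using A' by (intro nn_integral_cylinder_measure) simp
  also have "\<dots> = (\<integral>\<^sup>+y. ?w y * indicator A (log_polar y) \<partial>?R)"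
    by (subst nn_integral_restrict_space)
      (auto intro!: nn_integral_cong split: split_indicator)
  also have "\<dots> = emeasure (density ?R ?w) (log_polar -` A \<inter> space ?R)"
    using measurable_sets[OF log_polar_measurable_cylinder A]
    by (subst emeasure_density[OF w])
      (auto intro!: nn_integral_cong simp: space_restrict_space split: split_indicator)
  also have "\<dots> = emeasure (distr (density ?R ?w) cylinder_measure log_polar) A"
    using A log_polar_measurable_cylinder by (subst emeasure_distr) auto
  finally show "emeasure cylinder_measure A = \<dots>" .
qed simp

lemma
  fixes f :: "real \<times> (real^'n) \<Rightarrow> complex"
  assumes f: "f \<in> borel_measurable cylinder_measure"
  shows integrable_cylinder_measure_iff: "integrable cylinder_measure f \<longleftrightarrow>
      integrable lborel (\<lambda>y. norm y powr (- real CARD('n)) *\<^sub>R f (log_polar y))" (is ?I)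
    and integral_cylinder_measure: "(LINT z|cylinder_measure. f z) =
      (LINT y|lborel. norm y powr (- real CARD('n)) *\<^sub>R f (log_polar y))" (is ?E)
proof -
  let ?R = "restrict_space lborel (- {0::real^'n})" and ?w = "\<lambda>y::real^'n. norm y powr (- real CARD('n))"
  have w: "?w \<in> borel_measurable ?R"
    by (intro measurable_restrict_space1) simp
  have fl: "(\<lambda>y. f (log_polar y)) \<in> borel_measurable ?R"
    by (rule measurable_compose[OF log_polar_measurable_cylinder f])
  have lp: "log_polar \<in> density ?R (\<lambda>y. ennreal (?w y)) \<rightarrow>\<^sub>M cylinder_measure"
    using log_polar_measurable_cylinder by simp
  have ind: "indicator (- {0}) y * norm y powr - real CARD('n) = norm y powr - real CARD('n)"
    for y :: "real^'n"
    by (auto split: split_indicator)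
  show ?I
    by (subst cylinder_measure_eq_distr, subst integrable_distr_eq[OF lp f],
        subst integrable_density[OF fl w])
      (auto simp: integrable_restrict_space ind set_integrable_def)
  show ?E
    by (subst cylinder_measure_eq_distr, subst integral_distr[OF lp f],
        subst integral_density[OF fl w])
      (auto simp: integral_restrict_space ind set_lebesgue_integral_def)
qed

section \<open>Gaussian and gamma integrals\<close>

lemma
  fixes f :: "'a::euclidean_space \<Rightarrow> 'b::euclidean_space \<Rightarrow> 'c::{banach, second_countable_topology}"
  assumes m: "(\<lambda>(x, y). f x y) \<in> borel_measurable (borel \<Otimes>\<^sub>M borel)"
    and fin: "(\<integral>\<^sup>+x. \<integral>\<^sup>+y. ennreal (norm (f x y)) \<partial>lborel \<partial>lborel) < \<infinity>"
  shows lborel_swap: "(LINT x|lborel. LINT y|lborel. f x y) = (LINT y|lborel. LINT x|lborel. f x y)"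
    and lborel_iterated_integrable: "integrable lborel (\<lambda>y. LINT x|lborel. f x y)"
proof -
  have int: "integrable (lborel \<Otimes>\<^sub>M lborel) (\<lambda>(x, y). f x y)"
  proof (rule integrableI_bounded)
    show "(\<lambda>(x, y). f x y) \<in> borel_measurable (lborel \<Otimes>\<^sub>M lborel)"
      using m by (simp cong: measurable_cong_sets sets_pair_measure_cong)
    then have "(\<lambda>z. ennreal (norm (case z of (x, y) \<Rightarrow> f x y))) \<in> borel_measurable (lborel \<Otimes>\<^sub>M lborel)"
      by measurable
    from lborel.nn_integral_fst[OF this] fin
    show "(\<integral>\<^sup>+z. ennreal (norm (case z of (x, y) \<Rightarrow> f x y)) \<partial>(lborel \<Otimes>\<^sub>M lborel)) < \<infinity>"
      by simp
  qed
  show "(LINT x|lborel. LINT y|lborel. f x y) = (LINT y|lborel. LINT x|lborel. f x y)"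
    using lborel_pair.Fubini_integral[OF int] by simp
  show "integrable lborel (\<lambda>y. LINT x|lborel. f x y)"
    using lborel_pair.integrable_snd[OF int] by simp
qed

text \<open>
  Together with \<open>lborel_swap\<close> this exchanges the integrals of functions dominated by a product.
\<close>

lemma nn_integral_product_bound:
  fixes f :: "'a::euclidean_space \<Rightarrow> 'b::euclidean_space \<Rightarrow> 'c::real_normed_vector"
    and g :: "'a \<Rightarrow> 'd::{banach, second_countable_topology}" and h :: "'b \<Rightarrow> 'e::{banach, second_countable_topology}"
  assumes g: "integrable lborel g" and h: "integrable lborel h"
    and le: "\<And>x y. norm (f x y) \<le> norm (g x) * norm (h y)"
  shows "(\<integral>\<^sup>+x. \<integral>\<^sup>+y. ennreal (norm (f x y)) \<partial>lborel \<partial>lborel) < \<infinity>"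
proof -
  have [measurable]: "g \<in> borel_measurable borel" "h \<in> borel_measurable borel"
    using borel_measurable_integrable[OF g] borel_measurable_integrable[OF h] by auto
  have "(\<integral>\<^sup>+x. \<integral>\<^sup>+y. ennreal (norm (f x y)) \<partial>lborel \<partial>lborel)
      \<le> (\<integral>\<^sup>+x. \<integral>\<^sup>+y. ennreal (norm (g x)) * ennreal (norm (h y)) \<partial>lborel \<partial>lborel)"
    using le by (intro nn_integral_mono) (simp add: ennreal_mult[symmetric] ennreal_leI)
  also have "\<dots> = (\<integral>\<^sup>+x. ennreal (norm (g x)) \<partial>lborel) * (\<integral>\<^sup>+y. ennreal (norm (h y)) \<partial>lborel)"
    by (simp add: nn_integral_cmult nn_integral_multc)
  also have "\<dots> < \<infinity>"
    using g h by (simp add: integrable_iff_bounded ennreal_mult_less_top)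
  finally show ?thesis .
qed

lemma has_bochner_integral_lborel_prod:
  fixes f :: "'a::euclidean_space \<Rightarrow> real \<Rightarrow> complex"
  assumes "\<And>b. b \<in> Basis \<Longrightarrow> integrable lborel (f b)"
  shows "has_bochner_integral lborel (\<lambda>x::'a. \<Prod>b\<in>Basis. f b (x \<bullet> b))
    (\<Prod>b\<in>Basis. LINT u|lborel. f b u)"
proof -
  interpret product_sigma_finite "\<lambda>_::'a. lborel :: real measure" ..
  let ?P = "\<Pi>\<^sub>M b\<in>(Basis::'a set). (lborel :: real measure)"
  let ?T = "\<lambda>y::'a \<Rightarrow> real. \<Sum>b\<in>Basis. y b *\<^sub>R b"
  have T: "?T \<in> ?P \<rightarrow>\<^sub>M borel" by measurable
  have fm: "f b \<in> borel_measurable borel" if "b \<in> Basis" for b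
    using borel_measurable_integrable[OF assms[OF that]] by simp
  have m: "(\<lambda>x. \<Prod>b\<in>Basis. f b (x \<bullet> b)) \<in> borel_measurable borel"
  proof (rule borel_measurable_prod)
    fix b :: 'a assume b: "b \<in> Basis"
    show "(\<lambda>x. f b (x \<bullet> b)) \<in> borel_measurable borel"
      by (rule measurable_compose[OF _ fm[OF b]]) measurable
  qed
  have e: "(\<Prod>b\<in>Basis. f b (?T y \<bullet> b)) = (\<Prod>b\<in>Basis. f b (y b))" for y
    by (intro prod.cong refl) (simp add: inner_sum_left inner_Basis if_distrib sum.delta cong: if_cong)
  show ?thesis
  proof (unfold has_bochner_integral_iff, intro conjI)
    show "integrable lborel (\<lambda>x::'a. \<Prod>b\<in>Basis. f b (x \<bullet> b))"
      by (subst lborel_eq, subst integrable_distr_eq[OF T m], unfold e)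
        (rule product_integrable_prod, use assms in auto)
    show "(LINT x|lborel. (\<Prod>b\<in>Basis. f b (x \<bullet> b))) = (\<Prod>b\<in>Basis. LINT u|lborel. f b u)"
      by (subst lborel_eq, subst integral_distr[OF T m], unfold e)
        (rule product_integral_prod, use assms in auto)
  qed
qed

text \<open>
  A rescaling by \<open>sqrt (2 s)\<close> of the characteristic function of the standard normal distribution.
\<close>

lemma has_bochner_integral_gaussian_real:
  assumes s: "s > 0"
  shows "has_bochner_integral lborel
    (\<lambda>u. exp (\<i> * complex_of_real (\<xi> * u)) * complex_of_real (exp (- s * u\<^sup>2)))
    (complex_of_real (sqrt (pi / s) * exp (- \<xi>\<^sup>2 / (4 * s))))"
proof -
  define c where "c = sqrt (2 * s)"
  have c: "c > 0" "c\<^sup>2 = 2 * s" using s by (auto simp: c_def)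
  define F where "F = (\<lambda>x. std_normal_density x *\<^sub>R iexp (\<xi> / c * x))"
  have intF: "integrable lborel F"
    unfolding F_def
    by (rule Bochner_Integration.integrable_bound[where f = std_normal_density])
      (auto simp: norm_mult)
  have "(LINT x|lborel. F x) = char std_normal_distribution (\<xi> / c)"
    unfolding F_def char_def by (subst integral_density) auto
  also have "\<dots> = complex_of_real (exp (- (\<xi> / c)\<^sup>2 / 2))"
    by (simp add: char_std_normal_distribution)
  finally have "has_bochner_integral lborel F (complex_of_real (exp (- (\<xi> / c)\<^sup>2 / 2)))"
    using intF by (simp add: has_bochner_integral_iff)
  then have "has_bochner_integral lborel (\<lambda>u. F (0 + c * u)) (complex_of_real (exp (- (\<xi> / c)\<^sup>2 / 2)) /\<^sub>R \<bar>c\<bar>)"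
    using c by (subst (asm) lborel_has_bochner_integral_real_affine_iff[of c _ _ 0]) auto
  then have "has_bochner_integral lborel (\<lambda>u. complex_of_real (sqrt (2 * pi)) * F (0 + c * u))
     (complex_of_real (sqrt (2 * pi)) * (complex_of_real (exp (- (\<xi> / c)\<^sup>2 / 2)) /\<^sub>R \<bar>c\<bar>))"
    by (intro has_bochner_integral_mult_right) auto
  moreover have "complex_of_real (sqrt (2 * pi)) * F (0 + c * u) =
      exp (\<i> * complex_of_real (\<xi> * u)) * complex_of_real (exp (- s * u\<^sup>2))" for u
    using c by (auto simp: F_def std_normal_density_def scaleR_conv_of_real power_mult_distrib real_sqrt_mult)
  moreover have "complex_of_real (sqrt (2 * pi)) * (complex_of_real (exp (- (\<xi> / c)\<^sup>2 / 2)) /\<^sub>R \<bar>c\<bar>) =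
    complex_of_real (sqrt (pi / s) * exp (- \<xi>\<^sup>2 / (4 * s)))"
  proof -
    have "sqrt (2 * pi) / c = sqrt (pi / s)" by (simp add: c_def real_sqrt_mult real_sqrt_divide)
    moreover have "(\<xi> / c)\<^sup>2 / 2 = \<xi>\<^sup>2 / (4 * s)" using c by (simp add: power_divide)
    ultimately show ?thesis using c(1)
      by (simp add: scaleR_conv_of_real of_real_mult[symmetric] of_real_inverse[symmetric]
          field_simps del: of_real_mult of_real_inverse)
  qed
  ultimately show ?thesis by simp
qed

text \<open>
  In orthonormal coordinates both the Gaussian and the character are products.
\<close>

lemma has_bochner_integral_gaussian:
  fixes \<xi> :: "'a::euclidean_space"
  assumes s: "s > 0"
  shows "has_bochner_integral lborel
    (\<lambda>x. exp (\<i> * complex_of_real (\<xi> \<bullet> x)) * complex_of_real (exp (- s * (norm x)\<^sup>2)))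
    (complex_of_real ((pi / s) powr (DIM('a) / 2) * exp (- (norm \<xi>)\<^sup>2 / (4 * s))))"
proof -
  have sq: "(norm x)\<^sup>2 = (\<Sum>b\<in>Basis. (x \<bullet> b)\<^sup>2)" for x :: 'a
    unfolding power2_norm_eq_inner by (subst euclidean_inner) (simp add: power2_eq_square)
  let ?f = "\<lambda>b u. exp (\<i> * complex_of_real ((\<xi> \<bullet> b) * u)) * complex_of_real (exp (- s * u\<^sup>2))"
  note g = has_bochner_integral_gaussian_real[OF s]
  have "has_bochner_integral lborel (\<lambda>x::'a. \<Prod>b\<in>Basis. ?f b (x \<bullet> b))
    (\<Prod>b\<in>(Basis::'a set). LINT u|lborel. ?f b u)"
    by (rule has_bochner_integral_lborel_prod) (use g in \<open>auto simp: has_bochner_integral_iff\<close>)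
  moreover have "(\<Prod>b\<in>Basis. ?f b (x \<bullet> b)) =
      exp (\<i> * complex_of_real (\<xi> \<bullet> x)) * complex_of_real (exp (- s * (norm x)\<^sup>2))" for x
    unfolding prod.distrib of_real_prod[symmetric] sq
    by (subst (2) euclidean_inner)
      (simp add: exp_sum[symmetric] sum_distrib_left exp_of_real[symmetric])
  moreover have "(\<Prod>b\<in>(Basis::'a set). LINT u|lborel. ?f b u) =
      complex_of_real ((pi / s) powr (DIM('a) / 2) * exp (- (norm \<xi>)\<^sup>2 / (4 * s)))"
  proof -
    have "(\<Prod>b\<in>(Basis::'a set). LINT u|lborel. ?f b u) =
      complex_of_real (\<Prod>b\<in>(Basis::'a set). sqrt (pi / s) * exp (- (\<xi> \<bullet> b)\<^sup>2 / (4 * s)))"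
      unfolding of_real_prod using g by (intro prod.cong refl) (simp add: has_bochner_integral_iff)
    also have "(\<Prod>b\<in>(Basis::'a set). sqrt (pi / s) * exp (- (\<xi> \<bullet> b)\<^sup>2 / (4 * s))) =
      sqrt (pi / s) ^ DIM('a) * exp (- (norm \<xi>)\<^sup>2 / (4 * s))"
      by (simp add: prod.distrib exp_sum[symmetric] sq sum_negf sum_divide_distrib)
    also have "sqrt (pi / s) ^ DIM('a) = (pi / s) powr (DIM('a) / 2)"
      using s by (simp add: powr_half_sqrt[symmetric] powr_powr powr_realpow[symmetric] field_simps)
    finally show ?thesis .
  qed
  ultimately show ?thesis by simp
qed

lemma has_bochner_integral_gaussian_mass:
  assumes s: "s > 0"
  shows "has_bochner_integral lborel (\<lambda>x::'a::euclidean_space. exp (- s * (norm x)\<^sup>2))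
    ((pi / s) powr (DIM('a) / 2))"
  using has_bochner_integral_bounded_linear[OF bounded_linear_Re
      has_bochner_integral_gaussian[OF s, of "0::'a"]]
  by simp

text \<open>
  For \<open>p > 0\<close> this is \<open>\<Gamma>(p)\<close> times the density of the gamma distribution.  The exponent \<open>p = - \<gamma> < 0\<close>
  occurs as well, for the weight that the bubble has on the frequency side.
\<close>

definition gamma_density :: "real \<Rightarrow> real \<Rightarrow> real"
  where "gamma_density p s = indicator {0<..} s * (s powr (p - 1) * exp (- s))"

lemma gamma_density_nonneg: "gamma_density p s \<ge> 0"
  by (simp add: gamma_density_def)

lemma gamma_density_measurable [measurable]: "gamma_density p \<in> borel_measurable borel"
  unfolding gamma_density_def by measurable

lemma has_bochner_integral_gamma_density:
  assumes "p > 0"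
  shows "has_bochner_integral lborel (gamma_density p) (Gamma p)"
proof (rule has_bochner_integral_nn_integral)
  have "(\<integral>\<^sup>+s. ennreal (gamma_density p s) \<partial>lborel) =
      (\<integral>\<^sup>+t. ennreal (indicator {0..} t * t powr (p - 1) / exp t) \<partial>lborel)"
    by (intro nn_integral_cong)
      (auto simp: gamma_density_def exp_minus divide_inverse split: split_indicator)
  then show "(\<integral>\<^sup>+s. ennreal (gamma_density p s) \<partial>lborel) = ennreal (Gamma p)"
    using Gamma_conv_nn_integral_real[OF assms] by simp
qed (use assms in \<open>auto simp: gamma_density_nonneg\<close>)

text \<open>
  With \<open>A = |x|\<^sup>2\<close> this writes \<open>(1 + |x|\<^sup>2) powr (- p)\<close> as a superposition of Gaussians.
\<close>

lemma has_bochner_integral_gamma_density_exp: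
  assumes p: "p > 0" and A: "A \<ge> 0"
  shows "has_bochner_integral lborel (\<lambda>s. gamma_density p s * exp (- s * A)) (Gamma p * (1 + A) powr (- p))"
proof -
  have "has_bochner_integral lborel (\<lambda>s. gamma_density p (0 + (1 + A) * s)) (Gamma p /\<^sub>R \<bar>1 + A\<bar>)"
    using has_bochner_integral_gamma_density[OF p] A
    by (subst (asm) lborel_has_bochner_integral_real_affine_iff[of "1 + A" _ _ 0]) auto
  then have "has_bochner_integral lborel (\<lambda>s. (1 + A) powr (1 - p) * gamma_density p (0 + (1 + A) * s))
      ((1 + A) powr (1 - p) * (Gamma p /\<^sub>R \<bar>1 + A\<bar>))"
    by (intro has_bochner_integral_mult_right) auto
  moreover have "(1 + A) powr (1 - p) * gamma_density p (0 + (1 + A) * s) =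
      gamma_density p s * exp (- s * A)" for s
  proof (cases "s > 0")
    case True
    have "(1 + A) powr (1 - p) * (1 + A) powr (p - 1) = 1"
      using A by (simp add: powr_add[symmetric])
    moreover have "exp (- ((1 + A) * s)) = exp (- s) * exp (- s * A)"
      by (simp add: exp_add[symmetric] algebra_simps)
    ultimately show ?thesis
      using True A by (simp add: gamma_density_def powr_mult)
  qed (use A in \<open>auto simp: gamma_density_def zero_less_mult_iff\<close>)
  moreover have "(1 + A) powr (1 - p) * (Gamma p /\<^sub>R \<bar>1 + A\<bar>) = Gamma p * (1 + A) powr (- p)"
  proof -
    have "(1 + A) powr (1 - p) = (1 + A) * (1 + A) powr (- p)"
      using A by (simp add: powr_diff powr_minus divide_inverse)
    then show ?thesis using A by simp
  qed
  ultimately show ?thesis by (simp only:)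
qed

lemma has_bochner_integral_inversion:
  fixes F :: "real \<Rightarrow> real"
  assumes q: "q > 0"
    and F: "has_bochner_integral lborel (\<lambda>s. indicator {0<..} s * F s) I"
    and [measurable]: "F \<in> borel_measurable borel"
  shows "has_bochner_integral lborel (\<lambda>s. indicator {0<..} s * (q / s\<^sup>2 * F (q / s))) I"
proof -
  have "(\<lambda>s. q / s) ` {0<..} = {0<..}"
  proof (intro equalityI subsetI)
    fix x :: real assume "x \<in> {0<..}"
    then have "x = q / (q / x)" "q / x \<in> {0<..}" using q by auto
    then show "x \<in> (\<lambda>s. q / s) ` {0<..}" by (rule image_eqI)
  qed (use q in auto)
  moreover have "inj_on (\<lambda>s. q / s) {0<..}" using q by (auto simp: inj_on_def)
  moreover have "((\<lambda>s. q / s) has_real_derivative - (q / s\<^sup>2)) (at s within {0<..})" if "s \<in> {0<..}" for s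
    using that by (auto intro!: derivative_eq_intros simp: power2_eq_square)
  ultimately have "(\<lambda>x. \<bar>- (q / x\<^sup>2)\<bar> *\<^sub>R F (q / x)) absolutely_integrable_on {0<..} \<and>
      integral {0<..} (\<lambda>x. \<bar>- (q / x\<^sup>2)\<bar> *\<^sub>R F (q / x)) = I \<longleftrightarrow>
      F absolutely_integrable_on {0<..} \<and> integral {0<..} F = I"
    using has_absolute_integral_change_of_variables_1'[of "{0<..}" "\<lambda>s. q / s" "\<lambda>s. - (q / s\<^sup>2)" F I]
    by simp
  moreover have iff: "G absolutely_integrable_on {0<..} \<and> integral {0<..} G = I \<longleftrightarrow>
      has_bochner_integral lborel (\<lambda>s. indicator {0<..} s * G s) I"
    if "G \<in> borel_measurable borel" for G :: "real \<Rightarrow> real"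
  proof -
    have "G absolutely_integrable_on {0<..} \<longleftrightarrow> integrable lborel (\<lambda>s. indicator {0<..} s * G s)"
      unfolding set_integrable_def
      by (subst integrable_completion)
        (use that in \<open>auto intro!: borel_measurable_scaleR borel_measurable_indicator\<close>)
    moreover have "integral {0<..} G = (LINT s|lborel. indicator {0<..} s * G s)"
      if "G absolutely_integrable_on {0<..}"
    proof -
      have "(\<lambda>s. indicator {0<..} s * G s) \<in> borel_measurable lborel"
        using \<open>G \<in> borel_measurable borel\<close>
        by (auto intro!: borel_measurable_times borel_measurable_indicator)
      from integral_completion[OF this] show ?thesis
        using set_lebesgue_integral_eq_integral(2)[OF that]
        by (simp add: set_lebesgue_integral_def)
    qed
    ultimately show ?thesis by (auto simp: has_bochner_integral_iff)
  qed
  ultimately show ?thesis using F q by simp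
qed

text \<open>
  The image of the gamma integral under \<open>s \<mapsto> q/s\<close>.  It evaluates integrals of Gaussian heat kernels over
  the time \<open>s\<close>, with \<open>q\<close> proportional to the square of the distance.
\<close>

lemma has_bochner_integral_inverse_gamma:
  fixes p q :: real
  assumes p: "p > 0" and q: "q > 0"
  shows "has_bochner_integral lborel (\<lambda>s. indicator {0<..} s * (s powr (- p - 1) * exp (- q / s)))
    (Gamma p * q powr (- p))"
proof -
  have "has_bochner_integral lborel (\<lambda>s. indicator {0<..} s * (q / s\<^sup>2 * ((q / s) powr (p - 1) * exp (- (q / s))))) (Gamma p)"
    by (rule has_bochner_integral_inversion[where F = "\<lambda>s::real. s powr (p - 1) * exp (- s)", OF q])
      (use has_bochner_integral_gamma_density[OF p] in \<open>auto simp: gamma_density_def[abs_def]\<close>)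
  then have "has_bochner_integral lborel (\<lambda>s. q powr (- p) * (indicator {0<..} s * (q / s\<^sup>2 * ((q / s) powr (p - 1) * exp (- (q / s)))))) (q powr (- p) * Gamma p)"
    by (intro has_bochner_integral_mult_right) auto
  moreover have "q powr (- p) * (indicator {0<..} s * (q / s\<^sup>2 * ((q / s) powr (p - 1) * exp (- (q / s))))) =
    indicator {0<..} s * (s powr (- p - 1) * exp (- q / s))" for s
    using q by (auto simp: powr_divide powr_minus powr_diff powr_numeral[symmetric] field_simps
        power2_eq_square split: split_indicator)
  ultimately show ?thesis by (simp add: mult.commute)
qed

text \<open>
  The substitution \<open>s \<mapsto> q/s\<close> exchanges the two factors \<open>exp (- s)\<close> and \<open>exp (- q/s)\<close> and reverses the sign of
  \<open>p\<close>.  With \<open>q = |\<xi>|\<^sup>2/4\<close> and \<open>p = \<gamma>\<close> the factor \<open>q powr (- p)\<close> is the inverse of the symbol of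
  the fractional Laplacian, up to a constant.
\<close>

lemma gamma_density_reflection:
  fixes p q :: real
  assumes p: "p > 0" and q: "q > 0"
  shows "has_bochner_integral lborel (\<lambda>s. gamma_density (- p) s * exp (- q / s))
    (q powr (- p) * (LINT s|lborel. gamma_density p s * exp (- q / s)))"
proof -
  let ?F = "\<lambda>s. s powr (p - 1) * exp (- s) * exp (- q / s)"
  have "integrable lborel (\<lambda>s. gamma_density p s * exp (- q / s))"
  proof (rule Bochner_Integration.integrable_bound)
    show "integrable lborel (gamma_density p)"
      using has_bochner_integral_gamma_density[OF p] by (simp add: has_bochner_integral_iff)
    show "AE s in lborel. norm (gamma_density p s * exp (- q / s)) \<le> norm (gamma_density p s)"
      using q by (auto simp: gamma_density_def abs_mult mult_left_le split: split_indicator)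
  qed measurable
  then have F: "has_bochner_integral lborel (\<lambda>s. indicator {0<..} s * ?F s)
      (LINT s|lborel. gamma_density p s * exp (- q / s))"
    by (simp add: has_bochner_integral_iff gamma_density_def mult_ac)
  have "has_bochner_integral lborel (\<lambda>s. indicator {0<..} s * (q / s\<^sup>2 * ?F (q / s)))
      (LINT s|lborel. gamma_density p s * exp (- q / s))"
    using has_bochner_integral_inversion[where F = ?F, OF q F] by simp
  then have "has_bochner_integral lborel (\<lambda>s. q powr (- p) * (indicator {0<..} s * (q / s\<^sup>2 * ?F (q / s))))
      (q powr (- p) * (LINT s|lborel. gamma_density p s * exp (- q / s)))"
    by (intro has_bochner_integral_mult_right) auto
  moreover have "q powr (- p) * (indicator {0<..} s * (q / s\<^sup>2 * ?F (q / s))) =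
    gamma_density (- p) s * exp (- q / s)" for s
    using q by (auto simp: gamma_density_def powr_divide powr_minus powr_diff powr_numeral[symmetric] field_simps
        power2_eq_square split: split_indicator)
  ultimately show ?thesis by simp
qed

section \<open>Rapid decay of the Fourier transform\<close>

lemma compact_support_integrable:
  fixes f :: "'a::euclidean_space \<Rightarrow> complex"
  assumes "continuous_on UNIV f" and R: "\<And>x. norm x > R \<Longrightarrow> f x = 0"
  shows "integrable lborel f" and "\<exists>B. \<forall>x. norm (f x) \<le> B"
proof -
  have c: "continuous_on (cball 0 R) f" using assms(1) by (rule continuous_on_subset) simp
  have "integrable lborel (\<lambda>x. indicator (cball 0 R) x *\<^sub>R f x)"
    by (rule borel_integrable_compact) (use c in auto)
  moreover have "indicator (cball 0 R) x *\<^sub>R f x = f x" for x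
    using R[of x] by (cases "norm x > R") (auto split: split_indicator)
  ultimately show "integrable lborel f" by simp
  have "compact (f ` cball 0 R)" by (rule compact_continuous_image[OF c]) simp
  then obtain B where B: "\<And>x. x \<in> cball 0 R \<Longrightarrow> norm (f x) \<le> B"
    using compact_imp_bounded[OF \<open>compact (f ` cball 0 R)\<close>] unfolding bounded_iff by blast
  have "norm (f x) \<le> max B 0" for x
    using R[of x] B[of x] by (cases "norm x > R") auto
  then show "\<exists>B. \<forall>x. norm (f x) \<le> B" by blast
qed

lemma integral_lborel_translate:
  fixes f :: "'a::euclidean_space \<Rightarrow> complex"
  assumes "f \<in> borel_measurable borel"
  shows "(LINT x|lborel. f (c + x)) = (LINT x|lborel. f x)"
proof -
  have "(LINT x|lborel. f x) = (LINT x|distr lborel borel ((+) c). f x)"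
    by (simp add: lborel_distr_plus)
  also have "\<dots> = (LINT x|lborel. f (c + x))"
    using assms by (subst integral_distr) auto
  finally show ?thesis by simp
qed

lemma derivative_eq_0_outside_support:
  assumes "\<And>x. (F has_derivative F' x) (at x)" "\<And>x. norm x > R \<Longrightarrow> F x = 0" "norm x > R"
  shows "F' x = (\<lambda>_. 0)"
proof -
  have "open {y. norm y > R}" by (intro open_Collect_less continuous_intros)
  then have "(F has_derivative (\<lambda>_. 0)) (at x)"
    by (rule has_derivative_transform_within_open[OF has_derivative_const[of 0]])
      (use assms in auto)
  with assms(1) show ?thesis by (rule has_derivative_unique)
qed

text \<open>
  The difference quotients of \<open>F\<close> have integral zero by translation invariance.  By the mean value
  inequality they are bounded uniformly, with supports in a fixed ball, so their limit has integral zero too.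
\<close>

lemma integral_directional_derivative_eq_0:
  fixes F :: "'a::euclidean_space \<Rightarrow> complex"
  assumes F: "\<And>x. (F has_derivative F' x) (at x)"
    and cont: "continuous_on UNIV (\<lambda>x. F' x b)"
    and R: "\<And>x. norm x > R \<Longrightarrow> F x = 0" and b: "b \<in> Basis"
  shows "(LINT x|lborel. F' x b) = 0"
proof -
  have nb: "norm b = 1" using b by simp
  have contF: "continuous_on UNIV F"
    using F by (intro continuous_at_imp_continuous_on) (auto intro: has_derivative_continuous)
  then have Fm[measurable]: "F \<in> borel_measurable borel"
    by (rule borel_measurable_continuous_onI)
  have D0: "F' x b = 0" if "norm x > R" for x
    using derivative_eq_0_outside_support[OF F R that] by simp
  obtain B where B: "\<And>x. norm (F' x b) \<le> B"
    using compact_support_integrable(2)[OF cont D0] by blast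
  have intF: "integrable lborel F" by (rule compact_support_integrable(1)[OF contF R])
  \<comment> \<open>step sizes bounded by 1, so that all supports lie in the ball of radius \<open>R + 1\<close>\<close>
  define h where "h k = inverse (real (Suc k))" for k
  have h: "0 < h k" "h k \<le> 1" for k by (auto simp: h_def field_simps)
  define G where "G k x = (F (h k *\<^sub>R b + x) - F x) /\<^sub>R h k" for k x
  have bound: "norm (G k x) \<le> B" for k x
  proof -
    define u where "u t = F (t *\<^sub>R b + x)" for t
    have "(u has_derivative (\<lambda>s. F' (t *\<^sub>R b + x) (s *\<^sub>R b))) (at t)" for t
      unfolding u_def by (rule has_derivative_compose[OF _ F]) (auto intro!: derivative_eq_intros)
    moreover have "onorm (\<lambda>s. F' (t *\<^sub>R b + x) (s *\<^sub>R b)) \<le> B" for t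
    proof (rule onorm_le)
      fix s
      interpret l: bounded_linear "F' (t *\<^sub>R b + x)" using F by (rule has_derivative_bounded_linear)
      show "norm (F' (t *\<^sub>R b + x) (s *\<^sub>R b)) \<le> B * norm s"
        using mult_left_mono[OF B[of "t *\<^sub>R b + x"], of "norm s"] by (simp add: l.scaleR mult.commute)
    qed
    ultimately have "norm (u (h k) - u 0) \<le> B * norm (h k - 0)"
      by (intro differentiable_bound[OF convex_UNIV]) auto
    moreover have "norm (G k x) = norm (u (h k) - u 0) / h k"
      using h[of k] by (simp add: G_def u_def divide_inverse mult.commute)
    ultimately show ?thesis using h[of k] by (simp add: pos_divide_le_eq)
  qed
  have zero: "(LINT x|lborel. G k x) = 0" for k
  proof -
    have "integrable lborel (\<lambda>x. F (h k *\<^sub>R b + x))"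
    proof -
      have "integrable (distr lborel borel ((+) (h k *\<^sub>R b))) F"
        by (simp add: lborel_distr_plus intF)
      then show ?thesis by (subst (asm) integrable_distr_eq) auto
    qed
    then show ?thesis
      unfolding G_def using intF by (simp add: integral_lborel_translate)
  qed
  have "(\<lambda>k. LINT x|lborel. G k x) \<longlonglongrightarrow> (LINT x|lborel. F' x b)"
  proof (rule integral_dominated_convergence)
    show "(\<lambda>x. F' x b) \<in> borel_measurable lborel"
      using borel_measurable_continuous_onI[OF cont] by simp
    show "G k \<in> borel_measurable lborel" for k
      unfolding G_def by measurable
    show "integrable lborel (\<lambda>x::'a. indicator (cball 0 (R + 1)) x *\<^sub>R B)"
      by (rule borel_integrable_compact) auto
    show "AE x in lborel. (\<lambda>k. G k x) \<longlonglongrightarrow> F' x b"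
    proof (rule AE_I2)
      fix x
      interpret l: bounded_linear "F' x" using F by (rule has_derivative_bounded_linear)
      have lim0: "(\<lambda>k. h k *\<^sub>R b) \<longlonglongrightarrow> 0"
        unfolding h_def using tendsto_scaleR[OF LIMSEQ_inverse_real_of_nat tendsto_const[of b]] by simp
      have "filterlim (\<lambda>k. h k *\<^sub>R b) (at 0) sequentially"
        using lim0 h nb by (auto simp: filterlim_at intro!: always_eventually)
          (metis less_irrefl norm_zero zero_neq_one)+
      moreover have "((\<lambda>y. norm (F (x + y) - F x - F' x y) / norm y) \<longlongrightarrow> 0) (at 0)"
        using F[of x] by (simp add: has_derivative_at)
      ultimately have "(\<lambda>k. norm (F (x + h k *\<^sub>R b) - F x - F' x (h k *\<^sub>R b)) / norm (h k *\<^sub>R b)) \<longlonglongrightarrow> 0"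
        by (rule filterlim_compose[rotated])
      moreover have "norm (F (x + h k *\<^sub>R b) - F x - F' x (h k *\<^sub>R b)) / norm (h k *\<^sub>R b) =
          norm (G k x - F' x b)" for k
      proof -
        have "G k x - F' x b = (F (x + h k *\<^sub>R b) - F x - F' x (h k *\<^sub>R b)) /\<^sub>R h k"
          using h[of k] by (simp add: G_def l.scaleR add.commute scaleR_diff_right)
        then show ?thesis using h[of k] nb by (simp add: divide_inverse mult.commute)
      qed
      ultimately have "(\<lambda>k. norm (G k x - F' x b)) \<longlonglongrightarrow> 0" by simp
      then show "(\<lambda>k. G k x) \<longlonglongrightarrow> F' x b"
        by (simp add: tendsto_norm_zero_iff LIM_zero_iff)
    qed
    show "AE x in lborel. norm (G k x) \<le> indicator (cball 0 (R + 1)) x *\<^sub>R B" for k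
    proof (rule AE_I2)
      fix x
      show "norm (G k x) \<le> indicator (cball 0 (R + 1)) x *\<^sub>R B"
      proof (cases "norm x \<le> R + 1")
        case True then show ?thesis using bound by simp
      next
        case False
        have "norm x \<le> norm (h k *\<^sub>R b + x) + norm (h k *\<^sub>R b)"
          using norm_triangle_ineq4[of "h k *\<^sub>R b + x" "h k *\<^sub>R b"] by simp
        then have "norm (h k *\<^sub>R b + x) > R" using False h[of k] nb by simp
        then show ?thesis using False R by (simp add: G_def)
      qed
    qed
  qed
  then have "(\<lambda>k. 0 :: complex) \<longlonglongrightarrow> (LINT x|lborel. F' x b)" by (simp add: zero)
  then show ?thesis using LIMSEQ_unique[OF _ tendsto_const] by blast
qed

definition Cc_smooth :: "('a::euclidean_space \<Rightarrow> complex) set"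
  where "Cc_smooth = {f. (\<forall>k. Ck_on k UNIV f) \<and> (\<exists>R. \<forall>x. norm x > R \<longrightarrow> f x = 0)}"

abbreviation partial_deriv :: "'a::real_normed_vector \<Rightarrow> ('a \<Rightarrow> complex) \<Rightarrow> 'a \<Rightarrow> complex"
  where "partial_deriv b f \<equiv> (\<lambda>x. frechet_derivative f (at x) b)"

lemma Cc_smooth_has_derivative:
  "f \<in> Cc_smooth \<Longrightarrow> (f has_derivative frechet_derivative f (at x)) (at x)"
  unfolding Cc_smooth_def using Ck_on_SucD(1)[of 0 UNIV f x] by blast

lemma Cc_smooth_continuous: "f \<in> Cc_smooth \<Longrightarrow> continuous_on UNIV f"
  unfolding Cc_smooth_def using Ck_on_imp_continuous by blast

lemma Cc_smooth_integrable: "f \<in> Cc_smooth \<Longrightarrow> integrable lborel f"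
  using compact_support_integrable(1)[OF Cc_smooth_continuous] unfolding Cc_smooth_def by blast

lemma Cc_smooth_partial_deriv:
  assumes "f \<in> Cc_smooth" shows "partial_deriv b f \<in> Cc_smooth"
proof -
  obtain R where R: "\<And>x. norm x > R \<Longrightarrow> f x = 0" using assms by (auto simp: Cc_smooth_def)
  have "Ck_on k UNIV (partial_deriv b f)" for k
    using assms Ck_on_SucD(2)[of k UNIV f] by (auto simp: Cc_smooth_def simp del: Ck_on.simps)
  moreover have "partial_deriv b f x = 0" if "norm x > R" for x
    using derivative_eq_0_outside_support[OF Cc_smooth_has_derivative[OF assms] R that] by simp
  ultimately show ?thesis unfolding Cc_smooth_def by blast
qed

lemma Cc_smooth_add:
  assumes "f \<in> Cc_smooth" "g \<in> Cc_smooth" shows "(\<lambda>x. f x + g x) \<in> Cc_smooth"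
proof -
  obtain R S where "\<And>x. norm x > R \<Longrightarrow> f x = 0" "\<And>x. norm x > S \<Longrightarrow> g x = 0"
    using assms by (auto simp: Cc_smooth_def)
  then have "\<forall>x. norm x > max R S \<longrightarrow> f x + g x = 0" by simp
  then show ?thesis using assms Ck_on_add[OF open_UNIV] unfolding Cc_smooth_def by blast
qed

lemma Cc_smooth_cmult:
  assumes "f \<in> Cc_smooth" shows "(\<lambda>x. c *\<^sub>R f x) \<in> Cc_smooth"
proof -
  obtain R where "\<And>x. norm x > R \<Longrightarrow> f x = 0"
    using assms by (auto simp: Cc_smooth_def)
  then have "\<forall>x. norm x > R \<longrightarrow> c *\<^sub>R f x = 0" by simp
  then show ?thesis using assms Ck_on_scaleR[OF open_UNIV Ck_on_const] unfolding Cc_smooth_def by blast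
qed

lemma Cc_smooth_sum:
  "(\<And>i. i \<in> I \<Longrightarrow> f i \<in> Cc_smooth) \<Longrightarrow> (\<lambda>x. \<Sum>i\<in>I. f i x) \<in> Cc_smooth"
proof (induction I rule: infinite_finite_induct)
  case (insert i I)
  then show ?case using Cc_smooth_add[of "f i" "\<lambda>x. \<Sum>i\<in>I. f i x"] by simp
qed (auto simp: Cc_smooth_def Ck_on_const)

definition fourier_kernel :: "'a::real_inner \<Rightarrow> 'a \<Rightarrow> complex"
  where "fourier_kernel \<xi> x = exp (\<i> * complex_of_real (\<xi> \<bullet> x))"

lemma norm_fourier_kernel [simp]: "norm (fourier_kernel \<xi> x) = 1"
  by (simp add: fourier_kernel_def)

lemma fourier_kernel_measurable [measurable]:
  "fourier_kernel (\<xi> :: 'a::euclidean_space) \<in> borel_measurable borel"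
  unfolding fourier_kernel_def by measurable

lemma fourier_transform_eq:
  "fourier_transform w \<xi> = (LINT x|lborel. fourier_kernel (- \<xi>) x * w x)"
  by (simp add: fourier_transform_def fourier_kernel_def)

lemma integrable_fourier_kernel_mult:
  assumes "integrable lborel (f :: 'a::euclidean_space \<Rightarrow> complex)"
  shows "integrable lborel (\<lambda>x. fourier_kernel \<xi> x * f x)"
  by (rule Bochner_Integration.integrable_bound[OF assms])
    (use borel_measurable_integrable[OF assms] in \<open>auto simp: norm_mult\<close>)

lemma norm_fourier_transform_le:
  assumes "integrable lborel f"
  shows "norm (fourier_transform f \<xi>) \<le> (LINT x|lborel. norm (f x))"
proof -
  have "norm (fourier_transform f \<xi>) \<le> (LINT x|lborel. norm (fourier_kernel (- \<xi>) x * f x))"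
    unfolding fourier_transform_eq by (rule integral_norm_bound)
  then show ?thesis by (simp add: norm_mult)
qed

text \<open>
  Partial integration: the integral of the derivative of the product of \<open>f\<close> and the character vanishes.
\<close>

lemma fourier_transform_partial_deriv:
  fixes f :: "real^'n \<Rightarrow> complex"
  assumes f: "f \<in> Cc_smooth" and b: "b \<in> Basis"
  shows "fourier_transform (partial_deriv b f) \<xi> = \<i> * complex_of_real (\<xi> \<bullet> b) * fourier_transform f \<xi>"
proof -
  let ?e = "fourier_kernel (- \<xi>)"
  let ?F' = "\<lambda>x h. ?e x * frechet_derivative f (at x) h + (?e x * (\<i> * complex_of_real (- \<xi> \<bullet> h))) * f x"
  obtain R where R: "\<And>x. norm x > R \<Longrightarrow> f x = 0" using f by (auto simp: Cc_smooth_def)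
  have e': "(?e has_derivative (\<lambda>h. ?e x * (\<i> * complex_of_real (- \<xi> \<bullet> h)))) (at x)" for x
  proof -
    have "(exp has_derivative (*) (exp z)) (at z)" for z :: complex
      using DERIV_exp[of z] by (simp only: has_field_derivative_def)
    moreover have "((\<lambda>x. \<i> * complex_of_real (- \<xi> \<bullet> x)) has_derivative
        (\<lambda>h. \<i> * complex_of_real (- \<xi> \<bullet> h))) (at x)"
      by (auto intro!: derivative_eq_intros)
    ultimately show ?thesis
      unfolding fourier_kernel_def by (rule has_derivative_compose[rotated])
  qed
  have ce: "continuous_on UNIV ?e"
    unfolding fourier_kernel_def by (intro continuous_intros)
  have i1: "integrable lborel (\<lambda>x. ?e x * partial_deriv b f x)"
    by (intro integrable_fourier_kernel_mult Cc_smooth_integrable Cc_smooth_partial_deriv f)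
  have i2: "integrable lborel (\<lambda>x. ?e x * f x)"
    by (intro integrable_fourier_kernel_mult Cc_smooth_integrable f)
  have "(LINT x|lborel. ?F' x b) = 0"
  proof (rule integral_directional_derivative_eq_0[where F = "\<lambda>x. ?e x * f x"])
    show "((\<lambda>x. ?e x * f x) has_derivative ?F' x) (at x)" for x
      by (rule has_derivative_mult[OF e' Cc_smooth_has_derivative[OF f]])
    show "continuous_on UNIV (\<lambda>x. ?F' x b)"
      by (intro continuous_intros ce Cc_smooth_continuous[OF f]
          Cc_smooth_continuous[OF Cc_smooth_partial_deriv[OF f]])
  qed (use R b in auto)
  moreover have "?F' x b = ?e x * partial_deriv b f x - (\<i> * complex_of_real (\<xi> \<bullet> b)) * (?e x * f x)" for x
    by (simp add: algebra_simps)
  ultimately have "(LINT x|lborel. ?e x * partial_deriv b f x - (\<i> * complex_of_real (\<xi> \<bullet> b)) * (?e x * f x)) = 0"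
    by (simp only:)
  also have "(LINT x|lborel. ?e x * partial_deriv b f x - (\<i> * complex_of_real (\<xi> \<bullet> b)) * (?e x * f x)) =
    (LINT x|lborel. ?e x * partial_deriv b f x) - (\<i> * complex_of_real (\<xi> \<bullet> b)) * (LINT x|lborel. ?e x * f x)"
    using i1 i2 by (subst Bochner_Integration.integral_diff) auto
  finally show ?thesis by (simp add: fourier_transform_eq)
qed

text \<open>
  The operator \<open>1 - \<Delta>\<close>.
\<close>

definition bessel_op :: "('a::euclidean_space \<Rightarrow> complex) \<Rightarrow> 'a \<Rightarrow> complex"
  where "bessel_op f = (\<lambda>x. f x + (\<Sum>b\<in>Basis. (-1) *\<^sub>R partial_deriv b (partial_deriv b f) x))"

lemma Cc_smooth_bessel_op: "f \<in> Cc_smooth \<Longrightarrow> bessel_op f \<in> Cc_smooth"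
  unfolding bessel_op_def
  by (rule Cc_smooth_add[OF _ Cc_smooth_sum[OF Cc_smooth_cmult]])
    (auto intro: Cc_smooth_partial_deriv)

lemma fourier_transform_bessel_op:
  fixes f :: "real^'n \<Rightarrow> complex"
  assumes f: "f \<in> Cc_smooth"
  shows "fourier_transform (bessel_op f) \<xi> = complex_of_real (1 + (norm \<xi>)\<^sup>2) * fourier_transform f \<xi>"
proof -
  let ?D = "\<lambda>b. partial_deriv b (partial_deriv b f)"
  have D: "?D b \<in> Cc_smooth" for b
    by (rule Cc_smooth_partial_deriv[OF Cc_smooth_partial_deriv[OF f]])
  have i1: "integrable lborel (\<lambda>x. fourier_kernel (- \<xi>) x * f x)"
    by (intro integrable_fourier_kernel_mult Cc_smooth_integrable f)
  have i2: "integrable lborel (\<lambda>x. fourier_kernel (- \<xi>) x * ?D b x)" for b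
    by (intro integrable_fourier_kernel_mult Cc_smooth_integrable D)
  have "fourier_transform (?D b) \<xi> = - complex_of_real ((\<xi> \<bullet> b)\<^sup>2) * fourier_transform f \<xi>" if b: "b \<in> Basis" for b
  proof -
    have "\<i> * a * (\<i> * a * z) = - (a\<^sup>2) * z" for a z
      by (simp add: power2_eq_square algebra_simps)
    then show ?thesis
      by (simp add: fourier_transform_partial_deriv[OF Cc_smooth_partial_deriv[OF f] b]
          fourier_transform_partial_deriv[OF f b])
  qed
  then have D': "(LINT x|lborel. fourier_kernel (- \<xi>) x * ?D b x) = - complex_of_real ((\<xi> \<bullet> b)\<^sup>2) * fourier_transform f \<xi>"
    if b: "b \<in> Basis" for b using b by (simp add: fourier_transform_eq)
  have "fourier_transform (bessel_op f) \<xi> = (LINT x|lborel. fourier_kernel (- \<xi>) x * f x -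
      (\<Sum>b\<in>Basis. fourier_kernel (- \<xi>) x * ?D b x))"
    by (simp add: fourier_transform_eq bessel_op_def algebra_simps sum_distrib_left sum_negf)
  also have "\<dots> = fourier_transform f \<xi> - (\<Sum>b\<in>Basis. - complex_of_real ((\<xi> \<bullet> b)\<^sup>2) * fourier_transform f \<xi>)"
    using i1 i2 D' by (simp add: fourier_transform_eq)
  also have "\<dots> = complex_of_real (1 + (\<Sum>b\<in>Basis. (\<xi> \<bullet> b)\<^sup>2)) * fourier_transform f \<xi>"
    by (simp add: sum_negf sum_distrib_left algebra_simps)
  also have "(\<Sum>b\<in>Basis. (\<xi> \<bullet> b)\<^sup>2) = (norm \<xi>)\<^sup>2"
    unfolding power2_norm_eq_inner by (subst euclidean_inner[of \<xi> \<xi>]) (simp add: power2_eq_square)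
  finally show ?thesis .
qed

text \<open>
  \<open>(1 + |\<xi>|\<^sup>2)\<^sup>N\<close> times the Fourier transform of \<open>f\<close> is the Fourier transform of \<open>(1 - \<Delta>)\<^sup>N f\<close>, hence
  bounded.
\<close>

lemma fourier_transform_rapid_decay:
  fixes f :: "real^'n \<Rightarrow> complex"
  assumes f: "f \<in> Cc_smooth"
  shows "\<exists>C\<ge>0. \<forall>\<xi>. norm (fourier_transform f \<xi>) \<le> C * (1 + (norm \<xi>)\<^sup>2) powr (- real N)"
proof -
  have Cc: "(bessel_op ^^ N) f \<in> Cc_smooth"
    using f by (induction N) (auto simp: Cc_smooth_bessel_op)
  have ft: "fourier_transform ((bessel_op ^^ N) f) \<xi> = complex_of_real ((1 + (norm \<xi>)\<^sup>2) ^ N) * fourier_transform f \<xi>" for \<xi>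
  proof (induction N)
    case (Suc N)
    have "(bessel_op ^^ N) f \<in> Cc_smooth"
      using f by (induction N) (auto simp: Cc_smooth_bessel_op)
    then show ?case using Suc by (simp add: fourier_transform_bessel_op)
  qed simp
  let ?C = "LINT x|lborel. norm ((bessel_op ^^ N) f x)"
  have "norm (fourier_transform f \<xi>) \<le> ?C * (1 + (norm \<xi>)\<^sup>2) powr (- real N)" for \<xi>
  proof -
    have p: "1 + (norm \<xi>)\<^sup>2 > 0" by (simp add: add_pos_nonneg)
    have "norm (complex_of_real ((1 + (norm \<xi>)\<^sup>2) ^ N) * fourier_transform f \<xi>) \<le> ?C"
      unfolding ft[symmetric] by (rule norm_fourier_transform_le[OF Cc_smooth_integrable[OF Cc]])
    then have "(1 + (norm \<xi>)\<^sup>2) ^ N * norm (fourier_transform f \<xi>) \<le> ?C"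
      unfolding norm_mult norm_of_real using p by simp
    then show ?thesis using p by (simp add: powr_minus powr_realpow field_simps)
  qed
  moreover have "?C \<ge> 0" by simp
  ultimately show ?thesis by blast
qed

section \<open>The heat semigroup and the symbol of the fractional Laplacian\<close>

text \<open>
  Integrating the superposition of Gaussians over \<open>x\<close> first costs the factor \<open>s powr (- d/2)\<close> in
  dimension \<open>d\<close>, so the gamma integral with parameter \<open>b - d/2\<close> remains.
\<close>

lemma integrable_japanese_bracket:
  assumes b: "b > real DIM('a::euclidean_space) / 2"
  shows "integrable lborel (\<lambda>x::'a. (1 + (norm x)\<^sup>2) powr (- b))"
proof -
  let ?d = "real DIM('a) / 2"
  have b0: "b > 0" using b by (smt (verit) of_nat_0_le_iff divide_nonneg_pos)
  have "(\<integral>\<^sup>+s. \<integral>\<^sup>+x. ennreal (norm (gamma_density b s * exp (- s * (norm (x::'a))\<^sup>2))) \<partial>lborel \<partial>lborel)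
      = (\<integral>\<^sup>+s. ennreal (pi powr ?d * gamma_density (b - ?d) s) \<partial>lborel)"
  proof (rule nn_integral_cong)
    fix s :: real
    show "(\<integral>\<^sup>+x. ennreal (norm (gamma_density b s * exp (- s * (norm (x::'a))\<^sup>2))) \<partial>lborel) =
      ennreal (pi powr ?d * gamma_density (b - ?d) s)"
    proof (cases "s > 0")
      case True
      note g = has_bochner_integral_gaussian_mass[OF True, where 'a = 'a]
      have "(\<integral>\<^sup>+x. ennreal (norm (gamma_density b s * exp (- s * (norm (x::'a))\<^sup>2))) \<partial>lborel)
        = (\<integral>\<^sup>+x. ennreal (gamma_density b s * exp (- s * (norm (x::'a))\<^sup>2)) \<partial>lborel)"
        by (simp add: gamma_density_nonneg)
      also have "\<dots> = ennreal (LINT x|lborel. gamma_density b s * exp (- s * (norm (x::'a))\<^sup>2))"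
        using g by (intro nn_integral_eq_integral) (auto simp: has_bochner_integral_iff gamma_density_nonneg)
      also have "(LINT x|lborel. gamma_density b s * exp (- s * (norm (x::'a))\<^sup>2)) =
          gamma_density b s * (pi / s) powr ?d"
        using g by (simp add: has_bochner_integral_iff)
      also have "\<dots> = pi powr ?d * gamma_density (b - ?d) s"
        using True by (simp add: gamma_density_def powr_divide powr_diff mult_ac)
      finally show ?thesis .
    qed (simp add: gamma_density_def)
  qed
  also have "\<dots> = ennreal (LINT s|lborel. pi powr ?d * gamma_density (b - ?d) s)"
    using has_bochner_integral_gamma_density[of "b - ?d"] b
    by (intro nn_integral_eq_integral) (auto simp: has_bochner_integral_iff gamma_density_nonneg)
  also have "\<dots> < \<infinity>" by simp
  finally have fin: "(\<integral>\<^sup>+s. \<integral>\<^sup>+x. ennreal (norm (gamma_density b s * exp (- s * (norm (x::'a))\<^sup>2))) \<partial>lborel \<partial>lborel) < \<infinity>" .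
  have "integrable lborel (\<lambda>x::'a. LINT s|lborel. gamma_density b s * exp (- s * (norm x)\<^sup>2))"
    by (rule lborel_iterated_integrable[OF _ fin]) measurable
  then have "integrable lborel (\<lambda>x::'a. Gamma b * (1 + (norm x)\<^sup>2) powr (- b))"
    using has_bochner_integral_gamma_density_exp[OF b0] by (simp add: has_bochner_integral_iff)
  then show ?thesis
    using Gamma_real_pos[OF b0] by simp
qed

lemma fourier_transform_measurable [measurable]:
  assumes [measurable]: "w \<in> borel_measurable borel"
  shows "fourier_transform w \<in> borel_measurable borel"
  unfolding fourier_transform_def[abs_def] by measurable

lemma Cc_smooth_measurable: "w \<in> Cc_smooth \<Longrightarrow> w \<in> borel_measurable borel"
  by (intro borel_measurable_continuous_onI Cc_smooth_continuous)

lemma norm_powr_le_japanese_bracket: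
  assumes "\<gamma> \<ge> 0"
  shows "norm (x::'a::real_normed_vector) powr (2 * \<gamma>) \<le> (1 + (norm x)\<^sup>2) powr \<gamma>"
proof -
  have "norm x powr (2 * \<gamma>) = ((norm x)\<^sup>2) powr \<gamma>"
    using powr_powr[of "norm x" 2 \<gamma>] by (cases "x = 0") simp_all
  also have "\<dots> \<le> (1 + (norm x)\<^sup>2) powr \<gamma>" using assms by (intro powr_mono2) auto
  finally show ?thesis .
qed

lemma integrable_norm_powr_fourier_transform:
  fixes w :: "real^'n \<Rightarrow> complex"
  assumes w: "w \<in> Cc_smooth" and \<gamma>: "\<gamma> \<ge> 0"
  shows "integrable lborel (\<lambda>\<xi>. complex_of_real (norm \<xi> powr (2 * \<gamma>)) * fourier_transform w \<xi>)"
proof -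
  note [measurable] = Cc_smooth_measurable[OF w]
  \<comment> \<open>enough decay to absorb the symbol and to remain integrable\<close>
  obtain N where N: "real N > real CARD('n) / 2 + \<gamma>" using reals_Archimedean2 by blast
  obtain C where C: "C \<ge> 0" "\<And>\<xi>. norm (fourier_transform w \<xi>) \<le> C * (1 + (norm \<xi>)\<^sup>2) powr (- real N)"
    using fourier_transform_rapid_decay[OF w] by blast
  show ?thesis
  proof (rule Bochner_Integration.integrable_bound)
    show "integrable lborel (\<lambda>\<xi>::real^'n. C * (1 + (norm \<xi>)\<^sup>2) powr (- (real N - \<gamma>)))"
      using N by (intro integrable_mult_right integrable_japanese_bracket) auto
    show "AE \<xi> in lborel. norm (complex_of_real (norm \<xi> powr (2 * \<gamma>)) * fourier_transform w \<xi>)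
      \<le> norm (C * (1 + (norm \<xi>)\<^sup>2) powr (- (real N - \<gamma>)))"
    proof (rule AE_I2)
      fix \<xi> :: "real^'n"
      have "norm (complex_of_real (norm \<xi> powr (2 * \<gamma>)) * fourier_transform w \<xi>)
        \<le> (1 + (norm \<xi>)\<^sup>2) powr \<gamma> * (C * (1 + (norm \<xi>)\<^sup>2) powr (- real N))"
        unfolding norm_mult norm_of_real
        using norm_powr_le_japanese_bracket[OF \<gamma>, of \<xi>] C by (intro mult_mono) auto
      also have "\<dots> = C * (1 + (norm \<xi>)\<^sup>2) powr (- (real N - \<gamma>))"
        by (simp add: powr_add[symmetric] mult.left_commute)
      finally show "norm (complex_of_real (norm \<xi> powr (2 * \<gamma>)) * fourier_transform w \<xi>)
        \<le> norm (C * (1 + (norm \<xi>)\<^sup>2) powr (- (real N - \<gamma>)))" using C(1) by simp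
    qed
  qed measurable
qed

lemma integrable_fourier_transform:
  fixes w :: "real^'n \<Rightarrow> complex"
  assumes w: "w \<in> Cc_smooth"
  shows "integrable lborel (fourier_transform w)"
proof -
  have "AE \<xi>::real^'n in lborel. \<xi> \<noteq> 0" by (rule AE_lborel_singleton)
  then have "AE \<xi>::real^'n in lborel. complex_of_real (norm \<xi> powr (2 * 0)) * fourier_transform w \<xi> = fourier_transform w \<xi>"
    by eventually_elim simp
  then show ?thesis
    using integrable_norm_powr_fourier_transform[OF w, of 0] Cc_smooth_measurable[OF w]
    by (subst integrable_cong_AE[symmetric]) auto
qed

text \<open>
  The weight with which the symbol is built from heat semigroups; \<open>l\<close> stands for \<open>|\<xi>|\<^sup>2\<close>.  The \<open>m\<close>-th
  difference \<open>(1 - exp (- \<tau> l))\<^sup>m\<close> compensates the singularity at \<open>\<tau> = 0\<close> when \<open>m > \<gamma>\<close>.  The extra factor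
  \<open>exp (- \<tau> l)\<close> keeps the time zero, where the kernel would be a point mass, out of the binomial expansion.
\<close>

definition difference_density :: "real \<Rightarrow> nat \<Rightarrow> real \<Rightarrow> real \<Rightarrow> real"
  where "difference_density \<gamma> m l \<tau> =
    indicator {0<..} \<tau> * (\<tau> powr (- \<gamma> - 1) * (exp (- \<tau> * l) * (1 - exp (- \<tau> * l)) ^ m))"

lemma difference_density_nonneg: "l \<ge> 0 \<Longrightarrow> difference_density \<gamma> m l \<tau> \<ge> 0"
  by (auto simp: difference_density_def split: split_indicator)

text \<open>
  The power of \<open>l\<close> comes from rescaling \<open>\<tau>\<close>; the constant is the integral for \<open>l = 1\<close>, which converges
  because \<open>1 - exp (- \<tau>) \<le> \<tau>\<close>.
\<close>

lemma difference_density_integral: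
  assumes m: "real m > \<gamma>" "\<gamma> > 0"
  obtains c where "c > 0" "\<And>l. l \<ge> 0 \<Longrightarrow>
    has_bochner_integral lborel (difference_density \<gamma> m l) (c * l powr \<gamma>)"
proof -
  let ?c = "LINT \<tau>|lborel. difference_density \<gamma> m 1 \<tau>"
  have int: "integrable lborel (difference_density \<gamma> m 1)"
  proof (rule Bochner_Integration.integrable_bound)
    show "integrable lborel (gamma_density (real m - \<gamma>))"
      using has_bochner_integral_gamma_density[of "real m - \<gamma>"] m by (simp add: has_bochner_integral_iff)
    show "AE \<tau> in lborel. norm (difference_density \<gamma> m 1 \<tau>) \<le> norm (gamma_density (real m - \<gamma>) \<tau>)"
    proof (rule AE_I2)
      fix \<tau> :: real
      show "norm (difference_density \<gamma> m 1 \<tau>) \<le> norm (gamma_density (real m - \<gamma>) \<tau>)"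
      proof (cases "\<tau> > 0")
        case True
        have "1 - exp (- \<tau>) \<le> \<tau>" using exp_ge_add_one_self[of "- \<tau>"] by simp
        then have "(1 - exp (- \<tau>)) ^ m \<le> \<tau> ^ m" using True by (intro power_mono) auto
        then have "\<tau> powr (- \<gamma> - 1) * (exp (- \<tau>) * (1 - exp (- \<tau>)) ^ m) \<le> \<tau> powr (- \<gamma> - 1) * (exp (- \<tau>) * \<tau> ^ m)"
          by (intro mult_left_mono) auto
        also have "\<dots> = \<tau> powr (real m - \<gamma> - 1) * exp (- \<tau>)"
          using True by (simp add: powr_realpow[symmetric] powr_add[symmetric] algebra_simps)
        finally show ?thesis using True
          by (simp add: difference_density_def gamma_density_def abs_mult)
      qed (simp add: difference_density_def)
    qed
  qed (unfold difference_density_def, measurable)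
  have "?c \<noteq> 0"
  proof
    assume "?c = 0"
    then have "AE \<tau> in lborel. difference_density \<gamma> m 1 \<tau> = 0"
      using integral_nonneg_eq_0_iff_AE[OF int] by (simp add: difference_density_nonneg)
    then have "AE \<tau>::real in lborel. \<tau> \<notin> {0<..<1}"
      by eventually_elim (auto simp: difference_density_def)
    then have "{0<..<1::real} \<in> null_sets lborel"
      by (subst AE_iff_null_sets) auto
    then show False by (simp add: null_sets_def)
  qed
  moreover have "?c \<ge> 0"
    by (rule integral_nonneg_AE) (simp add: difference_density_nonneg)
  ultimately have c: "?c > 0" by simp
  have "has_bochner_integral lborel (difference_density \<gamma> m l) (?c * l powr \<gamma>)" if l: "l \<ge> 0" for l
  proof (cases "l = 0")
    case True
    have "m > 0" using m by (cases m) auto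
    then show ?thesis using True m
      by (simp add: difference_density_def[abs_def] power_0_left has_bochner_integral_zero)
  next
    case False
    have "has_bochner_integral lborel (\<lambda>\<tau>. difference_density \<gamma> m 1 (0 + l * \<tau>)) (?c /\<^sub>R \<bar>l\<bar>)"
      using int False by (subst lborel_has_bochner_integral_real_affine_iff[symmetric])
        (auto simp: has_bochner_integral_iff)
    then have "has_bochner_integral lborel (\<lambda>\<tau>. l powr (\<gamma> + 1) * difference_density \<gamma> m 1 (0 + l * \<tau>))
        (l powr (\<gamma> + 1) * (?c /\<^sub>R \<bar>l\<bar>))"
      by (intro has_bochner_integral_mult_right) auto
    moreover have "l powr (\<gamma> + 1) * difference_density \<gamma> m 1 (0 + l * \<tau>) = difference_density \<gamma> m l \<tau>" for \<tau>
    proof (cases "\<tau> > 0")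
      case True
      have "l powr (\<gamma> + 1) * l powr (- \<gamma> - 1) = 1"
        using l False by (simp add: powr_add[symmetric])
      then show ?thesis using True l False
        by (simp add: difference_density_def powr_mult mult.commute)
    qed (use l False in \<open>auto simp: difference_density_def zero_less_mult_iff\<close>)
    moreover have "l powr (\<gamma> + 1) * (?c /\<^sub>R \<bar>l\<bar>) = ?c * l powr \<gamma>"
      using l False by (simp add: powr_add)
    ultimately show ?thesis by (simp only:)
  qed
  with c show ?thesis by (rule that)
qed

text \<open>
  After inserting the definition of the Fourier transform of \<open>w\<close>, the integral over \<open>\<xi>\<close> is that of a
  Gaussian; its value at \<open>x - y\<close> is the heat kernel, up to the factor \<open>(2 \<pi>)\<^sup>n\<close>.
\<close>

lemma heat_semigroup:
  fixes w :: "real^'n \<Rightarrow> complex"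
  assumes w: "w \<in> Cc_smooth" and \<tau>: "\<tau> > 0"
  shows "(LINT \<xi>|lborel. fourier_kernel x \<xi> * (complex_of_real (exp (- \<tau> * (norm \<xi>)\<^sup>2)) * fourier_transform w \<xi>)) =
    (LINT y|lborel. complex_of_real ((pi / \<tau>) powr (CARD('n) / 2) * exp (- (norm (x - y))\<^sup>2 / (4 * \<tau>))) * w y)"
proof -
  note [measurable] = Cc_smooth_measurable[OF w]
  let ?f = "\<lambda>\<xi> y. fourier_kernel x \<xi> * (complex_of_real (exp (- \<tau> * (norm \<xi>)\<^sup>2)) * (fourier_kernel (- \<xi>) y * w y))"
  have "(LINT \<xi>|lborel. fourier_kernel x \<xi> * (complex_of_real (exp (- \<tau> * (norm \<xi>)\<^sup>2)) * fourier_transform w \<xi>)) =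
    (LINT \<xi>|lborel. LINT y|lborel. ?f \<xi> y)"
    by (simp add: fourier_transform_eq)
  also have "\<dots> = (LINT y|lborel. LINT \<xi>|lborel. ?f \<xi> y)"
  proof (rule lborel_swap)
    show "(\<lambda>(\<xi>, y). ?f \<xi> y) \<in> borel_measurable (borel \<Otimes>\<^sub>M borel)"
      unfolding fourier_kernel_def by measurable
    show "(\<integral>\<^sup>+\<xi>. \<integral>\<^sup>+y. ennreal (norm (?f \<xi> y)) \<partial>lborel \<partial>lborel) < \<infinity>"
      by (rule nn_integral_product_bound[where g = "\<lambda>\<xi>. exp (- \<tau> * (norm \<xi>)\<^sup>2)" and h = w])
        (use has_bochner_integral_gaussian_mass[OF \<tau>, where 'a = "real^'n"] Cc_smooth_integrable[OF w] in
          \<open>auto simp: norm_mult has_bochner_integral_iff\<close>)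
  qed
  also have "\<dots> = (LINT y|lborel. complex_of_real ((pi / \<tau>) powr (CARD('n) / 2) * exp (- (norm (x - y))\<^sup>2 / (4 * \<tau>))) * w y)"
  proof (intro Bochner_Integration.integral_cong refl)
    fix y
    have f: "?f \<xi> y = (exp (\<i> * complex_of_real ((x - y) \<bullet> \<xi>)) * complex_of_real (exp (- \<tau> * (norm \<xi>)\<^sup>2))) * w y" for \<xi>
      by (simp add: fourier_kernel_def inner_diff_left exp_diff exp_minus inner_commute[of \<xi>]
          algebra_simps divide_inverse)
    show "(LINT \<xi>|lborel. ?f \<xi> y) =
      complex_of_real ((pi / \<tau>) powr (CARD('n) / 2) * exp (- (norm (x - y))\<^sup>2 / (4 * \<tau>))) * w y"
      unfolding f integral_mult_left_zero
        has_bochner_integral_integral_eq[OF has_bochner_integral_gaussian[OF \<tau>, of "x - y"]]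
      by simp
  qed
  finally show ?thesis .
qed

text \<open>
  For \<open>|x| \<ge> 2 R\<close> every point \<open>y\<close> of the support satisfies \<open>|x - y| \<ge> |x|/2\<close>, so the heat kernel is a
  Gaussian tail in \<open>|x|\<close>.
\<close>

lemma heat_semigroup_bound:
  fixes w :: "real^'n \<Rightarrow> complex"
  assumes w: "w \<in> Cc_smooth" and \<tau>: "\<tau> > 0"
    and R: "\<And>y. norm y > R \<Longrightarrow> w y = 0" and x: "norm x \<ge> 2 * R"
  shows "norm (LINT \<xi>|lborel. fourier_kernel x \<xi> * (complex_of_real (exp (- \<tau> * (norm \<xi>)\<^sup>2)) * fourier_transform w \<xi>))
    \<le> (pi / \<tau>) powr (CARD('n) / 2) * exp (- (norm x)\<^sup>2 / (16 * \<tau>)) * (LINT y|lborel. norm (w y))"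
proof -
  let ?K = "(pi / \<tau>) powr (CARD('n) / 2)"
  have le: "norm (complex_of_real (?K * exp (- (norm (x - y))\<^sup>2 / (4 * \<tau>))) * w y)
    \<le> ?K * exp (- (norm x)\<^sup>2 / (16 * \<tau>)) * norm (w y)" for y
  proof (cases "w y = 0")
    case False
    then have "norm y \<le> R" using R[of y] by (auto simp: not_less[symmetric])
    then have "norm x / 2 \<le> norm (x - y)"
      using x norm_triangle_ineq2[of x y] by simp
    then have "(norm x / 2)\<^sup>2 \<le> (norm (x - y))\<^sup>2" by (rule power_mono) simp
    then have "- (norm (x - y))\<^sup>2 / (4 * \<tau>) \<le> - (norm x)\<^sup>2 / (16 * \<tau>)"
      using \<tau> by (simp add: power_divide field_simps)
    then show ?thesis
      unfolding norm_mult norm_of_real by (intro mult_right_mono) (auto simp: abs_mult intro!: mult_left_mono)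
  qed simp
  note [measurable] = Cc_smooth_measurable[OF w]
  have i: "integrable lborel (\<lambda>y. ?K * exp (- (norm x)\<^sup>2 / (16 * \<tau>)) * norm (w y))"
    using Cc_smooth_integrable[OF w] by simp
  have i': "integrable lborel (\<lambda>y. complex_of_real (?K * exp (- (norm (x - y))\<^sup>2 / (4 * \<tau>))) * w y)"
    by (rule Bochner_Integration.integrable_bound[OF i])
      (measurable, use le in \<open>auto intro: order_trans[OF _ abs_ge_self]\<close>)
  have "norm (LINT y|lborel. complex_of_real (?K * exp (- (norm (x - y))\<^sup>2 / (4 * \<tau>))) * w y)
     \<le> (LINT y|lborel. ?K * exp (- (norm x)\<^sup>2 / (16 * \<tau>)) * norm (w y))"
    by (rule Bochner_Integration.integral_norm_bound_integral[OF i' i le])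
  then show ?thesis unfolding heat_semigroup[OF w \<tau>] by simp
qed

section \<open>Decay of the fractional Laplacian\<close>

lemma frac_laplacian_eq:
  "frac_laplacian \<gamma> w x = (LINT \<xi>|lborel. fourier_kernel x \<xi> *
     (complex_of_real (norm \<xi> powr (2 * \<gamma>)) * fourier_transform w \<xi>)) / complex_of_real ((2 * pi) ^ CARD('n))"
  for x :: "real^'n"
  by (simp add: frac_laplacian_def inverse_fourier_transform_def fourier_kernel_def inner_commute)

lemma frac_laplacian_measurable [measurable]:
  assumes [measurable]: "w \<in> borel_measurable borel"
  shows "frac_laplacian \<gamma> w \<in> borel_measurable borel"
  unfolding frac_laplacian_def inverse_fourier_transform_def[abs_def] by measurable

text \<open>
  Each heat semigroup in the binomial expansion of the symbol is bounded by a Gaussian tail, whose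
  exponential factor is largest at the longest time \<open>(m + 1) \<tau>\<close>.  The integral of these bounds against \<open>\<tau> powr (- \<gamma> - 1)\<close> scales
  like \<open>|x| powr (- n - 2 \<gamma>)\<close>.
\<close>

lemma frac_laplacian_decay_off_support:
  fixes w :: "real^'n \<Rightarrow> complex" and \<gamma> :: real
  assumes w: "w \<in> Cc_smooth" and \<gamma>: "\<gamma> > 0" and R: "\<And>y. norm y > R \<Longrightarrow> w y = 0"
  obtains K where "\<And>x. x \<noteq> 0 \<Longrightarrow> norm x \<ge> 2 * R \<Longrightarrow>
    norm (LINT \<xi>|lborel. fourier_kernel x \<xi> * (complex_of_real (norm \<xi> powr (2 * \<gamma>)) * fourier_transform w \<xi>))
      \<le> K * norm x powr (- (real CARD('n) + 2 * \<gamma>))"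
proof -
  note [measurable] = Cc_smooth_measurable[OF w]
  let ?n = "real CARD('n) / 2" and ?W = "fourier_transform w"
  define M where "M = (LINT y|lborel. norm (w y))"
  have M: "M \<ge> 0" by (simp add: M_def)
  \<comment> \<open>the order of the difference has to exceed \<open>\<gamma>\<close>\<close>
  obtain m where m: "real m > \<gamma>" using reals_Archimedean2 by blast
  obtain c where c: "c > 0" "\<And>l. l \<ge> 0 \<Longrightarrow> has_bochner_integral lborel (difference_density \<gamma> m l) (c * l powr \<gamma>)"
    using difference_density_integral[OF m \<gamma>] by blast
  define K where "K = 2 ^ m * pi powr ?n * M * (Gamma (\<gamma> + ?n) * (1 / (16 * (real m + 1))) powr (- (\<gamma> + ?n))) / c"
  have "norm (LINT \<xi>|lborel. fourier_kernel x \<xi> * (complex_of_real (norm \<xi> powr (2 * \<gamma>)) * ?W \<xi>))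
      \<le> K * norm x powr (- (real CARD('n) + 2 * \<gamma>))" (is "norm ?L \<le> _")
    if x: "x \<noteq> 0" "norm x \<ge> 2 * R" for x
  proof -
    let ?f = "\<lambda>\<xi> \<tau>. complex_of_real (difference_density \<gamma> m ((norm \<xi>)\<^sup>2) \<tau>) * (fourier_kernel x \<xi> * ?W \<xi>)"
    let ?q = "(norm x)\<^sup>2 / (16 * (real m + 1))"
    have q: "?q > 0" using x by simp
    have sq: "((norm \<xi>)\<^sup>2) powr \<gamma> = norm \<xi> powr (2 * \<gamma>)" for \<xi> :: "real^'n"
      using powr_powr[of "norm \<xi>" 2 \<gamma>] by (cases "\<xi> = 0") simp_all
    have inner: "(LINT \<tau>|lborel. ?f \<xi> \<tau>) =
        complex_of_real c * (fourier_kernel x \<xi> * (complex_of_real (norm \<xi> powr (2 * \<gamma>)) * ?W \<xi>))" for \<xi>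
    proof -
      have "(LINT \<tau>|lborel. ?f \<xi> \<tau>) =
        complex_of_real (LINT \<tau>|lborel. difference_density \<gamma> m ((norm \<xi>)\<^sup>2) \<tau>) * (fourier_kernel x \<xi> * ?W \<xi>)"
        by simp
      also have "(LINT \<tau>|lborel. difference_density \<gamma> m ((norm \<xi>)\<^sup>2) \<tau>) = c * norm \<xi> powr (2 * \<gamma>)"
        using c(2)[of "(norm \<xi>)\<^sup>2"] by (simp add: has_bochner_integral_iff sq)
      finally show ?thesis by (simp add: mult_ac)
    qed
    have fin: "(\<integral>\<^sup>+\<xi>. \<integral>\<^sup>+\<tau>. ennreal (norm (?f \<xi> \<tau>)) \<partial>lborel \<partial>lborel) < \<infinity>"
    proof -
      have "(\<integral>\<^sup>+\<tau>. ennreal (norm (?f \<xi> \<tau>)) \<partial>lborel) =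
          ennreal (norm (complex_of_real c * (complex_of_real (norm \<xi> powr (2 * \<gamma>)) * ?W \<xi>)))" for \<xi>
      proof -
        have "(\<integral>\<^sup>+\<tau>. ennreal (norm (?f \<xi> \<tau>)) \<partial>lborel) =
          (\<integral>\<^sup>+\<tau>. ennreal (difference_density \<gamma> m ((norm \<xi>)\<^sup>2) \<tau> * norm (?W \<xi>)) \<partial>lborel)"
          by (simp add: norm_mult difference_density_nonneg)
        also have "\<dots> = ennreal (LINT \<tau>|lborel. difference_density \<gamma> m ((norm \<xi>)\<^sup>2) \<tau> * norm (?W \<xi>))"
          using c(2)[of "(norm \<xi>)\<^sup>2"]
          by (intro nn_integral_eq_integral) (auto simp: has_bochner_integral_iff difference_density_nonneg)
        also have "(LINT \<tau>|lborel. difference_density \<gamma> m ((norm \<xi>)\<^sup>2) \<tau> * norm (?W \<xi>)) =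
            c * norm \<xi> powr (2 * \<gamma>) * norm (?W \<xi>)"
          using c(2)[of "(norm \<xi>)\<^sup>2"] by (simp add: has_bochner_integral_iff sq)
        finally show ?thesis using c(1) by (simp add: norm_mult mult_ac)
      qed
      then have "(\<integral>\<^sup>+\<xi>. \<integral>\<^sup>+\<tau>. ennreal (norm (?f \<xi> \<tau>)) \<partial>lborel \<partial>lborel) =
        (\<integral>\<^sup>+\<xi>. ennreal (norm (complex_of_real c * (complex_of_real (norm \<xi> powr (2 * \<gamma>)) * ?W \<xi>))) \<partial>lborel)"
        by simp
      also have "\<dots> < \<infinity>"
        using integrable_mult_right[OF integrable_norm_powr_fourier_transform[OF w less_imp_le[OF \<gamma>]], of "complex_of_real c"]
        by (simp only: integrable_iff_bounded)
      finally show ?thesis .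
    qed
    have fm: "(\<lambda>(\<xi>, \<tau>). ?f \<xi> \<tau>) \<in> borel_measurable (borel \<Otimes>\<^sub>M borel)"
      unfolding difference_density_def by measurable
    define g where "g \<tau> = 2 ^ m * pi powr ?n * M * (indicator {0<..} \<tau> * (\<tau> powr (- (\<gamma> + ?n) - 1) * exp (- ?q / \<tau>)))" for \<tau> :: real
    have gint: "has_bochner_integral lborel g (2 ^ m * pi powr ?n * M * (Gamma (\<gamma> + ?n) * ?q powr (- (\<gamma> + ?n))))"
      unfolding g_def
      by (rule has_bochner_integral_mult_right has_bochner_integral_inverse_gamma)+
        (use \<gamma> q in \<open>auto intro: add_pos_pos\<close>)
    have bound: "norm (LINT \<xi>|lborel. ?f \<xi> \<tau>) \<le> g \<tau>" for \<tau>
    proof (cases "\<tau> > 0")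
      case False then show ?thesis by (simp add: difference_density_def g_def)
    next
      case \<tau>: True
      let ?h = "\<lambda>j \<xi>. fourier_kernel x \<xi> * (complex_of_real (exp (- (real (Suc j) * \<tau>) * (norm \<xi>)\<^sup>2)) * ?W \<xi>)"
      have hint: "integrable lborel (?h j)" for j
      proof (rule integrable_fourier_kernel_mult)
        show "integrable lborel (\<lambda>\<xi>. complex_of_real (exp (- (real (Suc j) * \<tau>) * (norm \<xi>)\<^sup>2)) * ?W \<xi>)"
          by (rule Bochner_Integration.integrable_bound[OF integrable_fourier_transform[OF w]])
            (measurable, use \<tau> in \<open>auto simp: norm_mult mult_left_le_one_le\<close>)
      qed
      have hbound: "norm (LINT \<xi>|lborel. ?h j \<xi>) \<le> (pi / \<tau>) powr ?n * exp (- ?q / \<tau>) * M" if "j \<le> m" for j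
      proof -
        have "norm (LINT \<xi>|lborel. ?h j \<xi>) \<le>
            (pi / (real (Suc j) * \<tau>)) powr ?n * exp (- (norm x)\<^sup>2 / (16 * (real (Suc j) * \<tau>))) * M"
          unfolding M_def using \<tau> by (intro heat_semigroup_bound[OF w _ R x(2)]) auto
        also have "\<dots> \<le> (pi / \<tau>) powr ?n * exp (- ?q / \<tau>) * M"
        proof (intro mult_right_mono mult_mono powr_mono2)
          show "pi / (real (Suc j) * \<tau>) \<le> pi / \<tau>" 
          proof (intro divide_left_mono)
            show "\<tau> \<le> real (Suc j) * \<tau>" using \<tau> by (simp add: mult_le_cancel_right1)
          qed (use \<tau> in auto)
          have "(norm x)\<^sup>2 / (16 * (real m + 1) * \<tau>) \<le> (norm x)\<^sup>2 / (16 * (real (Suc j) * \<tau>))"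
            using \<tau> that by (intro divide_left_mono) (auto intro!: mult_right_mono)
          then show "exp (- (norm x)\<^sup>2 / (16 * (real (Suc j) * \<tau>))) \<le> exp (- ?q / \<tau>)"
            by simp
        qed (use M \<tau> in auto)
        finally show ?thesis .
      qed
      \<comment> \<open>the term of index \<open>j\<close> is a heat semigroup at time \<open>(j + 1) \<tau>\<close>\<close>
      have expand: "?f \<xi> \<tau> = complex_of_real (\<tau> powr (- \<gamma> - 1)) *
          (\<Sum>j\<le>m. of_nat (m choose j) * (- 1) ^ j * ?h j \<xi>)" for \<xi>
      proof -
        let ?z = "exp (- \<tau> * (norm \<xi>)\<^sup>2)"
        have "?z * (1 - ?z) ^ m = ?z * (\<Sum>j\<le>m. of_nat (m choose j) * (- ?z) ^ j)"
          using binomial_ring[of "- ?z" 1 m] by simp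
        also have "\<dots> = (\<Sum>j\<le>m. of_nat (m choose j) * (-1) ^ j * ?z ^ Suc j)"
          unfolding sum_distrib_left by (intro sum.cong refl) (subst power_minus, simp)
        also have "\<dots> = (\<Sum>j\<le>m. of_nat (m choose j) * (-1) ^ j * exp (- (real (Suc j) * \<tau>) * (norm \<xi>)\<^sup>2))"
          by (intro sum.cong refl) (simp only: exp_of_nat_mult[symmetric] mult_ac mult_minus_right mult_minus_left)
        finally have "?f \<xi> \<tau> = complex_of_real (\<tau> powr (- \<gamma> - 1) *
            (\<Sum>j\<le>m. of_nat (m choose j) * (-1) ^ j * exp (- (real (Suc j) * \<tau>) * (norm \<xi>)\<^sup>2))) * (fourier_kernel x \<xi> * ?W \<xi>)"
          using \<tau> by (simp only: difference_density_def) simp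
        then show ?thesis
          by (simp add: sum_distrib_left sum_distrib_right mult_ac)
      qed
      have "norm (LINT \<xi>|lborel. ?f \<xi> \<tau>) = norm (complex_of_real (\<tau> powr (- \<gamma> - 1)) *
          (\<Sum>j\<le>m. of_nat (m choose j) * (- 1) ^ j * (LINT \<xi>|lborel. ?h j \<xi>)))"
        unfolding expand integral_mult_right_zero
        by (subst Bochner_Integration.integral_sum) (intro integrable_mult_right hint, simp)
      also have "\<dots> = \<tau> powr (- \<gamma> - 1) * norm (\<Sum>j\<le>m. of_nat (m choose j) * (- 1) ^ j * (LINT \<xi>|lborel. ?h j \<xi>))"
        by (simp add: norm_mult)
      also have "\<dots> \<le> \<tau> powr (- \<gamma> - 1) * (\<Sum>j\<le>m. real (m choose j) * ((pi / \<tau>) powr ?n * exp (- ?q / \<tau>) * M))"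
      proof (intro mult_left_mono sum_norm_le)
        fix j assume "j \<in> {..m}"
        then show "norm (of_nat (m choose j) * (- 1) ^ j * (LINT \<xi>|lborel. ?h j \<xi>))
            \<le> real (m choose j) * ((pi / \<tau>) powr ?n * exp (- ?q / \<tau>) * M)"
          using mult_left_mono[OF hbound[of j], of "real (m choose j)"]
          by (simp add: norm_mult norm_power)
      qed simp
      also have "\<dots> = \<tau> powr (- \<gamma> - 1) * (2 ^ m * ((pi / \<tau>) powr ?n * exp (- ?q / \<tau>) * M))"
        unfolding sum_distrib_right[symmetric] of_nat_sum[symmetric] choose_row_sum by simp
      also have "\<dots> = g \<tau>"
      proof -
        have "\<tau> powr (- (\<gamma> + ?n) - 1) = \<tau> powr (- \<gamma> - 1) * \<tau> powr (- ?n)"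
          by (simp add: powr_add[symmetric] algebra_simps)
        moreover have "(pi / \<tau>) powr ?n = pi powr ?n * \<tau> powr (- ?n)"
          using \<tau> by (simp add: powr_divide powr_minus_divide)
        ultimately show ?thesis
          using \<tau> by (simp only: g_def) (simp add: mult_ac)
      qed
      finally show ?thesis .
    qed
    have "complex_of_real c * ?L = (LINT \<xi>|lborel. LINT \<tau>|lborel. ?f \<xi> \<tau>)"
      unfolding inner by simp
    also have "\<dots> = (LINT \<tau>|lborel. LINT \<xi>|lborel. ?f \<xi> \<tau>)"
      by (rule lborel_swap[OF fm fin])
    finally have "norm (complex_of_real c * ?L) = norm (LINT \<tau>|lborel. LINT \<xi>|lborel. ?f \<xi> \<tau>)" by simp
    also have "\<dots> \<le> (LINT \<tau>|lborel. g \<tau>)"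
      using gint
      by (intro Bochner_Integration.integral_norm_bound_integral[OF lborel_iterated_integrable[OF fm fin] _ bound])
        (auto simp: has_bochner_integral_iff)
    also have "\<dots> = 2 ^ m * pi powr ?n * M * (Gamma (\<gamma> + ?n) * ?q powr (- (\<gamma> + ?n)))"
      using gint by (simp add: has_bochner_integral_iff)
    also have "?q powr (- (\<gamma> + ?n)) = (1 / (16 * (real m + 1))) powr (- (\<gamma> + ?n)) * norm x powr (- (real CARD('n) + 2 * \<gamma>))"
    proof -
      have "?q powr (- (\<gamma> + ?n)) = (1 / (16 * (real m + 1)) * norm x powr 2) powr (- (\<gamma> + ?n))"
        using x by simp
      also have "\<dots> = (1 / (16 * (real m + 1))) powr (- (\<gamma> + ?n)) * norm x powr (2 * (- (\<gamma> + ?n)))"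
        by (subst powr_mult) (auto simp only: powr_powr)
      also have "2 * (- (\<gamma> + ?n)) = - (real CARD('n) + 2 * \<gamma>)" by simp
      finally show ?thesis .
    qed
    finally show ?thesis using c(1) by (simp add: norm_mult K_def field_simps)
  qed
  then show ?thesis by (rule that)
qed

text \<open>
  Far from the support the previous estimate applies, and on a ball the Fourier integral is bounded by
  the integral of its modulus.
\<close>

lemma frac_laplacian_bound:
  fixes w :: "real^'n \<Rightarrow> complex" and \<gamma> :: real
  assumes w: "w \<in> Cc_smooth" and \<gamma>: "\<gamma> > 0"
  obtains D where "\<And>x. norm (frac_laplacian \<gamma> w x) \<le> D * (1 + (norm x)\<^sup>2) powr (- (real CARD('n) / 2 + \<gamma>))"
proof -
  let ?p = "real CARD('n) / 2 + \<gamma>"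
  let ?L = "\<lambda>x. LINT \<xi>|lborel. fourier_kernel x \<xi> * (complex_of_real (norm \<xi> powr (2 * \<gamma>)) * fourier_transform w \<xi>)"
  have p: "?p > 0" using \<gamma> by (simp add: add_nonneg_pos)
  obtain R where R: "\<And>y. norm y > R \<Longrightarrow> w y = 0" using w by (auto simp: Cc_smooth_def)
  obtain K where K: "\<And>x. x \<noteq> 0 \<Longrightarrow> norm x \<ge> 2 * R \<Longrightarrow> norm (?L x) \<le> K * norm x powr (- (real CARD('n) + 2 * \<gamma>))"
    using frac_laplacian_decay_off_support[OF w \<gamma> R] by blast
  define A where "A = (LINT \<xi>|lborel. norm (complex_of_real (norm \<xi> powr (2 * \<gamma>)) * fourier_transform w \<xi>))"
  have A: "norm (?L x) \<le> A" for x
    using integral_norm_bound[of lborel "\<lambda>\<xi>. fourier_kernel x \<xi> * (complex_of_real (norm \<xi> powr (2 * \<gamma>)) * fourier_transform w \<xi>)"]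
    by (simp add: A_def norm_mult)
  have A0: "A \<ge> 0" by (simp add: A_def)
  define \<rho> where "\<rho> = max 1 (2 * R)"
  define D where "D = A * (1 + \<rho>\<^sup>2) powr ?p + \<bar>K\<bar> * 2 powr ?p"
  have L: "norm (?L x) \<le> D * (1 + (norm x)\<^sup>2) powr (- ?p)" for x
  proof (cases "norm x \<le> \<rho>")
    case True
    have "1 + (norm x)\<^sup>2 \<le> 1 + \<rho>\<^sup>2" using True by (simp add: power_mono)
    then have "(1 + (norm x)\<^sup>2) powr ?p \<le> (1 + \<rho>\<^sup>2) powr ?p" using p by (intro powr_mono2) auto
    then have "A \<le> A * (1 + \<rho>\<^sup>2) powr ?p * (1 + (norm x)\<^sup>2) powr (- ?p)"
      using A0 by (simp add: powr_minus field_simps mult_left_mono add_nonneg_eq_0_iff)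
    also have "\<dots> \<le> D * (1 + (norm x)\<^sup>2) powr (- ?p)"
      unfolding D_def by (intro mult_right_mono) auto
    finally show ?thesis using A[of x] by simp
  next
    case False
    then have x: "x \<noteq> 0" "norm x \<ge> 2 * R" "norm x \<ge> 1" by (auto simp: \<rho>_def)
    have "1 + (norm x)\<^sup>2 \<le> 2 * (norm x)\<^sup>2" using x(3) by (simp add: one_le_power)
    then have "(1 + (norm x)\<^sup>2) powr ?p \<le> (2 * (norm x)\<^sup>2) powr ?p" using p by (intro powr_mono2) auto
    also have "\<dots> = 2 powr ?p * ((norm x powr 2) powr ?p)" using x by (simp add: powr_mult)
    also have "(norm x powr 2) powr ?p = norm x powr (real CARD('n) + 2 * \<gamma>)"
      by (simp only: powr_powr) (simp add: algebra_simps)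
    finally have "norm x powr (- (real CARD('n) + 2 * \<gamma>)) \<le> 2 powr ?p * (1 + (norm x)\<^sup>2) powr (- ?p)"
    proof -
      have inv: "inverse X \<le> c * inverse Y" if "Y \<le> c * X" "X > 0" "Y > 0" for X Y c :: real
        using that by (simp add: field_simps)
      assume "(1 + (norm x)\<^sup>2) powr ?p \<le> 2 powr ?p * norm x powr (real CARD('n) + 2 * \<gamma>)"
      then show ?thesis
        unfolding powr_minus using x by (intro inv) (auto simp: add_nonneg_eq_0_iff)
    qed
    then have "\<bar>K\<bar> * norm x powr (- (real CARD('n) + 2 * \<gamma>)) \<le> \<bar>K\<bar> * (2 powr ?p * (1 + (norm x)\<^sup>2) powr (- ?p))"
      by (intro mult_left_mono) auto
    also have "\<dots> \<le> D * (1 + (norm x)\<^sup>2) powr (- ?p)"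
      unfolding D_def mult.assoc[symmetric] using A0 by (intro mult_right_mono) auto
    finally have "\<bar>K\<bar> * norm x powr (- (real CARD('n) + 2 * \<gamma>)) \<le> D * (1 + (norm x)\<^sup>2) powr (- ?p)" .
    moreover have "K * norm x powr (- (real CARD('n) + 2 * \<gamma>)) \<le> \<bar>K\<bar> * norm x powr (- (real CARD('n) + 2 * \<gamma>))"
      by (intro mult_right_mono) auto
    ultimately show ?thesis using K[OF x(1,2)] by linarith
  qed
  have "norm (frac_laplacian \<gamma> w x) \<le> D / (2 * pi) ^ CARD('n) * (1 + (norm x)\<^sup>2) powr (- ?p)" for x
    using divide_right_mono[OF L[of x], of "(2 * pi) ^ CARD('n)"]
    by (simp add: frac_laplacian_eq norm_divide norm_power norm_mult)
  then show ?thesis by (rule that)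
qed

lemma integrable_frac_laplacian:
  fixes w :: "real^'n \<Rightarrow> complex" and \<gamma> :: real
  assumes w: "w \<in> Cc_smooth" and \<gamma>: "\<gamma> > 0"
  shows "integrable lborel (frac_laplacian \<gamma> w)"
proof -
  obtain D where D: "\<And>x. norm (frac_laplacian \<gamma> w x) \<le> D * (1 + (norm x)\<^sup>2) powr (- (real CARD('n) / 2 + \<gamma>))"
    using frac_laplacian_bound[OF w \<gamma>] by blast
  show ?thesis
  proof (rule Bochner_Integration.integrable_bound)
    show "integrable lborel (\<lambda>x::real^'n. D * (1 + (norm x)\<^sup>2) powr (- (real CARD('n) / 2 + \<gamma>)))"
      using \<gamma> by (intro integrable_mult_right integrable_japanese_bracket) auto
    show "AE x in lborel. norm (frac_laplacian \<gamma> w x) \<le> norm (D * (1 + (norm x)\<^sup>2) powr (- (real CARD('n) / 2 + \<gamma>)))"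
      using D by (intro AE_I2) (auto intro: order_trans[OF _ abs_ge_self])
    show "frac_laplacian \<gamma> w \<in> borel_measurable lborel"
      using frac_laplacian_measurable[OF Cc_smooth_measurable[OF w]] by simp
  qed
qed

section \<open>The fractional Laplacian of the bubble\<close>

text \<open>
  Moves a Gaussian weight from the space side to the frequency side.
\<close>

lemma gaussian_multiplication_formula:
  fixes h :: "real^'n \<Rightarrow> complex"
  assumes h: "integrable lborel h" and s: "s > 0"
  shows "(LINT x|lborel. complex_of_real (exp (- s * (norm x)\<^sup>2)) * (LINT \<xi>|lborel. fourier_kernel x \<xi> * h \<xi>)) =
    (LINT \<xi>|lborel. complex_of_real ((pi / s) powr (real CARD('n) / 2) * exp (- (norm \<xi>)\<^sup>2 / (4 * s))) * h \<xi>)"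
proof -
  have [measurable]: "h \<in> borel_measurable borel" using borel_measurable_integrable[OF h] by simp
  let ?f = "\<lambda>x \<xi>. complex_of_real (exp (- s * (norm x)\<^sup>2)) * (fourier_kernel x \<xi> * h \<xi>)"
  have "(LINT x|lborel. complex_of_real (exp (- s * (norm x)\<^sup>2)) * (LINT \<xi>|lborel. fourier_kernel x \<xi> * h \<xi>)) =
    (LINT x|lborel. LINT \<xi>|lborel. ?f x \<xi>)" by simp
  also have "\<dots> = (LINT \<xi>|lborel. LINT x|lborel. ?f x \<xi>)"
  proof (rule lborel_swap)
    show "(\<lambda>(x, \<xi>). ?f x \<xi>) \<in> borel_measurable (borel \<Otimes>\<^sub>M borel)"
      unfolding fourier_kernel_def by measurable
    show "(\<integral>\<^sup>+x. \<integral>\<^sup>+\<xi>. ennreal (norm (?f x \<xi>)) \<partial>lborel \<partial>lborel) < \<infinity>"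
      by (rule nn_integral_product_bound[where g = "\<lambda>x. exp (- s * (norm x)\<^sup>2)" and h = h])
        (use has_bochner_integral_gaussian_mass[OF s, where 'a = "real^'n"] h in
          \<open>auto simp: norm_mult has_bochner_integral_iff\<close>)
  qed
  also have "\<dots> = (LINT \<xi>|lborel. complex_of_real ((pi / s) powr (real CARD('n) / 2) * exp (- (norm \<xi>)\<^sup>2 / (4 * s))) * h \<xi>)"
  proof (rule Bochner_Integration.integral_cong[OF refl])
    fix \<xi> :: "real^'n"
    have f: "?f x \<xi> = (exp (\<i> * complex_of_real (\<xi> \<bullet> x)) * complex_of_real (exp (- s * (norm x)\<^sup>2))) * h \<xi>" for x
      by (simp add: fourier_kernel_def inner_commute[of x] mult_ac)
    show "(LINT x|lborel. ?f x \<xi>) =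
      complex_of_real ((pi / s) powr (real CARD('n) / 2) * exp (- (norm \<xi>)\<^sup>2 / (4 * s))) * h \<xi>"
      unfolding f integral_mult_left_zero
        has_bochner_integral_integral_eq[OF has_bochner_integral_gaussian[OF s, of \<xi>]]
      by simp
  qed
  finally show ?thesis .
qed

text \<open>
  Dropping the damping factor \<open>e\<close> bounds an integrand by a product of a function of \<open>s\<close> and a function of
  the other variable, which dominates an exchange of integrals.
\<close>

lemma norm_damped_le:
  assumes "s > 0 \<Longrightarrow> 0 \<le> e \<and> e \<le> 1"
  shows "norm (complex_of_real (c * gamma_density p s * e) * z) \<le> norm (c * gamma_density p s) * norm z"
proof (cases "s > 0")
  case True
  then have "norm (c * gamma_density p s * e) \<le> norm (c * gamma_density p s)"
    using assms by (simp add: abs_mult mult_left_le)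
  then have "norm (c * gamma_density p s * e) * norm z \<le> norm (c * gamma_density p s) * norm z"
    by (rule mult_right_mono) simp
  then show ?thesis by (simp only: norm_mult[of "complex_of_real _"] norm_of_real real_norm_def)
qed (simp add: gamma_density_def)

text \<open>
  In the sense of distributions, \<open>(-\<Delta>)\<^sup>\<gamma> (1 + |x|\<^sup>2)\<^sup>-\<^sup>a\<close> is a multiple of \<open>(1 + |x|\<^sup>2)\<^sup>-\<^sup>b\<close>, where
  \<open>a = n/2 - \<gamma>\<close> and \<open>b = n/2 + \<gamma>\<close>.  Written as superpositions of Gaussians on the frequency side, the two
  functions correspond to the two sides of \<open>gamma_density_reflection\<close>.
\<close>

lemma bubble_duality:
  fixes w :: "real^'n \<Rightarrow> complex" and \<gamma> :: real
  assumes w: "w \<in> Cc_smooth" and \<gamma>: "\<gamma> > 0" "\<gamma> < real CARD('n) / 2"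
  shows "integrable lborel (\<lambda>x. complex_of_real ((1 + (norm x)\<^sup>2) powr (- (real CARD('n) / 2 - \<gamma>))) * frac_laplacian \<gamma> w x)"
      (is ?I)
    and "(LINT x|lborel. complex_of_real ((1 + (norm x)\<^sup>2) powr (- (real CARD('n) / 2 - \<gamma>))) * frac_laplacian \<gamma> w x) =
      complex_of_real (4 powr \<gamma> * Gamma (real CARD('n) / 2 + \<gamma>) / Gamma (real CARD('n) / 2 - \<gamma>)) *
      (LINT x|lborel. complex_of_real ((1 + (norm x)\<^sup>2) powr (- (real CARD('n) / 2 + \<gamma>))) * w x)"
proof -
  note wm[measurable] = Cc_smooth_measurable[OF w]
  let ?n = "real CARD('n) / 2" and ?W = "fourier_transform w" and ?g = "frac_laplacian \<gamma> w"
  define a where "a = ?n - \<gamma>"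
  have a: "a > 0" using \<gamma> by (simp add: a_def)
  have gint: "integrable lborel ?g" by (rule integrable_frac_laplacian[OF w \<gamma>(1)])
  have gm[measurable]: "?g \<in> borel_measurable borel" using borel_measurable_integrable[OF gint] by simp
  show ?I
    unfolding a_def[symmetric]
  proof (rule Bochner_Integration.integrable_bound[OF gint])
    show "(\<lambda>x. complex_of_real ((1 + (norm x)\<^sup>2) powr (- a)) * ?g x) \<in> borel_measurable lborel"
      by measurable
    have "(1 + (norm x)\<^sup>2) powr (- a) \<le> 1" for x :: "real^'n"
      using powr_mono[of "- a" 0 "1 + (norm x)\<^sup>2"] a by (simp add: add_nonneg_eq_0_iff)
    then show "AE x in lborel. norm (complex_of_real ((1 + (norm x)\<^sup>2) powr (- a)) * ?g x) \<le> norm (?g x)"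
      by (intro AE_I2) (simp add: norm_mult mult_left_le_one_le)
  qed
  define h where "h \<xi> = complex_of_real (norm \<xi> powr (2 * \<gamma>)) * ?W \<xi>" for \<xi> :: "real^'n"
  have g_eq: "?g x = (LINT \<xi>|lborel. fourier_kernel x \<xi> * h \<xi>) / complex_of_real ((2 * pi) ^ CARD('n))" for x
    unfolding h_def by (rule frac_laplacian_eq)
  have hint: "integrable lborel h"
    unfolding h_def by (rule integrable_norm_powr_fourier_transform[OF w]) (use \<gamma> in auto)
  have Wint: "integrable lborel ?W" by (rule integrable_fourier_transform[OF w])
  define k where "k = pi powr ?n / (2 * pi) ^ CARD('n)"
  have k: "k > 0" by (simp add: k_def)
  have k4: "k * (4 * pi) powr ?n = 1"
  proof -
    have "pi powr ?n * (4 * pi) powr ?n = ((2 * pi) powr 2) powr ?n"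
      by (subst powr_mult[symmetric]) (auto simp: power2_eq_square mult_ac)
    also have "\<dots> = (2 * pi) ^ CARD('n)"
      by (simp only: powr_powr) (simp add: powr_realpow)
    finally show ?thesis by (simp add: k_def)
  qed
  let ?q = "\<lambda>\<xi>::real^'n. (norm \<xi>)\<^sup>2 / 4"
  define J where "J \<xi> = (LINT s|lborel. gamma_density \<gamma> s * exp (- ?q \<xi> / s))" for \<xi> :: "real^'n"
  have reflJ: "has_bochner_integral lborel (\<lambda>s. gamma_density (- \<gamma>) s * exp (- ?q \<xi> / s)) (?q \<xi> powr (- \<gamma>) * J \<xi>)"
    if "\<xi> \<noteq> 0" for \<xi>
    unfolding J_def by (rule gamma_density_reflection[OF \<gamma>(1)]) (use that in simp)
  have qpow: "?q \<xi> powr (- \<gamma>) * norm \<xi> powr (2 * \<gamma>) = 4 powr \<gamma>" if "\<xi> \<noteq> 0" for \<xi>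
  proof -
    have "?q \<xi> powr (- \<gamma>) = (norm \<xi> powr 2 * (1 / 4)) powr (- \<gamma>)" using that by simp
    also have "\<dots> = norm \<xi> powr (- (2 * \<gamma>)) * (1 / 4) powr (- \<gamma>)"
      by (subst powr_mult) (auto simp only: powr_powr, simp)
    also have "(1 / 4) powr (- \<gamma>) = 4 powr \<gamma>"
      by (simp add: powr_minus_divide powr_divide)
    finally show ?thesis using that by (simp add: powr_add[symmetric] mult_ac)
  qed
  have J0: "J \<xi> \<ge> 0" for \<xi>
    unfolding J_def by (rule integral_nonneg_AE) (simp add: gamma_density_nonneg)
  have J1: "J \<xi> \<le> Gamma \<gamma>" if "\<xi> \<noteq> 0" for \<xi>
  proof -
    note g = has_bochner_integral_gamma_density[OF \<gamma>(1)]
    have le: "gamma_density \<gamma> s * exp (- ?q \<xi> / s) \<le> gamma_density \<gamma> s" for s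
      by (cases "s > 0") (auto simp: gamma_density_def intro!: mult_left_le)
    have "J \<xi> \<le> (LINT s|lborel. gamma_density \<gamma> s)"
      unfolding J_def
    proof (rule integral_mono_AE')
      show "integrable lborel (gamma_density \<gamma>)" using g by (simp add: has_bochner_integral_iff)
    qed (use le in \<open>auto simp: gamma_density_nonneg\<close>)
    then show ?thesis using g by (simp add: has_bochner_integral_iff)
  qed
  \<comment> \<open>subordinate the bubble to Gaussians\<close>
  have "complex_of_real (Gamma a) * (LINT x|lborel. complex_of_real ((1 + (norm x)\<^sup>2) powr (- a)) * ?g x) =
      (LINT x|lborel. LINT s|lborel. complex_of_real (gamma_density a s * exp (- s * (norm x)\<^sup>2)) * ?g x)"
  proof -
    have inner: "(LINT s|lborel. complex_of_real (gamma_density a s * exp (- s * (norm x)\<^sup>2)) * ?g x) =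
      complex_of_real (Gamma a) * (complex_of_real ((1 + (norm x)\<^sup>2) powr (- a)) * ?g x)" for x
      unfolding integral_mult_left_zero integral_complex_of_real
        has_bochner_integral_integral_eq[OF has_bochner_integral_gamma_density_exp[OF a zero_le_power2]]
      by (simp add: mult_ac)
    show ?thesis unfolding inner by (rule integral_mult_right_zero[symmetric])
  qed
  also have "\<dots> = (LINT s|lborel. LINT x|lborel. complex_of_real (gamma_density a s * exp (- s * (norm x)\<^sup>2)) * ?g x)"
  proof (rule lborel_swap)
    show "(\<lambda>(x, s). complex_of_real (gamma_density a s * exp (- s * (norm x)\<^sup>2)) * ?g x) \<in> borel_measurable (borel \<Otimes>\<^sub>M borel)"
      by measurable
    show "(\<integral>\<^sup>+x. \<integral>\<^sup>+s. ennreal (norm (complex_of_real (gamma_density a s * exp (- s * (norm x)\<^sup>2)) * ?g x)) \<partial>lborel \<partial>lborel) < \<infinity>"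
    proof (rule nn_integral_product_bound[OF gint])
      show "integrable lborel (gamma_density a)"
        using has_bochner_integral_gamma_density[OF a] by (simp add: has_bochner_integral_iff)
      show "norm (complex_of_real (gamma_density a s * exp (- s * (norm x)\<^sup>2)) * ?g x) \<le> norm (?g x) * norm (gamma_density a s)" for x s
        using norm_damped_le[of s "exp (- s * (norm x)\<^sup>2)" 1 a "?g x"] by (simp add: mult.commute)
    qed
  qed
  \<comment> \<open>pass to the frequency side\<close>
  also have "\<dots> = (LINT s|lborel. LINT \<xi>|lborel. complex_of_real (k * gamma_density (- \<gamma>) s * exp (- ?q \<xi> / s)) * h \<xi>)"
  proof (rule Bochner_Integration.integral_cong[OF refl])
    fix s :: real
    show "(LINT x|lborel. complex_of_real (gamma_density a s * exp (- s * (norm x)\<^sup>2)) * ?g x) =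
      (LINT \<xi>|lborel. complex_of_real (k * gamma_density (- \<gamma>) s * exp (- ?q \<xi> / s)) * h \<xi>)"
    proof (cases "s > 0")
      case False then show ?thesis by (simp add: gamma_density_def)
    next
      case True
      let ?c = "complex_of_real (gamma_density a s / (2 * pi) ^ CARD('n))"
      have "(LINT x|lborel. complex_of_real (gamma_density a s * exp (- s * (norm x)\<^sup>2)) * ?g x) =
        (LINT x|lborel. ?c * (complex_of_real (exp (- s * (norm x)\<^sup>2)) * (LINT \<xi>|lborel. fourier_kernel x \<xi> * h \<xi>)))"
      proof (rule Bochner_Integration.integral_cong[OF refl])
        fix x :: "real^'n"
        have "complex_of_real (A * E) * (L / complex_of_real P) = complex_of_real (A / P) * (complex_of_real E * L)"
          for A E P L by simp
        then show "complex_of_real (gamma_density a s * exp (- s * (norm x)\<^sup>2)) * ?g x =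
            ?c * (complex_of_real (exp (- s * (norm x)\<^sup>2)) * (LINT \<xi>|lborel. fourier_kernel x \<xi> * h \<xi>))"
          unfolding g_eq .
      qed
      also have "\<dots> = ?c * (LINT \<xi>|lborel. complex_of_real ((pi / s) powr ?n * exp (- (norm \<xi>)\<^sup>2 / (4 * s))) * h \<xi>)"
        unfolding integral_mult_right_zero gaussian_multiplication_formula[OF hint True] ..
      also have "\<dots> = (LINT \<xi>|lborel. ?c * (complex_of_real ((pi / s) powr ?n * exp (- (norm \<xi>)\<^sup>2 / (4 * s))) * h \<xi>))"
        by (rule integral_mult_right_zero[symmetric])
      also have "\<dots> = (LINT \<xi>|lborel. complex_of_real (k * gamma_density (- \<gamma>) s * exp (- ?q \<xi> / s)) * h \<xi>)"
      proof (rule Bochner_Integration.integral_cong[OF refl])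
        fix \<xi> :: "real^'n"
        have "gamma_density a s * (pi / s) powr ?n = pi powr ?n * gamma_density (- \<gamma>) s"
        proof -
          have "s powr (a - 1) * s powr (- ?n) = s powr (- \<gamma> - 1)"
            by (simp add: powr_add[symmetric] a_def)
          moreover have "(pi / s) powr ?n = pi powr ?n * s powr (- ?n)"
            using True by (simp add: powr_divide powr_minus_divide)
          ultimately show ?thesis using True by (simp add: gamma_density_def mult_ac)
        qed
        then have "gamma_density a s / (2 * pi) ^ CARD('n) * ((pi / s) powr ?n * exp (- (norm \<xi>)\<^sup>2 / (4 * s))) =
            k * gamma_density (- \<gamma>) s * exp (- ?q \<xi> / s)"
          by (simp add: k_def)
        then show "?c * (complex_of_real ((pi / s) powr ?n * exp (- (norm \<xi>)\<^sup>2 / (4 * s))) * h \<xi>) =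
            complex_of_real (k * gamma_density (- \<gamma>) s * exp (- ?q \<xi> / s)) * h \<xi>"
          by (simp only: mult.assoc[symmetric] of_real_mult[symmetric])
      qed
      finally show ?thesis .
    qed
  qed
  \<comment> \<open>the reflection of the gamma density absorbs the symbol\<close>
  also have "\<dots> = (LINT \<xi>|lborel. LINT s|lborel. complex_of_real (k * gamma_density (- \<gamma>) s * exp (- ?q \<xi> / s)) * h \<xi>)"
  proof (rule lborel_swap[symmetric])
    show "(\<lambda>(\<xi>, s). complex_of_real (k * gamma_density (- \<gamma>) s * exp (- ?q \<xi> / s)) * h \<xi>) \<in> borel_measurable (borel \<Otimes>\<^sub>M borel)"
      unfolding h_def by measurable
    have "(\<integral>\<^sup>+s. ennreal (norm (complex_of_real (k * gamma_density (- \<gamma>) s * exp (- ?q \<xi> / s)) * h \<xi>)) \<partial>lborel)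
        \<le> ennreal (norm (complex_of_real (k * 4 powr \<gamma> * Gamma \<gamma>) * ?W \<xi>))" for \<xi>
    proof (cases "\<xi> = 0")
      case True then show ?thesis by (simp add: h_def)
    next
      case False
      have "(\<integral>\<^sup>+s. ennreal (norm (complex_of_real (k * gamma_density (- \<gamma>) s * exp (- ?q \<xi> / s)) * h \<xi>)) \<partial>lborel)
        = (\<integral>\<^sup>+s. ennreal (k * norm (h \<xi>) * (gamma_density (- \<gamma>) s * exp (- ?q \<xi> / s))) \<partial>lborel)"
        using k by (simp add: norm_mult abs_mult gamma_density_nonneg mult_ac)
      also have "\<dots> = ennreal (LINT s|lborel. k * norm (h \<xi>) * (gamma_density (- \<gamma>) s * exp (- ?q \<xi> / s)))"
        using reflJ[OF False] k
        by (intro nn_integral_eq_integral integrable_mult_right)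
          (auto simp: has_bochner_integral_iff gamma_density_nonneg)
      also have "(LINT s|lborel. k * norm (h \<xi>) * (gamma_density (- \<gamma>) s * exp (- ?q \<xi> / s))) =
          k * norm (h \<xi>) * (?q \<xi> powr (- \<gamma>) * J \<xi>)"
        unfolding integral_mult_right_zero has_bochner_integral_integral_eq[OF reflJ[OF False]] ..
      also have "\<dots> = k * norm (?W \<xi>) * (?q \<xi> powr (- \<gamma>) * norm \<xi> powr (2 * \<gamma>)) * J \<xi>"
        by (simp add: h_def norm_mult mult_ac)
      also have "\<dots> \<le> k * norm (?W \<xi>) * 4 powr \<gamma> * Gamma \<gamma>"
        unfolding qpow[OF False] using J1[OF False] k by (intro mult_left_mono) auto
      also have "\<dots> = norm (complex_of_real (k * 4 powr \<gamma> * Gamma \<gamma>) * ?W \<xi>)"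
        using k Gamma_real_pos[OF \<gamma>(1)] by (simp add: norm_mult abs_mult)
      finally show ?thesis by (simp add: ennreal_leI)
    qed
    then have "(\<integral>\<^sup>+\<xi>. \<integral>\<^sup>+s. ennreal (norm (complex_of_real (k * gamma_density (- \<gamma>) s * exp (- ?q \<xi> / s)) * h \<xi>)) \<partial>lborel \<partial>lborel)
      \<le> (\<integral>\<^sup>+\<xi>. ennreal (norm (complex_of_real (k * 4 powr \<gamma> * Gamma \<gamma>) * ?W \<xi>)) \<partial>lborel)"
      by (intro nn_integral_mono)
    also have "\<dots> < \<infinity>"
      using integrable_mult_right[OF Wint, of "complex_of_real (k * 4 powr \<gamma> * Gamma \<gamma>)"]
      by (simp only: integrable_iff_bounded)
    finally show "(\<integral>\<^sup>+\<xi>. \<integral>\<^sup>+s. ennreal (norm (complex_of_real (k * gamma_density (- \<gamma>) s * exp (- ?q \<xi> / s)) * h \<xi>)) \<partial>lborel \<partial>lborel) < \<infinity>" .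
  qed
  also have "\<dots> = (LINT \<xi>|lborel. LINT s|lborel. complex_of_real (k * 4 powr \<gamma> * gamma_density \<gamma> s * exp (- ?q \<xi> / s)) * ?W \<xi>)"
  proof (rule integral_cong_AE)
    show "(\<lambda>\<xi>. LINT s|lborel. complex_of_real (k * gamma_density (- \<gamma>) s * exp (- ?q \<xi> / s)) * h \<xi>) \<in> borel_measurable lborel"
      unfolding h_def by measurable
    show "(\<lambda>\<xi>. LINT s|lborel. complex_of_real (k * 4 powr \<gamma> * gamma_density \<gamma> s * exp (- ?q \<xi> / s)) * ?W \<xi>) \<in> borel_measurable lborel"
      by measurable
    have eq: "(LINT s|lborel. complex_of_real (k * gamma_density (- \<gamma>) s * exp (- ?q \<xi> / s)) * h \<xi>) =
        (LINT s|lborel. complex_of_real (k * 4 powr \<gamma> * gamma_density \<gamma> s * exp (- ?q \<xi> / s)) * ?W \<xi>)"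
      if "\<xi> \<noteq> 0" for \<xi>
    proof -
      have "(LINT s|lborel. complex_of_real (k * gamma_density (- \<gamma>) s * exp (- ?q \<xi> / s)) * h \<xi>) =
          complex_of_real (k * (?q \<xi> powr (- \<gamma>) * J \<xi>)) * h \<xi>"
        unfolding integral_mult_left_zero integral_complex_of_real mult.assoc integral_mult_right_zero
          has_bochner_integral_integral_eq[OF reflJ[OF that]] ..
      also have "\<dots> = complex_of_real (k * (?q \<xi> powr (- \<gamma>) * norm \<xi> powr (2 * \<gamma>)) * J \<xi>) * ?W \<xi>"
        by (simp add: h_def mult_ac)
      also have "\<dots> = complex_of_real (k * 4 powr \<gamma> * J \<xi>) * ?W \<xi>"
        unfolding qpow[OF that] ..
      also have "\<dots> = (LINT s|lborel. complex_of_real (k * 4 powr \<gamma> * gamma_density \<gamma> s * exp (- ?q \<xi> / s)) * ?W \<xi>)"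
        unfolding integral_mult_left_zero integral_complex_of_real mult.assoc integral_mult_right_zero J_def ..
      finally show ?thesis .
    qed
    show "AE \<xi> in lborel. (LINT s|lborel. complex_of_real (k * gamma_density (- \<gamma>) s * exp (- ?q \<xi> / s)) * h \<xi>) =
        (LINT s|lborel. complex_of_real (k * 4 powr \<gamma> * gamma_density \<gamma> s * exp (- ?q \<xi> / s)) * ?W \<xi>)"
      using AE_lborel_singleton[of "0 :: real^'n"] by eventually_elim (rule eq)
  qed
  also have "\<dots> = (LINT s|lborel. LINT \<xi>|lborel. complex_of_real (k * 4 powr \<gamma> * gamma_density \<gamma> s * exp (- ?q \<xi> / s)) * ?W \<xi>)"
  proof (rule lborel_swap)
    show "(\<lambda>(\<xi>, s). complex_of_real (k * 4 powr \<gamma> * gamma_density \<gamma> s * exp (- ?q \<xi> / s)) * ?W \<xi>) \<in> borel_measurable (borel \<Otimes>\<^sub>M borel)"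
      by measurable
    show "(\<integral>\<^sup>+\<xi>. \<integral>\<^sup>+s. ennreal (norm (complex_of_real (k * 4 powr \<gamma> * gamma_density \<gamma> s * exp (- ?q \<xi> / s)) * ?W \<xi>)) \<partial>lborel \<partial>lborel) < \<infinity>"
    proof (rule nn_integral_product_bound[OF Wint])
      show "integrable lborel (\<lambda>s. k * 4 powr \<gamma> * gamma_density \<gamma> s)"
        using has_bochner_integral_gamma_density[OF \<gamma>(1)] by (simp add: has_bochner_integral_iff)
      show "norm (complex_of_real (k * 4 powr \<gamma> * gamma_density \<gamma> s * exp (- ?q \<xi> / s)) * ?W \<xi>) \<le> norm (?W \<xi>) * norm (k * 4 powr \<gamma> * gamma_density \<gamma> s)" for \<xi> s
        using norm_damped_le[of s "exp (- ?q \<xi> / s)" "k * 4 powr \<gamma>" \<gamma> "?W \<xi>"] by (simp add: mult.commute)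
    qed
  qed
  \<comment> \<open>return to the space side\<close>
  also have "\<dots> = (LINT s|lborel. LINT y|lborel. complex_of_real (4 powr \<gamma> * gamma_density (?n + \<gamma>) s * exp (- s * (norm y)\<^sup>2)) * w y)"
  proof (rule Bochner_Integration.integral_cong[OF refl])
    fix s :: real
    show "(LINT \<xi>|lborel. complex_of_real (k * 4 powr \<gamma> * gamma_density \<gamma> s * exp (- ?q \<xi> / s)) * ?W \<xi>) =
      (LINT y|lborel. complex_of_real (4 powr \<gamma> * gamma_density (?n + \<gamma>) s * exp (- s * (norm y)\<^sup>2)) * w y)"
    proof (cases "s > 0")
      case False then show ?thesis by (simp add: gamma_density_def)
    next
      case True
      let ?c = "complex_of_real (k * 4 powr \<gamma> * gamma_density \<gamma> s)"
      have "(LINT \<xi>|lborel. complex_of_real (k * 4 powr \<gamma> * gamma_density \<gamma> s * exp (- ?q \<xi> / s)) * ?W \<xi>) =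
        (LINT \<xi>|lborel. ?c * (fourier_kernel 0 \<xi> * (complex_of_real (exp (- (1 / (4 * s)) * (norm \<xi>)\<^sup>2)) * ?W \<xi>)))"
        by (intro Bochner_Integration.integral_cong refl) (simp add: fourier_kernel_def)
      also have "\<dots> = ?c * (LINT y|lborel. complex_of_real ((pi / (1 / (4 * s))) powr ?n * exp (- (norm (0 - y))\<^sup>2 / (4 * (1 / (4 * s))))) * w y)"
        unfolding integral_mult_right_zero by (subst heat_semigroup[OF w]) (use True in auto)
      also have "\<dots> = (LINT y|lborel. ?c * (complex_of_real ((pi / (1 / (4 * s))) powr ?n * exp (- (norm (0 - y))\<^sup>2 / (4 * (1 / (4 * s))))) * w y))"
        by (rule integral_mult_right_zero[symmetric])
      also have "\<dots> = (LINT y|lborel. complex_of_real (4 powr \<gamma> * gamma_density (?n + \<gamma>) s * exp (- s * (norm y)\<^sup>2)) * w y)"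
      proof (rule Bochner_Integration.integral_cong[OF refl])
        fix y :: "real^'n"
        have "k * 4 powr \<gamma> * gamma_density \<gamma> s * (pi / (1 / (4 * s))) powr ?n = 4 powr \<gamma> * gamma_density (?n + \<gamma>) s"
        proof -
          have "pi / (1 / (4 * s)) = (4 * pi) * s" by simp
          then have "(pi / (1 / (4 * s))) powr ?n = (4 * pi) powr ?n * s powr ?n"
            using True by (simp only: powr_mult)
          moreover have "s powr (\<gamma> - 1) * s powr ?n = s powr (?n + \<gamma> - 1)"
            by (simp add: powr_add[symmetric] algebra_simps)
          ultimately have "k * 4 powr \<gamma> * gamma_density \<gamma> s * (pi / (1 / (4 * s))) powr ?n =
              (k * (4 * pi) powr ?n) * (4 powr \<gamma> * gamma_density (?n + \<gamma>) s)"
            using True by (simp only: gamma_density_def) (simp add: mult_ac)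
          then show ?thesis by (simp only: k4 mult_1)
        qed
        moreover have "exp (- (norm (0 - y))\<^sup>2 / (4 * (1 / (4 * s)))) = exp (- s * (norm y)\<^sup>2)"
          using True by (simp add: field_simps)
        ultimately have "k * 4 powr \<gamma> * gamma_density \<gamma> s * ((pi / (1 / (4 * s))) powr ?n * exp (- (norm (0 - y))\<^sup>2 / (4 * (1 / (4 * s))))) =
          4 powr \<gamma> * gamma_density (?n + \<gamma>) s * exp (- s * (norm y)\<^sup>2)"
          by (simp only: mult.assoc[symmetric])
        then show "?c * (complex_of_real ((pi / (1 / (4 * s))) powr ?n * exp (- (norm (0 - y))\<^sup>2 / (4 * (1 / (4 * s))))) * w y) =
          complex_of_real (4 powr \<gamma> * gamma_density (?n + \<gamma>) s * exp (- s * (norm y)\<^sup>2)) * w y"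
          by (simp only: mult.assoc[symmetric] of_real_mult[symmetric])
      qed
      finally show ?thesis .
    qed
  qed
  also have "\<dots> = (LINT y|lborel. LINT s|lborel. complex_of_real (4 powr \<gamma> * gamma_density (?n + \<gamma>) s * exp (- s * (norm y)\<^sup>2)) * w y)"
  proof (rule lborel_swap)
    show "(\<lambda>(s, y). complex_of_real (4 powr \<gamma> * gamma_density (?n + \<gamma>) s * exp (- s * (norm y)\<^sup>2)) * w y) \<in> borel_measurable (borel \<Otimes>\<^sub>M borel)"
      by measurable
    show "(\<integral>\<^sup>+s. \<integral>\<^sup>+y. ennreal (norm (complex_of_real (4 powr \<gamma> * gamma_density (?n + \<gamma>) s * exp (- s * (norm y)\<^sup>2)) * w y)) \<partial>lborel \<partial>lborel) < \<infinity>"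
    proof (rule nn_integral_product_bound[OF _ Cc_smooth_integrable[OF w]])
      show "integrable lborel (\<lambda>s. 4 powr \<gamma> * gamma_density (?n + \<gamma>) s)"
        using has_bochner_integral_gamma_density[of "?n + \<gamma>"] \<gamma> by (simp add: has_bochner_integral_iff)
      show "norm (complex_of_real (4 powr \<gamma> * gamma_density (?n + \<gamma>) s * exp (- s * (norm y)\<^sup>2)) * w y) \<le> norm (4 powr \<gamma> * gamma_density (?n + \<gamma>) s) * norm (w y)" for s y
        by (rule norm_damped_le) simp
    qed
  qed
  also have "\<dots> = (LINT y|lborel. complex_of_real (4 powr \<gamma> * Gamma (?n + \<gamma>)) * (complex_of_real ((1 + (norm y)\<^sup>2) powr (- (?n + \<gamma>))) * w y))"
  proof (rule Bochner_Integration.integral_cong[OF refl])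
    fix y :: "real^'n"
    have p: "?n + \<gamma> > 0" using \<gamma> by simp
    have "(LINT s|lborel. complex_of_real (4 powr \<gamma> * gamma_density (?n + \<gamma>) s * exp (- s * (norm y)\<^sup>2)) * w y) =
      (LINT s|lborel. complex_of_real (4 powr \<gamma>) * (complex_of_real (gamma_density (?n + \<gamma>) s * exp (- s * (norm y)\<^sup>2)) * w y))"
      by (simp add: mult_ac)
    also have "\<dots> = complex_of_real (4 powr \<gamma>) * (complex_of_real (Gamma (?n + \<gamma>) * (1 + (norm y)\<^sup>2) powr (- (?n + \<gamma>))) * w y)"
      unfolding integral_mult_right_zero integral_mult_left_zero integral_complex_of_real
        has_bochner_integral_integral_eq[OF has_bochner_integral_gamma_density_exp[OF p zero_le_power2]] ..
    finally show "(LINT s|lborel. complex_of_real (4 powr \<gamma> * gamma_density (?n + \<gamma>) s * exp (- s * (norm y)\<^sup>2)) * w y) =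
      complex_of_real (4 powr \<gamma> * Gamma (?n + \<gamma>)) * (complex_of_real ((1 + (norm y)\<^sup>2) powr (- (?n + \<gamma>))) * w y)"
      by (simp add: mult_ac)
  qed
  also have "\<dots> = complex_of_real (4 powr \<gamma> * Gamma (?n + \<gamma>)) * (LINT y|lborel. complex_of_real ((1 + (norm y)\<^sup>2) powr (- (?n + \<gamma>))) * w y)"
    by (rule integral_mult_right_zero)
  finally show "(LINT x|lborel. complex_of_real ((1 + (norm x)\<^sup>2) powr (- (?n - \<gamma>))) * ?g x) =
      complex_of_real (4 powr \<gamma> * Gamma (?n + \<gamma>) / Gamma (?n - \<gamma>)) *
      (LINT x|lborel. complex_of_real ((1 + (norm x)\<^sup>2) powr (- (?n + \<gamma>))) * w x)"
    using Gamma_real_pos[OF a] unfolding a_def by (simp add: field_simps)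
qed

section \<open>The constants\<close>

text \<open>
  The logarithmic derivative of the ratio is a difference of values of the digamma function, which
  increases strictly.
\<close>

lemma Gamma_half_shift_ratio_less:
  assumes "0 < x" "x < (y::real)"
  shows "Gamma (x + 1/2) / Gamma x < Gamma (y + 1/2) / Gamma y"
proof -
  let ?F = "\<lambda>t::real. ln_Gamma (t + 1/2) - ln_Gamma t"
  have "?F x < ?F y"
  proof (rule DERIV_pos_imp_increasing[OF assms(2)])
    fix t assume "x \<le> t" "t \<le> y"
    then have "t > 0" using assms by simp
    then show "\<exists>d. (?F has_real_derivative d) (at t) \<and> d > 0"
      by (intro exI[of _ "Digamma (t + 1/2) - Digamma t"] conjI)
        (auto intro!: derivative_eq_intros Digamma_real_strict_mono)
  qed
  then have "ln (Gamma (x + 1/2) / Gamma x) < ln (Gamma (y + 1/2) / Gamma y)"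
    using assms by (simp add: ln_Gamma_real_pos ln_div Gamma_real_pos less_imp_neq[symmetric])
  then show ?thesis
    using assms by (subst (asm) ln_less_cancel_iff) (auto intro!: divide_pos_pos Gamma_real_pos)
qed

lemma yamabe_const_pos:
  assumes "0 < \<gamma>" "\<gamma> < real n / 2"
  shows "yamabe_const n \<gamma> > 0"
proof -
  have "Gamma ((real n / 2 + \<gamma>) / 2) > 0" "Gamma ((real n / 2 - \<gamma>) / 2) > 0"
    using assms by (auto intro!: Gamma_real_pos)
  then show ?thesis by (simp add: yamabe_const_def)
qed

lemma Gamma_duplication_real:
  assumes "(x::real) > 0"
  shows "Gamma (2 * x) = 2 powr (2 * x - 1) / sqrt pi * (Gamma x * Gamma (x + 1/2))"
proof -
  have "complex_of_real (Gamma x * Gamma (x + 1/2)) =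
      complex_of_real (exp ((1 - 2 * x) * ln 2) * sqrt pi * Gamma (2 * x))"
  proof -
    have nz: "complex_of_real x \<notin> \<int>\<^sub>\<le>\<^sub>0" "complex_of_real x + 1/2 \<notin> \<int>\<^sub>\<le>\<^sub>0"
      using assms by (auto elim!: nonpos_Ints_cases simp: complex_eq_iff)
    have "Gamma (complex_of_real x) * Gamma (complex_of_real x + 1/2) =
      exp ((1 - 2 * complex_of_real x) * of_real (ln 2)) * of_real (sqrt pi) * Gamma (2 * complex_of_real x)"
      using Gamma_legendre_duplication[OF nz] .
    moreover have "Gamma (complex_of_real x + 1/2) = complex_of_real (Gamma (x + 1/2))"
      using Gamma_complex_of_real[of "x + 1/2"] by simp
    moreover have "Gamma (2 * complex_of_real x) = complex_of_real (Gamma (2 * x))"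
      using Gamma_complex_of_real[of "2 * x"] by simp
    moreover have "exp ((1 - 2 * complex_of_real x) * of_real (ln 2)) = complex_of_real (exp ((1 - 2 * x) * ln 2))"
      by (simp add: exp_of_real[symmetric])
    ultimately show ?thesis by (simp add: Gamma_complex_of_real)
  qed
  then have "Gamma x * Gamma (x + 1/2) = exp ((1 - 2 * x) * ln 2) * sqrt pi * Gamma (2 * x)"
    by (simp only: of_real_eq_iff)
  moreover have "exp ((1 - 2 * x) * ln 2) * 2 powr (2 * x - 1) = 1"
    by (simp add: powr_def exp_add[symmetric] algebra_simps)
  ultimately show ?thesis by (simp add: field_simps)
qed

text \<open>
  The duplication formula, applied to \<open>\<Gamma>(2 x)\<close> and \<open>\<Gamma>(2 y)\<close> with \<open>x = (n/2 - \<gamma>)/2\<close> and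
  \<open>y = (n/2 + \<gamma>)/2\<close>, cancels all powers of 2 and leaves a quotient of two half-shift ratios.
\<close>

lemma yamabe_const_ratio_less_1:
  assumes \<gamma>: "0 < \<gamma>" "\<gamma> < real n / 2"
  shows "yamabe_const n \<gamma> * (Gamma (real n / 2 - \<gamma>) / Gamma (real n / 2 + \<gamma>)) < 1"
proof -
  define x where "x = (real n / 2 - \<gamma>) / 2"
  define y where "y = (real n / 2 + \<gamma>) / 2"
  have xy: "0 < x" "x < y" "2 * x = real n / 2 - \<gamma>" "2 * y = real n / 2 + \<gamma>" "y - x = \<gamma>"
    using \<gamma> by (auto simp: x_def y_def add_divide_distrib diff_divide_distrib)
  have G: "Gamma x > 0" "Gamma y > 0" "Gamma (x + 1/2) > 0" "Gamma (y + 1/2) > 0"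
    using xy by (auto intro!: Gamma_real_pos)
  have pw: "2 powr (2 * \<gamma>) * 2 powr (2 * x - 1) = 2 powr (2 * y - 1)"
    using xy(5) by (simp add: powr_add[symmetric] algebra_simps)
  have "yamabe_const n \<gamma> * (Gamma (2 * x) / Gamma (2 * y)) =
      (2 powr (2 * \<gamma>) * 2 powr (2 * x - 1) / 2 powr (2 * y - 1)) *
      ((Gamma y)\<^sup>2 / (Gamma x)\<^sup>2 * (Gamma x * Gamma (x + 1/2)) / (Gamma y * Gamma (y + 1/2)))"
  proof -
    have "yamabe_const n \<gamma> = 2 powr (2 * \<gamma>) * (Gamma y / Gamma x)\<^sup>2"
      by (simp add: yamabe_const_def x_def y_def)
    moreover have "y > 0" using xy by simp
    ultimately show ?thesis
      by (simp only: Gamma_duplication_real[OF xy(1)] Gamma_duplication_real[OF \<open>y > 0\<close>])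
        (simp add: power_divide mult_ac)
  qed
  also have "\<dots> = (Gamma (x + 1/2) / Gamma x) / (Gamma (y + 1/2) / Gamma y)"
    unfolding pw using G by (simp add: power2_eq_square field_simps)
  also have "\<dots> < 1"
    using Gamma_half_shift_ratio_less[OF xy(1,2)] G by (subst divide_less_eq_1_pos) auto
  finally show ?thesis unfolding xy .
qed

lemma yamabe_bubble_const_gt_1:
  assumes \<gamma>: "0 < \<gamma>" "\<gamma> < real n / 2"
    and C: "C = (yamabe_const n \<gamma> * (Gamma (real n / 2 - \<gamma>) / Gamma (real n / 2 + \<gamma>)))
                  powr (- ((real n - 2 * \<gamma>) / (4 * \<gamma>)))"
  shows "C > 1"
proof -
  let ?k = "yamabe_const n \<gamma> * (Gamma (real n / 2 - \<gamma>) / Gamma (real n / 2 + \<gamma>))"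
  have "?k > 0"
    using yamabe_const_pos[OF \<gamma>] \<gamma> by (intro mult_pos_pos divide_pos_pos Gamma_real_pos) auto
  moreover have "- ((real n - 2 * \<gamma>) / (4 * \<gamma>)) < 0" using \<gamma> by simp
  ultimately have "?k powr (- ((real n - 2 * \<gamma>) / (4 * \<gamma>))) > 1 powr (- ((real n - 2 * \<gamma>) / (4 * \<gamma>)))"
    using yamabe_const_ratio_less_1[OF \<gamma>] by (intro powr_less_mono2_neg) auto
  then show ?thesis by (simp add: C)
qed

text \<open>
  This relation determines \<open>C\<close>: the two sides of the equation have degrees \<open>1\<close> and
  \<open>(n + 2 \<gamma>) / (n - 2 \<gamma>)\<close> in \<open>C\<close>, and the degrees differ by \<open>4 \<gamma> / (n - 2 \<gamma>)\<close>.
\<close>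

lemma yamabe_bubble_const_power:
  assumes \<gamma>: "0 < \<gamma>" "\<gamma> < real n / 2"
    and C: "C = (yamabe_const n \<gamma> * (Gamma (real n / 2 - \<gamma>) / Gamma (real n / 2 + \<gamma>)))
                  powr (- ((real n - 2 * \<gamma>) / (4 * \<gamma>)))"
  shows "yamabe_const n \<gamma> * C powr ((real n + 2 * \<gamma>) / (real n - 2 * \<gamma>)) =
    C * (Gamma (real n / 2 + \<gamma>) / Gamma (real n / 2 - \<gamma>))"
proof -
  let ?k = "yamabe_const n \<gamma> * (Gamma (real n / 2 - \<gamma>) / Gamma (real n / 2 + \<gamma>))"
  have G: "Gamma (real n / 2 - \<gamma>) > 0" "Gamma (real n / 2 + \<gamma>) > 0"
    using \<gamma> by (auto intro!: Gamma_real_pos)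
  have k: "?k > 0"
    using yamabe_const_pos[OF \<gamma>] G by (intro mult_pos_pos divide_pos_pos)
  have "C > 0" using yamabe_bubble_const_gt_1[OF \<gamma> C] by simp
  have "(real n + 2 * \<gamma>) / (real n - 2 * \<gamma>) = 1 + 4 * \<gamma> / (real n - 2 * \<gamma>)"
    using \<gamma> by (simp add: field_simps)
  then have "C powr ((real n + 2 * \<gamma>) / (real n - 2 * \<gamma>)) = C * C powr (4 * \<gamma> / (real n - 2 * \<gamma>))"
    using \<open>C > 0\<close> by (simp add: powr_add)
  also have "C powr (4 * \<gamma> / (real n - 2 * \<gamma>)) = ?k powr (- 1)"
  proof -
    have "- ((real n - 2 * \<gamma>) / (4 * \<gamma>)) * (4 * \<gamma> / (real n - 2 * \<gamma>)) = - 1"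
      using \<gamma> by (simp add: field_simps)
    then show ?thesis unfolding C powr_powr by (simp only:)
  qed
  also have "\<dots> = 1 / ?k" using powr_minus_divide[of ?k 1] powr_one[OF less_imp_le[OF k]] by (simp only:)
  finally show ?thesis
    using yamabe_const_pos[OF \<gamma>] G by (simp add: field_simps)
qed

section \<open>The solution on the cylinder\<close>

lemma smooth_onE:
  assumes "smooth_on X f" "x \<in> X"
  obtains U g where "open U" "x \<in> U" "\<And>k. Ck_on k U g" "\<And>y. y \<in> U \<Longrightarrow> y \<in> X \<Longrightarrow> g y = f y"
proof -
  from assms have "\<exists>U g. open U \<and> x \<in> U \<and> (\<forall>k. Ck_on k U g) \<and> (\<forall>y\<in>U \<inter> X. g y = f y)"
    unfolding smooth_on_def by (rule bspec)
  then obtain U g where Ug: "open U" "x \<in> U" "\<forall>k. Ck_on k U g" "\<forall>y\<in>U \<inter> X. g y = f y"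
    by (elim exE conjE)
  show ?thesis
    by (rule that[OF Ug(1,2) spec[OF Ug(3)] bspec[OF Ug(4) IntI]])
qed

lemma smooth_on_imp_continuous_on:
  assumes "smooth_on X f"
  shows "continuous_on X f"
  unfolding continuous_on_eq_continuous_within
proof
  fix x assume x: "x \<in> X"
  obtain U g where U: "open U" "x \<in> U" "\<And>k. Ck_on k U g" "\<And>y. y \<in> U \<Longrightarrow> y \<in> X \<Longrightarrow> g y = f y"
    using smooth_onE[OF assms x] by metis
  have "continuous_on (X \<inter> U) g"
    by (rule continuous_on_subset[OF Ck_on_imp_continuous[OF U(3)]]) simp
  then have "continuous_on (X \<inter> U) f"
    by (rule continuous_on_cong[THEN iffD1, OF refl, rotated]) (use U(4) in auto)
  then have "continuous (at x within (X \<inter> U)) f"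
    using x U(2) by (simp add: continuous_on_eq_continuous_within)
  moreover have "at x within (X \<inter> U) = at x within X"
    by (rule at_within_nhd[OF U(2,1)]) auto
  ultimately show "continuous (at x within X) f" by simp
qed

lemma measurable_cylinder_measure_continuous:
  fixes f :: "real \<times> (real^'n) \<Rightarrow> complex"
  assumes "continuous_on cylinder f"
  shows "f \<in> borel_measurable cylinder_measure"
  using borel_measurable_continuous_on_restrict[OF assms]
  by (simp add: measurable_cong_sets[OF sets_cylinder_measure refl])

lemma log_polar_in_cylinder: "x \<noteq> 0 \<Longrightarrow> log_polar x \<in> cylinder"
  by (simp add: cylinder_def log_polar_def)

lemma euclidean_lift_eq:
  "euclidean_lift \<gamma> \<phi> x = (norm x powr (- ((real CARD('n) - 2 * \<gamma>) / 2))) *\<^sub>R \<phi> (log_polar x)"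
  for x :: "real^'n"
  by (simp add: euclidean_lift_def log_polar_def scaleR_conv_of_real)

text \<open>
  The support of a test function is bounded in \<open>t\<close>, so the lift is supported in an annulus.  Near the
  origin it vanishes, and elsewhere it is a composition of smooth functions.
\<close>

lemma euclidean_lift_Cc_smooth:
  fixes \<phi> :: "real \<times> (real^'n) \<Rightarrow> complex"
  assumes \<phi>: "\<phi> \<in> test_functions"
  shows "euclidean_lift \<gamma> \<phi> \<in> Cc_smooth"
proof -
  let ?w = "euclidean_lift \<gamma> \<phi>"
  obtain K where K: "compact K" "\<And>z. z \<in> cylinder - K \<Longrightarrow> \<phi> z = 0"
    and sm: "smooth_on cylinder \<phi>"
    using \<phi> by (auto simp: test_functions_def)
  have "bounded (fst ` K)"
    using K(1) by (intro bounded_fst compact_imp_bounded)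
  then obtain T where T: "\<And>z. z \<in> K \<Longrightarrow> \<bar>fst z\<bar> \<le> T"
    by (auto simp: bounded_iff)
  have zero: "?w x = 0" if "norm x < exp (- T) \<or> norm x > exp T" for x
  proof (cases "x = 0")
    case False
    have "ln (norm x) < - T \<or> ln (norm x) > T"
      using that False ln_less_cancel_iff[of "norm x" "exp (- T)"] ln_less_cancel_iff[of "exp T" "norm x"] by simp
    then have "\<bar>fst (log_polar x)\<bar> > T"
      by (auto simp: log_polar_def)
    then have "log_polar x \<notin> K" using T[of "log_polar x"] by auto
    then show ?thesis using log_polar_in_cylinder[OF False] K(2) by (simp add: euclidean_lift_eq)
  qed (simp add: euclidean_lift_def)
  have "Ck_on k UNIV ?w" for k
  proof (rule Ck_on_local)
    fix x :: "real^'n"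
    show "\<exists>W. open W \<and> x \<in> W \<and> Ck_on k W ?w"
    proof (cases "x = 0")
      case True
      have "Ck_on k (ball 0 (exp (- T))) ?w"
        by (rule Ck_on_cong[OF open_ball _ Ck_on_const[where c = 0]]) (simp add: zero)
      then show ?thesis using True by (intro exI[of _ "ball 0 (exp (- T))"]) simp
    next
      case False
      obtain U g where U: "open U" "log_polar x \<in> U" "\<And>k. Ck_on k U g"
        "\<And>z. z \<in> U \<Longrightarrow> z \<in> cylinder \<Longrightarrow> g z = \<phi> z"
        using smooth_onE[OF sm log_polar_in_cylinder[OF False]] by metis
      have lp: "Ck_on j (- {0}) (log_polar :: real^'n \<Rightarrow> _)" for j
        using Ck_on_log_polar by (simp add: log_polar_def[abs_def])
      define W where "W = - {0} \<inter> log_polar -` U"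
      have W: "open W" "x \<in> W" "W \<subseteq> - {0}"
        unfolding W_def using U(2) False
        by (auto intro!: continuous_open_preimage[OF Ck_on_imp_continuous[OF lp] _ U(1)])
      have "Ck_on k W (\<lambda>y. norm y powr (- ((real CARD('n) - 2 * \<gamma>) / 2)))"
        by (rule Ck_on_compose[OF W(1) Ck_on_subset[OF Ck_on_norm W(3)] Ck_on_powr]) (use W(3) in auto)
      moreover have "Ck_on k W (\<lambda>y. g (log_polar y))"
        by (rule Ck_on_compose[OF W(1) Ck_on_subset[OF lp W(3)] U(3)]) (auto simp: W_def)
      ultimately have "Ck_on k W (\<lambda>y. norm y powr (- ((real CARD('n) - 2 * \<gamma>) / 2)) *\<^sub>R g (log_polar y))"
        by (rule Ck_on_scaleR[OF W(1)])
      then have "Ck_on k W ?w"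
        by (rule Ck_on_cong[OF W(1), rotated])
          (auto simp: euclidean_lift_eq W_def U(4)[OF _ log_polar_in_cylinder])
      then show ?thesis using W by blast
    qed
  qed
  moreover have "\<forall>x. norm x > exp T \<longrightarrow> ?w x = 0" using zero by blast
  ultimately show ?thesis unfolding Cc_smooth_def by blast
qed

text \<open>
  The profile \<open>cosh t powr (- a)\<close> at \<open>t = - ln r\<close> is the bubble, up to powers of \<open>2\<close> and \<open>r\<close>.
\<close>

lemma cosh_ln_powr:
  fixes r a :: real
  assumes "r > 0"
  shows "cosh (- ln r) powr (- a) = 2 powr a * r powr a * (1 + r\<^sup>2) powr (- a)"
proof -
  have "cosh (- ln r) = (1 + r\<^sup>2) * inverse (2 * r)"
    using assms by (simp add: cosh_def exp_minus power2_eq_square field_simps)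
  moreover have "inverse (2 * r) powr (- a) = 2 powr a * r powr a"
  proof -
    have "inverse (2 * r) powr (- a) = inverse ((2 * r) powr (- a))"
      by (rule inverse_powr)
    also have "\<dots> = (2 * r) powr a" by (simp only: powr_minus inverse_inverse_eq)
    finally show ?thesis using assms by (simp add: powr_mult)
  qed
  moreover have "((1 + r\<^sup>2) * inverse (2 * r)) powr (- a) = (1 + r\<^sup>2) powr (- a) * inverse (2 * r) powr (- a)"
    by (rule powr_mult)
  ultimately show ?thesis by (simp only: mult.commute)
qed

theorem proposition6p1:
  fixes \<gamma> C :: real and n :: nat and v :: "real \<Rightarrow> real"
    and V :: "real \<times> (real ^ 'n::finite) \<Rightarrow> real"
  assumes n: "n = CARD('n)" "n \<ge> 2"
    and \<gamma>: "0 < \<gamma>" "\<gamma> < real n / 2"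
    and C: "C = (yamabe_const n \<gamma> * (Gamma (real n / 2 - \<gamma>) / Gamma (real n / 2 + \<gamma>)))
                  powr (- ((real n - 2 * \<gamma>) / (4 * \<gamma>)))"
    and v: "v = (\<lambda>t. C * cosh t powr (- ((real n - 2 * \<gamma>) / 2)))"
    and V: "V = (\<lambda>(t, \<theta>). v t)"
  shows "(\<forall>t. v t > 0)
    \<and> smooth_on cylinder V
    \<and> has_conf_frac_laplacian \<gamma> V
        (\<lambda>z. yamabe_const n \<gamma> * V z powr ((real n + 2 * \<gamma>) / (real n - 2 * \<gamma>)))
    \<and> C > 1"
proof -
  define a where "a = real n / 2 - \<gamma>"
  define b where "b = real n / 2 + \<gamma>"
  define p where "p = (real n + 2 * \<gamma>) / (real n - 2 * \<gamma>)"
  let ?\<kappa> = "yamabe_const n \<gamma>"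
  have ab: "a > 0" "b > 0" "a + b = real n" "a * p = b" "b = a + 2 * \<gamma>"
    "(real n - 2 * \<gamma>) / 2 = a" "(real n + 2 * \<gamma>) / 2 = b"
    using \<gamma> by (auto simp: a_def b_def p_def field_simps)
  have C1: "C > 1" using \<gamma> C by (rule yamabe_bubble_const_gt_1)
  have v_eq: "v = (\<lambda>t. C * cosh t powr (- a))" unfolding v ab ..
  have V_eq: "V z = C * cosh (fst z) powr (- a)" for z by (simp add: V v_eq split: prod.splits)
  have vpos: "v t > 0" for t using C1 by (simp add: v_eq)
  have Vpos: "V z > 0" for z using C1 by (simp add: V_eq)
  have "Ck_on k UNIV V" for k
  proof -
    have "Ck_on k UNIV (fst :: real \<times> (real^'n) \<Rightarrow> real)"
      by (rule Ck_on_bounded_linear) (rule bounded_linear_fst)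
    then have "Ck_on k UNIV (\<lambda>z :: real \<times> (real^'n). cosh (fst z))"
      by (rule Ck_on_compose[OF open_UNIV _ Ck_on_cosh]) simp
    then have "Ck_on k UNIV (\<lambda>z :: real \<times> (real^'n). cosh (fst z) powr (- a))"
      by (rule Ck_on_compose[OF open_UNIV _ Ck_on_powr]) simp
    then have "Ck_on k UNIV (\<lambda>z :: real \<times> (real^'n). C *\<^sub>R cosh (fst z) powr (- a))"
      by (rule Ck_on_scaleR[OF open_UNIV Ck_on_const])
    then show ?thesis by (simp add: V_eq[abs_def])
  qed
  then have smooth: "smooth_on cylinder V"
    unfolding smooth_on_def by (blast intro: open_UNIV)
  have "V z \<le> C" for z
  proof -
    have "cosh (fst z) powr (- a) \<le> cosh (fst z) powr 0"
      using ab cosh_real_ge_1 by (intro powr_mono) auto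
    then show ?thesis using C1 by (simp add: V_eq)
  qed
  then have bdd: "bounded (V ` cylinder)"
    using Vpos by (intro boundedI[of _ C]) (auto simp: less_imp_le)
  have Vcont: "continuous_on UNIV V"
    unfolding V_eq[abs_def] by (intro continuous_intros) auto
  have VL: "V (log_polar y) = C * 2 powr a * norm y powr a * (1 + (norm y)\<^sup>2) powr (- a)"
    if "y \<noteq> 0" for y :: "real^'n"
    using that cosh_ln_powr[of "norm y" a] by (simp add: V_eq log_polar_def)
  have VLp: "V (log_polar y) powr p = C powr p * 2 powr b * norm y powr b * (1 + (norm y)\<^sup>2) powr (- b)"
    if "y \<noteq> 0" for y :: "real^'n"
  proof -
    have "V (log_polar y) powr p = C powr p * (2 powr a) powr p * (norm y powr a) powr p *
        ((1 + (norm y)\<^sup>2) powr (- a)) powr p"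
      unfolding VL[OF that] using C1 by (simp add: powr_mult)
    then show ?thesis by (simp add: powr_powr ab)
  qed
  have const: "?\<kappa> * C powr p * 2 powr b = C * 2 powr a * (4 powr \<gamma> * Gamma b / Gamma a)"
  proof -
    have "?\<kappa> * C powr p = C * (Gamma b / Gamma a)"
      unfolding p_def a_def b_def by (rule yamabe_bubble_const_power[OF \<gamma> C])
    moreover have "2 powr b = 2 powr a * 4 powr \<gamma>"
      using powr_powr[of 2 2 \<gamma>] by (simp add: ab(5) powr_add)
    ultimately show ?thesis by simp
  qed
  have "integrable cylinder_measure (\<lambda>z. complex_of_real (?\<kappa> * V z powr p) * \<phi> z) \<and>
      integrable cylinder_measure (\<lambda>z. complex_of_real (V z) * conf_frac_laplacian \<gamma> \<phi> z) \<and>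
      (LINT z|cylinder_measure. complex_of_real (?\<kappa> * V z powr p) * \<phi> z) =
      (LINT z|cylinder_measure. complex_of_real (V z) * conf_frac_laplacian \<gamma> \<phi> z)"
    if \<phi>: "\<phi> \<in> test_functions" for \<phi> :: "real \<times> (real^'n) \<Rightarrow> complex"
  proof -
    define w where "w = euclidean_lift \<gamma> \<phi>"
    let ?g = "frac_laplacian \<gamma> w"
    have w: "w \<in> Cc_smooth" unfolding w_def by (rule euclidean_lift_Cc_smooth[OF \<phi>])
    note [measurable] = Cc_smooth_measurable[OF w]
    have \<gamma>n: "\<gamma> < real CARD('n) / 2" using \<gamma> n by simp
    have ab': "real CARD('n) / 2 - \<gamma> = a" "real CARD('n) / 2 + \<gamma> = b"
      by (simp_all add: a_def b_def n(1))
    note dual = bubble_duality[OF w \<gamma>(1) \<gamma>n, unfolded ab']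
    let ?F = "\<lambda>z. complex_of_real (?\<kappa> * V z powr p) * \<phi> z"
    let ?G = "\<lambda>z. complex_of_real (V z) * conf_frac_laplacian \<gamma> \<phi> z"
    have w_eq: "w y = norm y powr (- a) *\<^sub>R \<phi> (log_polar y)" for y
      by (simp add: w_def euclidean_lift_eq ab(6) flip: n(1))
    have "continuous_on cylinder \<phi>"
      using \<phi> by (intro smooth_on_imp_continuous_on) (simp add: test_functions_def)
    then have Fm: "?F \<in> borel_measurable cylinder_measure"
      using Vpos less_imp_neq[OF Vpos]
      by (intro measurable_cylinder_measure_continuous continuous_intros continuous_on_subset[OF Vcont])
        (auto simp: less_imp_neq[symmetric])
    have FL: "norm y powr (- real CARD('n)) *\<^sub>R ?F (log_polar y) =
        complex_of_real (?\<kappa> * C powr p * 2 powr b) * (complex_of_real ((1 + (norm y)\<^sup>2) powr (- b)) * w y)" for y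
    proof (cases "y = 0")
      case False
      have N: "norm y powr (- real CARD('n)) * norm y powr b = norm y powr (- a)"
      proof -
        have "- real CARD('n) + b = - a" using ab(3) n(1) by linarith
        then show ?thesis by (simp only: powr_add[symmetric])
      qed
      have "norm y powr (- real CARD('n)) *\<^sub>R ?F (log_polar y) =
          complex_of_real (norm y powr (- real CARD('n)) * (?\<kappa> * V (log_polar y) powr p)) * \<phi> (log_polar y)"
        by (simp add: scaleR_conv_of_real)
      also have "norm y powr (- real CARD('n)) * (?\<kappa> * V (log_polar y) powr p) =
          (?\<kappa> * C powr p * 2 powr b) * (1 + (norm y)\<^sup>2) powr (- b) * norm y powr (- a)"
        unfolding VLp[OF False] N[symmetric] by (simp only: mult_ac)
      also have "complex_of_real \<dots> * \<phi> (log_polar y) =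
          complex_of_real (?\<kappa> * C powr p * 2 powr b) * (complex_of_real ((1 + (norm y)\<^sup>2) powr (- b)) * w y)"
        by (simp add: w_eq scaleR_conv_of_real)
      finally show ?thesis .
    qed (simp add: w_def euclidean_lift_def)
    have wint: "integrable lborel (\<lambda>y. complex_of_real ((1 + (norm y)\<^sup>2) powr (- b)) * w y)"
    proof (rule Bochner_Integration.integrable_bound[OF Cc_smooth_integrable[OF w]])
      have "(1 + (norm x)\<^sup>2) powr (- b) \<le> 1" for x :: "real^'n"
        using powr_mono[of "- b" 0 "1 + (norm x)\<^sup>2"] ab by (simp add: add_nonneg_eq_0_iff)
      then show "AE x in lborel. norm (complex_of_real ((1 + (norm x)\<^sup>2) powr (- b)) * w x) \<le> norm (w x)"
        by (intro AE_I2) (simp add: norm_mult mult_left_le_one_le)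
    qed measurable
    have Fint: "integrable cylinder_measure ?F"
      unfolding integrable_cylinder_measure_iff[OF Fm] FL by (rule integrable_mult_right[OF wint])
    have Gb: "?G \<in> borel_measurable borel"
    proof -
      have "(\<lambda>z :: real \<times> (real^'n). exp (- fst z) *\<^sub>R snd z) \<in> borel_measurable borel"
        by (intro borel_measurable_continuous_onI continuous_intros)
      then have "(\<lambda>z :: real \<times> (real^'n). ?g (exp (- fst z) *\<^sub>R snd z)) \<in> borel_measurable borel"
        by (rule measurable_compose[OF _ frac_laplacian_measurable[OF Cc_smooth_measurable[OF w]]])
      moreover have "(\<lambda>z :: real \<times> (real^'n). complex_of_real (exp (- fst z) powr b)) \<in> borel_measurable borel"
        by (intro borel_measurable_continuous_onI continuous_intros) auto
      moreover have "(\<lambda>z. complex_of_real (V z)) \<in> borel_measurable borel"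
        by (intro borel_measurable_continuous_onI continuous_intros Vcont)
      ultimately have "(\<lambda>z. complex_of_real (V z) * (complex_of_real (exp (- fst z) powr b) * ?g (exp (- fst z) *\<^sub>R snd z))) \<in>
          borel_measurable borel"
        by (intro borel_measurable_times)
      moreover have "?G = (\<lambda>z. complex_of_real (V z) * (complex_of_real (exp (- fst z) powr b) * ?g (exp (- fst z) *\<^sub>R snd z)))"
        by (simp add: fun_eq_iff conf_frac_laplacian_def Let_def w_def ab(7) flip: n(1))
      ultimately show ?thesis by (simp only:)
    qed
    then have Gm: "?G \<in> borel_measurable cylinder_measure"
      using measurable_restrict_space1[OF Gb, of cylinder]
      by (simp only: measurable_cong_sets[OF sets_cylinder_measure refl])
    let ?H = "\<lambda>y. complex_of_real (C * 2 powr a) * (complex_of_real ((1 + (norm y)\<^sup>2) powr (- a)) * ?g y)"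
    have GL0: "norm y powr (- real CARD('n)) *\<^sub>R ?G (log_polar y) = ?H y" if "y \<noteq> 0" for y :: "real^'n"
    proof -
      have P: "conf_frac_laplacian \<gamma> \<phi> (log_polar y) = complex_of_real (norm y powr b) * ?g y"
        using that by (simp add: conf_frac_laplacian_def log_polar_def w_def ab(7) flip: n(1))
      have N: "norm y powr (- real CARD('n)) * norm y powr a * norm y powr b = 1"
      proof -
        have "- real CARD('n) + a + b = 0" using ab(3) n(1) by linarith
        then show ?thesis using that by (simp only: powr_add[symmetric]) simp
      qed
      have "norm y powr (- real CARD('n)) *\<^sub>R ?G (log_polar y) =
          complex_of_real (norm y powr (- real CARD('n)) * (V (log_polar y) * norm y powr b)) * ?g y"
        unfolding P by (simp add: scaleR_conv_of_real)
      also have "norm y powr (- real CARD('n)) * (V (log_polar y) * norm y powr b) =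
          C * 2 powr a * (1 + (norm y)\<^sup>2) powr (- a) * (norm y powr (- real CARD('n)) * norm y powr a * norm y powr b)"
        unfolding VL[OF that] by (simp only: mult_ac)
      also have "\<dots> = C * 2 powr a * (1 + (norm y)\<^sup>2) powr (- a)"
        unfolding N by simp
      finally show ?thesis by simp
    qed
    have GL: "AE y in lborel. norm y powr (- real CARD('n)) *\<^sub>R ?G (log_polar y) = ?H y"
      using AE_lborel_singleton[of "0 :: real^'n"] by eventually_elim (rule GL0)
    have GLm: "(\<lambda>y. norm y powr (- real CARD('n)) *\<^sub>R ?G (log_polar y)) \<in> borel_measurable lborel"
      using measurable_compose[OF log_polar_measurable Gb] by simp
    have Hm: "?H \<in> borel_measurable lborel" by measurable
    have Gint: "integrable cylinder_measure ?G"
      unfolding integrable_cylinder_measure_iff[OF Gm] integrable_cong_AE[OF GLm Hm GL]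
      by (rule integrable_mult_right[OF dual(1)])
    have "(LINT z|cylinder_measure. ?F z) =
        complex_of_real (?\<kappa> * C powr p * 2 powr b) * (LINT y|lborel. complex_of_real ((1 + (norm y)\<^sup>2) powr (- b)) * w y)"
      unfolding integral_cylinder_measure[OF Fm] FL by (rule integral_mult_right_zero)
    also have "\<dots> = complex_of_real (C * 2 powr a) * (LINT y|lborel. complex_of_real ((1 + (norm y)\<^sup>2) powr (- a)) * ?g y)"
      unfolding const dual(2) by simp
    also have "\<dots> = (LINT y|lborel. ?H y)"
      by (rule integral_mult_right_zero[symmetric])
    also have "\<dots> = (LINT z|cylinder_measure. ?G z)"
      unfolding integral_cylinder_measure[OF Gm] by (rule integral_cong_AE[OF GLm Hm GL, symmetric])
    finally show ?thesis using Fint Gint by blast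
  qed
  then have "has_conf_frac_laplacian \<gamma> V (\<lambda>z. ?\<kappa> * V z powr p)"
    unfolding has_conf_frac_laplacian_def using smooth bdd by blast
  then show ?thesis using vpos smooth C1 unfolding p_def by blast
qed

end
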